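(* Let $M_1$ and $M_2$ be odd dimensional smooth manifolds, let $H_i$ be a real closed $3$-form on $M_i$ ($i=1,2$; the untwisted case is $H_1=H_2=0$), and let $(\Phi_i,E_{\pm,i},G_i)$ be an $H_i$-twisted generalized contact metric structure on $M_i$, $i=1,2$. On $M_1\times M_2$ let $\widetilde H=H_1+H_2$ (sum of pullbacks), let $G=G_1\times G_2$ be the product generalized metric, i.e. $G(v_1,v_2)=(G_1v_1,G_2v_2)$, let $\mathcal J_1$ be the generalized almost complex structure $$\mathcal J_1(v_1,v_2)=\big(\Phi_1(v_1)-2\langle E_{+,2},v_2\rangle E_{+,1}-2\langle E_{-,2},v_2\rangle E_{-,1},\ \ \Phi_2(v_2)+2\langle E_{+,1},v_1\rangle E_{+,2}+2\langle E_{-,1},v_1\rangle E_{-,2}\big)$$ for $v_i=X_i+\alpha_i$ in $TM_i\oplus T^*M_i$, and let $\mathcal J_2=G\mathcal J_1$, which is again a generalized almost complex structure. Then $(M_1\times M_2,\mathcal J_1,\mathcal J_2)$ is $\widetilde H$-twisted generalized K\"ahler if and only if $(\Phi_i,E_{\pm,i},G_i)$ is an $H_i$-twisted generalized coK\"ahler structure on $M_i$ for both $i=1,2$.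
   Context: For a smooth manifold $M$, $TM\oplus T^*M$ carries the neutral metric $\langle X+\alpha,Y+\beta\rangle=\frac12(\beta(X)+\alpha(Y))$; adjoints $^*$ are taken with respect to it. For a real closed $3$-form $H$, the $H$-twisted Courant bracket is $$[[X+\alpha,Y+\beta]]_H=[X,Y]+\mathcal L_X\beta-\mathcal L_Y\alpha-\tfrac12 d(\iota_X\beta-\iota_Y\alpha)+\iota_Y\iota_XH,$$ extended complex bilinearly to sections of $(TM\oplus T^*M)\otimes\mathbb C$. A subbundle is closed (involutive) if its sections are closed under this bracket. The bundle $T(M_1\times M_2)\oplus T^*(M_1\times M_2)$ is identified with $(TM_1\oplus T^*M_1)\oplus(TM_2\oplus T^*M_2)$ (pulled back to the product). A generalized almost complex structure is an endomorphism $\mathcal J$ of $TM\oplus T^*M$ with $\mathcal J+\mathcal J^*=0$, $\mathcal J^2=-\mathrm{Id}$; it is an $H$-twisted generalized complex structure if its $\sqrt{-1}$-eigenbundle in $(TM\oplus T^*M)\otimes\mathbb C$ is closed under $[[\cdot,\cdot]]_H$. A generalized (Riemannian) metric is an automorphism $G$ of $TM\oplus T^*M$ with $G^*=G$, $G^2=\mathrm{Id}$ and $\langle Gv,v\rangle>0$ for all $v\ne0$. An $H$-twisted generalized K\"ahler structure is a pair of commuting $H$-twisted generalized complex structures $\mathcal J_1,\mathcal J_2$ such that $-\mathcal J_1\mathcal J_2$ is a generalized metric. A generalized almost contact structure on $M$ is $(\Phi,E_\pm)$, with $\Phi$ an endomorphism of $TM\oplus T^*M$ and $E_+,E_-$ sections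 of $TM\oplus T^*M$, such that $\Phi+\Phi^*=0$, $\Phi\circ\Phi=-\mathrm{Id}+E_+\otimes E_-+E_-\otimes E_+$, $\langle E_\pm,E_\pm\rangle=0$, $2\langle E_+,E_-\rangle=1$. Here $(E\otimes F)(v)=2\langle F,v\rangle E$. Let $E^{(1,0)}$ be the $\sqrt{-1}$-eigenbundle of $\Phi$ in $(TM\oplus T^*M)\otimes\mathbb C$, let $L_{E_\pm}$ be the complex line bundle spanned by $E_\pm$, and $L^\pm=L_{E_\pm}\oplus E^{(1,0)}$. The structure is an $H$-twisted generalized contact structure if $L^+$ or $L^-$ is closed under $[[\cdot,\cdot]]_H$, and is strong if both are. It is normal if it is strong and $[[E_+,E_-]]_H=0$. A generalized almost contact metric structure is $(\Phi,E_\pm,G)$ with $(\Phi,E_\pm)$ a generalized almost contact structure and $G$ a generalized metric satisfying $-\Phi G\Phi=G-E_+\otimes E_+-E_-\otimes E_-$. It is an $H$-twisted generalized contact metric structure if $(\Phi,E_\pm)$ is moreover an $H$-twisted generalized contact structure. For such $(\Phi,E_\pm,G)$, one has that $(G\Phi, GE_\pm=E_\mp,G)$ is again a generalized almost contact metric structure. An $H$-twisted generalized coK\"ahler structure is a generalized contact metric structure $(\Phi,E_\pm,G)$ which is normal (with respect to $[[\cdot,\cdot]]_H$) and such that $(G\Phi,GE_\pm)$ is also strong with respect to $[[\cdot,\cdot]]_H$. *)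

theory Defs
  imports "HOL-Analysis.Analysis"
begin

section \<open>Smooth maps between open subsets of normed spaces\<close>

primrec Ck_on :: "nat \<Rightarrow> 'e::euclidean_space set \<Rightarrow> ('e \<Rightarrow> 'b::real_normed_vector) \<Rightarrow> bool" where
  "Ck_on 0 S f \<longleftrightarrow> continuous_on S f"
| "Ck_on (Suc k) S f \<longleftrightarrow>
     (\<forall>x\<in>S. f differentiable (at x)) \<and> (\<forall>v. Ck_on k S (\<lambda>x. frechet_derivative f (at x) v))"

text \<open>Only meaningful (and only used) for open \<open>S\<close>.\<close>

definition smooth_map_on :: "'e::euclidean_space set \<Rightarrow> ('e \<Rightarrow> 'b::real_normed_vector) \<Rightarrow> bool" where
  "smooth_map_on S f \<longleftrightarrow> (\<forall>k. Ck_on k S f)"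


section \<open>Smooth manifolds\<close>

record ('a, 'e) chart =
  cdom :: "'a set"
  cmap :: "'a \<Rightarrow> 'e"

definition cinv :: "('a, 'e) chart \<Rightarrow> 'e \<Rightarrow> 'a" where
  "cinv c = the_inv_into (cdom c) (cmap c)"

definition is_chart :: "('a::topological_space, 'e::euclidean_space) chart \<Rightarrow> bool" where
  "is_chart c \<longleftrightarrow> open (cdom c) \<and> open (cmap c ` cdom c) \<and>
     homeomorphism (cdom c) (cmap c ` cdom c) (cmap c) (cinv c)"

text \<open>
  A manifold is a whole Hausdorff, second countable type \<open>'a\<close> (hence nonempty) with a smooth atlas
  modelled on \<open>'e\<close> (hence of dimension \<open>DIM('e)\<close>, without boundary).  The atlas need not be
  maximal.  The field \<open>chart_at\<close> selects a chart around each point.  The fibres over \<open>p\<close> of all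
  bundles associated with \<open>TM\<close> are written in the coordinates of \<open>chart_at M p\<close>: a tangent vector at
  \<open>p\<close> is the element of \<open>'e\<close> that represents it in that chart, and a covector is an element of
  the dual space of \<open>'e\<close>.  So a section of a bundle is a plain function, and its expression in another
  chart is obtained from the coordinate change at each point.
\<close>

record ('a, 'e) manifold =
  atlas :: "('a, 'e) chart set"
  chart_at :: "'a \<Rightarrow> ('a, 'e) chart"

definition smooth_manifold ::
    "('a::{second_countable_topology, t2_space}, 'e::euclidean_space) manifold \<Rightarrow> bool" where
  "smooth_manifold M \<longleftrightarrow>
     (\<forall>c\<in>atlas M. is_chart c) \<and>
     (\<forall>c\<in>atlas M. \<forall>d\<in>atlas M.
        smooth_map_on (cmap c ` (cdom c \<inter> cdom d)) (cmap d \<circ> cinv c)) \<and>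
     (\<forall>p. chart_at M p \<in> atlas M \<and> p \<in> cdom (chart_at M p))"

definition tchange :: "('a, 'e::euclidean_space) chart \<Rightarrow> ('a, 'e) chart \<Rightarrow> 'a \<Rightarrow> 'e \<Rightarrow>\<^sub>L 'e" where
  "tchange c d p = Blinfun (frechet_derivative (cmap d \<circ> cinv c) (at (cmap c p)))"


section \<open>The bundle \<open>TM \<oplus> T\<^sup>*M\<close>\<close>

type_synonym 'e gvec = "'e \<times> ('e \<Rightarrow>\<^sub>L real)"

definition pairing :: "'e::euclidean_space gvec \<Rightarrow> 'e gvec \<Rightarrow> real" where
  "pairing u v = (blinfun_apply (snd v) (fst u) + blinfun_apply (snd u) (fst v)) / 2"

definition is_adjoint ::
    "('e::euclidean_space gvec \<Rightarrow> 'e gvec) \<Rightarrow> ('e gvec \<Rightarrow> 'e gvec) \<Rightarrow> bool" where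
  "is_adjoint A B \<longleftrightarrow> (\<forall>u v. pairing (A u) v = pairing u (B v))"

definition tens :: "'e::euclidean_space gvec \<Rightarrow> 'e gvec \<Rightarrow> 'e gvec \<Rightarrow> 'e gvec" where
  "tens E F v = (2 * pairing F v) *\<^sub>R E"

text \<open>Change of coordinates from chart \<open>c\<close> to chart \<open>d\<close> at \<open>p\<close>: tangent vectors are pushed forward,
  covectors are pulled back along the inverse coordinate change.\<close>

definition gchange ::
    "('a, 'e::euclidean_space) chart \<Rightarrow> ('a, 'e) chart \<Rightarrow> 'a \<Rightarrow> 'e gvec \<Rightarrow> 'e gvec" where
  "gchange c d p v = (blinfun_apply (tchange c d p) (fst v), snd v o\<^sub>L tchange d c p)"

definition local_rep ::
    "('a, 'e::euclidean_space) manifold \<Rightarrow> ('a, 'e) chart \<Rightarrow> ('a \<Rightarrow> 'e gvec) \<Rightarrow> 'e \<Rightarrow> 'e gvec" where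
  "local_rep M c s x = (let q = cinv c x in gchange (chart_at M q) c q (s q))"

definition smooth_section ::
    "('a, 'e::euclidean_space) manifold \<Rightarrow> ('a \<Rightarrow> 'e gvec) \<Rightarrow> bool" where
  "smooth_section M s \<longleftrightarrow> (\<forall>c\<in>atlas M. smooth_map_on (cmap c ` cdom c) (local_rep M c s))"

definition bundle_endo ::
    "('a, 'e::euclidean_space) manifold \<Rightarrow> ('a \<Rightarrow> 'e gvec \<Rightarrow> 'e gvec) \<Rightarrow> bool" where
  "bundle_endo M A \<longleftrightarrow>
     (\<forall>p. linear (A p)) \<and>
     (\<forall>c\<in>atlas M. \<forall>v. smooth_map_on (cmap c ` cdom c)
        (\<lambda>x. let q = cinv c x in
          gchange (chart_at M q) c q (A q (gchange c (chart_at M q) q v))))"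


section \<open>Closed three-forms\<close>

definition form_rep ::
    "('a, 'e::euclidean_space) manifold \<Rightarrow> ('a, 'e) chart \<Rightarrow> ('a \<Rightarrow> 'e \<Rightarrow> 'e \<Rightarrow> 'e \<Rightarrow> real)
      \<Rightarrow> 'e \<Rightarrow> 'e \<Rightarrow> 'e \<Rightarrow> 'e \<Rightarrow> real" where
  "form_rep M c H u v w x =
     (let q = cinv c x; T = blinfun_apply (tchange c (chart_at M q) q) in H q (T u) (T v) (T w))"

definition three_form ::
    "('a, 'e::euclidean_space) manifold \<Rightarrow> ('a \<Rightarrow> 'e \<Rightarrow> 'e \<Rightarrow> 'e \<Rightarrow> real) \<Rightarrow> bool" where
  "three_form M H \<longleftrightarrow>
     (\<forall>p u v. linear (\<lambda>z. H p z u v) \<and> linear (\<lambda>z. H p u z v) \<and> linear (\<lambda>z. H p u v z)) \<and>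
     (\<forall>p u v. H p u u v = 0 \<and> H p u v v = 0) \<and>
     (\<forall>c\<in>atlas M. \<forall>u v w. smooth_map_on (cmap c ` cdom c) (form_rep M c H u v w))"

text \<open>Closedness: the exterior derivative vanishes on the constant vector fields of every chart.\<close>

definition closed_three_form ::
    "('a, 'e::euclidean_space) manifold \<Rightarrow> ('a \<Rightarrow> 'e \<Rightarrow> 'e \<Rightarrow> 'e \<Rightarrow> real) \<Rightarrow> bool" where
  "closed_three_form M H \<longleftrightarrow> three_form M H \<and>
     (\<forall>c\<in>atlas M. \<forall>x\<in>cmap c ` cdom c. \<forall>u0 u1 u2 u3.
          frechet_derivative (form_rep M c H u1 u2 u3) (at x) u0
        - frechet_derivative (form_rep M c H u0 u2 u3) (at x) u1
        + frechet_derivative (form_rep M c H u0 u1 u3) (at x) u2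
        - frechet_derivative (form_rep M c H u0 u1 u2) (at x) u3 = 0)"


section \<open>The twisted Courant bracket\<close>

text \<open>Vector fields, functions and one-forms on an open subset of \<open>'e\<close>.\<close>

definition lie_bracket :: "('e::euclidean_space \<Rightarrow> 'e) \<Rightarrow> ('e \<Rightarrow> 'e) \<Rightarrow> 'e \<Rightarrow> 'e" where
  "lie_bracket X Y x = frechet_derivative Y (at x) (X x) - frechet_derivative X (at x) (Y x)"

definition lie_deriv ::
    "('e::euclidean_space \<Rightarrow> 'e) \<Rightarrow> ('e \<Rightarrow> 'e \<Rightarrow>\<^sub>L real) \<Rightarrow> 'e \<Rightarrow> 'e \<Rightarrow>\<^sub>L real" where
  "lie_deriv X \<beta> x =
     frechet_derivative \<beta> (at x) (X x) + (\<beta> x o\<^sub>L Blinfun (frechet_derivative X (at x)))"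

definition ext_d :: "('e::euclidean_space \<Rightarrow> real) \<Rightarrow> 'e \<Rightarrow> 'e \<Rightarrow>\<^sub>L real" where
  "ext_d f x = Blinfun (frechet_derivative f (at x))"

text \<open>
  The value of the bracket at \<open>p\<close> is computed in the coordinates of \<open>chart_at M p\<close>, in which the
  fibre over \<open>p\<close> is written.  In these coordinates the last summand is the covector
  \<open>\<iota>\<^sub>Y \<iota>\<^sub>X H = H(X, Y, _)\<close>.
\<close>

definition courant ::
    "('a, 'e::euclidean_space) manifold \<Rightarrow> ('a \<Rightarrow> 'e \<Rightarrow> 'e \<Rightarrow> 'e \<Rightarrow> real)
      \<Rightarrow> ('a \<Rightarrow> 'e gvec) \<Rightarrow> ('a \<Rightarrow> 'e gvec) \<Rightarrow> 'a \<Rightarrow> 'e gvec" where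
  "courant M H a b p =
     (let c = chart_at M p; x = cmap c p;
          X = (\<lambda>y. fst (local_rep M c a y)); \<alpha> = (\<lambda>y. snd (local_rep M c a y));
          Y = (\<lambda>y. fst (local_rep M c b y)); \<beta> = (\<lambda>y. snd (local_rep M c b y))
      in (lie_bracket X Y x,
          lie_deriv X \<beta> x - lie_deriv Y \<alpha> x
          - (1/2) *\<^sub>R ext_d (\<lambda>y. blinfun_apply (\<beta> y) (X y) - blinfun_apply (\<alpha> y) (Y y)) x
          + Blinfun (H p (fst (a p)) (fst (b p)))))"


section \<open>Complexification\<close>

text \<open>The pair \<open>(u, v)\<close> stands for \<open>u + \<surd>-1 v\<close> in \<open>(TM \<oplus> T\<^sup>*M) \<otimes> \<complex>\<close>.\<close>

type_synonym 'e cgvec = "'e gvec \<times> 'e gvec"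

definition cscale :: "complex \<Rightarrow> 'e::euclidean_space cgvec \<Rightarrow> 'e cgvec" where
  "cscale z w = (Re z *\<^sub>R fst w - Im z *\<^sub>R snd w, Re z *\<^sub>R snd w + Im z *\<^sub>R fst w)"

definition cext :: "('e::euclidean_space gvec \<Rightarrow> 'e gvec) \<Rightarrow> 'e cgvec \<Rightarrow> 'e cgvec" where
  "cext A w = (A (fst w), A (snd w))"

definition i_eigen :: "('a \<Rightarrow> 'e::euclidean_space gvec \<Rightarrow> 'e gvec) \<Rightarrow> 'a \<Rightarrow> 'e cgvec set" where
  "i_eigen A p = {w. cext (A p) w = cscale \<i> w}"

definition cline :: "('a \<Rightarrow> 'e::euclidean_space gvec) \<Rightarrow> 'a \<Rightarrow> 'e cgvec set" where
  "cline E p = {cscale z (E p, 0) | z. True}"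

definition bundle_sum ::
    "('a \<Rightarrow> 'e::euclidean_space cgvec set) \<Rightarrow> ('a \<Rightarrow> 'e cgvec set) \<Rightarrow> 'a \<Rightarrow> 'e cgvec set" where
  "bundle_sum K L p = {u + v | u v. u \<in> K p \<and> v \<in> L p}"

definition csection_of ::
    "('a, 'e::euclidean_space) manifold \<Rightarrow> ('a \<Rightarrow> 'e cgvec set) \<Rightarrow> ('a \<Rightarrow> 'e cgvec) \<Rightarrow> bool" where
  "csection_of M L w \<longleftrightarrow>
     smooth_section M (\<lambda>p. fst (w p)) \<and> smooth_section M (\<lambda>p. snd (w p)) \<and> (\<forall>p. w p \<in> L p)"

definition ccourant ::
    "('a, 'e::euclidean_space) manifold \<Rightarrow> ('a \<Rightarrow> 'e \<Rightarrow> 'e \<Rightarrow> 'e \<Rightarrow> real)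
      \<Rightarrow> ('a \<Rightarrow> 'e cgvec) \<Rightarrow> ('a \<Rightarrow> 'e cgvec) \<Rightarrow> 'a \<Rightarrow> 'e cgvec" where
  "ccourant M H w z p =
     (let a = (\<lambda>q. fst (w q)); b = (\<lambda>q. snd (w q)); c = (\<lambda>q. fst (z q)); d = (\<lambda>q. snd (z q))
      in (courant M H a c p - courant M H b d p, courant M H a d p + courant M H b c p))"

text \<open>The bracket of two smooth sections is automatically smooth, so only membership in \<open>L\<close> is
  required.\<close>

definition involutive ::
    "('a, 'e::euclidean_space) manifold \<Rightarrow> ('a \<Rightarrow> 'e \<Rightarrow> 'e \<Rightarrow> 'e \<Rightarrow> real)
      \<Rightarrow> ('a \<Rightarrow> 'e cgvec set) \<Rightarrow> bool" where
  "involutive M H L \<longleftrightarrow>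
     (\<forall>w z. csection_of M L w \<longrightarrow> csection_of M L z \<longrightarrow> (\<forall>p. ccourant M H w z p \<in> L p))"


section \<open>Generalized complex and generalized Kaehler structures\<close>

definition gen_almost_complex ::
    "('a, 'e::euclidean_space) manifold \<Rightarrow> ('a \<Rightarrow> 'e gvec \<Rightarrow> 'e gvec) \<Rightarrow> bool" where
  "gen_almost_complex M J \<longleftrightarrow> bundle_endo M J \<and>
     (\<forall>p. is_adjoint (J p) (\<lambda>v. - J p v)) \<and> (\<forall>p v. J p (J p v) = - v)"

definition gen_complex ::
    "('a, 'e::euclidean_space) manifold \<Rightarrow> ('a \<Rightarrow> 'e \<Rightarrow> 'e \<Rightarrow> 'e \<Rightarrow> real)
      \<Rightarrow> ('a \<Rightarrow> 'e gvec \<Rightarrow> 'e gvec) \<Rightarrow> bool" where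
  "gen_complex M H J \<longleftrightarrow> gen_almost_complex M J \<and> involutive M H (i_eigen J)"

definition gen_metric ::
    "('a, 'e::euclidean_space) manifold \<Rightarrow> ('a \<Rightarrow> 'e gvec \<Rightarrow> 'e gvec) \<Rightarrow> bool" where
  "gen_metric M G \<longleftrightarrow> bundle_endo M G \<and>
     (\<forall>p. is_adjoint (G p) (G p)) \<and> (\<forall>p v. G p (G p v) = v) \<and>
     (\<forall>p v. v \<noteq> 0 \<longrightarrow> pairing (G p v) v > 0)"

definition gen_kahler ::
    "('a, 'e::euclidean_space) manifold \<Rightarrow> ('a \<Rightarrow> 'e \<Rightarrow> 'e \<Rightarrow> 'e \<Rightarrow> real)
      \<Rightarrow> ('a \<Rightarrow> 'e gvec \<Rightarrow> 'e gvec) \<Rightarrow> ('a \<Rightarrow> 'e gvec \<Rightarrow> 'e gvec) \<Rightarrow> bool" where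
  "gen_kahler M H J1 J2 \<longleftrightarrow>
     gen_complex M H J1 \<and> gen_complex M H J2 \<and>
     (\<forall>p v. J1 p (J2 p v) = J2 p (J1 p v)) \<and>
     gen_metric M (\<lambda>p v. - J1 p (J2 p v))"


section \<open>Generalized contact and generalized coKaehler structures\<close>

definition gen_almost_contact ::
    "('a, 'e::euclidean_space) manifold \<Rightarrow> ('a \<Rightarrow> 'e gvec \<Rightarrow> 'e gvec)
      \<Rightarrow> ('a \<Rightarrow> 'e gvec) \<Rightarrow> ('a \<Rightarrow> 'e gvec) \<Rightarrow> bool" where
  "gen_almost_contact M \<Phi> Ep Em \<longleftrightarrow>
     bundle_endo M \<Phi> \<and> smooth_section M Ep \<and> smooth_section M Em \<and>
     (\<forall>p. is_adjoint (\<Phi> p) (\<lambda>v. - \<Phi> p v)) \<and>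
     (\<forall>p v. \<Phi> p (\<Phi> p v) = - v + tens (Ep p) (Em p) v + tens (Em p) (Ep p) v) \<and>
     (\<forall>p. pairing (Ep p) (Ep p) = 0 \<and> pairing (Em p) (Em p) = 0 \<and> 2 * pairing (Ep p) (Em p) = 1)"

definition contact_L ::
    "('a \<Rightarrow> 'e::euclidean_space gvec \<Rightarrow> 'e gvec) \<Rightarrow> ('a \<Rightarrow> 'e gvec) \<Rightarrow> 'a \<Rightarrow> 'e cgvec set" where
  "contact_L \<Phi> E = bundle_sum (cline E) (i_eigen \<Phi>)"

definition gen_contact ::
    "('a, 'e::euclidean_space) manifold \<Rightarrow> ('a \<Rightarrow> 'e \<Rightarrow> 'e \<Rightarrow> 'e \<Rightarrow> real)
      \<Rightarrow> ('a \<Rightarrow> 'e gvec \<Rightarrow> 'e gvec) \<Rightarrow> ('a \<Rightarrow> 'e gvec) \<Rightarrow> ('a \<Rightarrow> 'e gvec) \<Rightarrow> bool" where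
  "gen_contact M H \<Phi> Ep Em \<longleftrightarrow> gen_almost_contact M \<Phi> Ep Em \<and>
     (involutive M H (contact_L \<Phi> Ep) \<or> involutive M H (contact_L \<Phi> Em))"

definition strong_gen_contact ::
    "('a, 'e::euclidean_space) manifold \<Rightarrow> ('a \<Rightarrow> 'e \<Rightarrow> 'e \<Rightarrow> 'e \<Rightarrow> real)
      \<Rightarrow> ('a \<Rightarrow> 'e gvec \<Rightarrow> 'e gvec) \<Rightarrow> ('a \<Rightarrow> 'e gvec) \<Rightarrow> ('a \<Rightarrow> 'e gvec) \<Rightarrow> bool" where
  "strong_gen_contact M H \<Phi> Ep Em \<longleftrightarrow> gen_almost_contact M \<Phi> Ep Em \<and>
     involutive M H (contact_L \<Phi> Ep) \<and> involutive M H (contact_L \<Phi> Em)"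

definition normal_gen_contact ::
    "('a, 'e::euclidean_space) manifold \<Rightarrow> ('a \<Rightarrow> 'e \<Rightarrow> 'e \<Rightarrow> 'e \<Rightarrow> real)
      \<Rightarrow> ('a \<Rightarrow> 'e gvec \<Rightarrow> 'e gvec) \<Rightarrow> ('a \<Rightarrow> 'e gvec) \<Rightarrow> ('a \<Rightarrow> 'e gvec) \<Rightarrow> bool" where
  "normal_gen_contact M H \<Phi> Ep Em \<longleftrightarrow> strong_gen_contact M H \<Phi> Ep Em \<and>
     (\<forall>p. courant M H Ep Em p = 0)"

definition gen_almost_contact_metric ::
    "('a, 'e::euclidean_space) manifold \<Rightarrow> ('a \<Rightarrow> 'e gvec \<Rightarrow> 'e gvec)
      \<Rightarrow> ('a \<Rightarrow> 'e gvec) \<Rightarrow> ('a \<Rightarrow> 'e gvec) \<Rightarrow> ('a \<Rightarrow> 'e gvec \<Rightarrow> 'e gvec) \<Rightarrow> bool" where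
  "gen_almost_contact_metric M \<Phi> Ep Em G \<longleftrightarrow>
     gen_almost_contact M \<Phi> Ep Em \<and> gen_metric M G \<and>
     (\<forall>p v. - \<Phi> p (G p (\<Phi> p v)) = G p v - tens (Ep p) (Ep p) v - tens (Em p) (Em p) v)"

definition gen_contact_metric ::
    "('a, 'e::euclidean_space) manifold \<Rightarrow> ('a \<Rightarrow> 'e \<Rightarrow> 'e \<Rightarrow> 'e \<Rightarrow> real)
      \<Rightarrow> ('a \<Rightarrow> 'e gvec \<Rightarrow> 'e gvec) \<Rightarrow> ('a \<Rightarrow> 'e gvec) \<Rightarrow> ('a \<Rightarrow> 'e gvec)
      \<Rightarrow> ('a \<Rightarrow> 'e gvec \<Rightarrow> 'e gvec) \<Rightarrow> bool" where
  "gen_contact_metric M H \<Phi> Ep Em G \<longleftrightarrow>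
     gen_almost_contact_metric M \<Phi> Ep Em G \<and> gen_contact M H \<Phi> Ep Em"

definition gen_cokahler ::
    "('a, 'e::euclidean_space) manifold \<Rightarrow> ('a \<Rightarrow> 'e \<Rightarrow> 'e \<Rightarrow> 'e \<Rightarrow> real)
      \<Rightarrow> ('a \<Rightarrow> 'e gvec \<Rightarrow> 'e gvec) \<Rightarrow> ('a \<Rightarrow> 'e gvec) \<Rightarrow> ('a \<Rightarrow> 'e gvec)
      \<Rightarrow> ('a \<Rightarrow> 'e gvec \<Rightarrow> 'e gvec) \<Rightarrow> bool" where
  "gen_cokahler M H \<Phi> Ep Em G \<longleftrightarrow>
     gen_contact_metric M H \<Phi> Ep Em G \<and> normal_gen_contact M H \<Phi> Ep Em \<and>
     strong_gen_contact M H (\<lambda>p v. G p (\<Phi> p v)) (\<lambda>p. G p (Ep p)) (\<lambda>p. G p (Em p))"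


section \<open>Products\<close>

definition chart_prod :: "('a, 'e) chart \<Rightarrow> ('b, 'f) chart \<Rightarrow> ('a \<times> 'b, 'e \<times> 'f) chart" where
  "chart_prod c d = \<lparr>cdom = cdom c \<times> cdom d, cmap = map_prod (cmap c) (cmap d)\<rparr>"

definition manifold_prod ::
    "('a, 'e) manifold \<Rightarrow> ('b, 'f) manifold \<Rightarrow> ('a \<times> 'b, 'e \<times> 'f) manifold" where
  "manifold_prod M N =
     \<lparr>atlas = {chart_prod c d | c d. c \<in> atlas M \<and> d \<in> atlas N},
      chart_at = (\<lambda>(p, q). chart_prod (chart_at M p) (chart_at N q))\<rparr>"

text \<open>
  The identification of \<open>T(M\<^sub>1 \<times> M\<^sub>2) \<oplus> T\<^sup>*(M\<^sub>1 \<times> M\<^sub>2)\<close> with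
  \<open>(TM\<^sub>1 \<oplus> T\<^sup>*M\<^sub>1) \<oplus> (TM\<^sub>2 \<oplus> T\<^sup>*M\<^sub>2)\<close>.  The fibre over \<open>(p, q)\<close> is written in the product of the
  charts chosen at \<open>p\<close> and \<open>q\<close>, in which the projections and their differentials are \<open>fst\<close>
  and \<open>snd\<close>.
\<close>

definition gjoin ::
    "'e::euclidean_space gvec \<Rightarrow> 'f::euclidean_space gvec \<Rightarrow> ('e \<times> 'f) gvec" where
  "gjoin v1 v2 = ((fst v1, fst v2), (snd v1 o\<^sub>L fst_blinfun) + (snd v2 o\<^sub>L snd_blinfun))"

definition gfst :: "('e::euclidean_space \<times> 'f::euclidean_space) gvec \<Rightarrow> 'e gvec" where
  "gfst v = (fst (fst v), snd v o\<^sub>L Blinfun (\<lambda>x. (x, 0)))"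

definition gsnd :: "('e::euclidean_space \<times> 'f::euclidean_space) gvec \<Rightarrow> 'f gvec" where
  "gsnd v = (snd (fst v), snd v o\<^sub>L Blinfun (\<lambda>y. (0, y)))"

text \<open>The sum of the pullbacks of two three-forms along the projections.\<close>

definition form_sum ::
    "('a \<Rightarrow> 'e \<Rightarrow> 'e \<Rightarrow> 'e \<Rightarrow> real) \<Rightarrow> ('b \<Rightarrow> 'f \<Rightarrow> 'f \<Rightarrow> 'f \<Rightarrow> real)
      \<Rightarrow> 'a \<times> 'b \<Rightarrow> 'e \<times> 'f \<Rightarrow> 'e \<times> 'f \<Rightarrow> 'e \<times> 'f \<Rightarrow> real" where
  "form_sum H1 H2 = (\<lambda>(p, q) u v w. H1 p (fst u) (fst v) (fst w) + H2 q (snd u) (snd v) (snd w))"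

definition endo_prod ::
    "('a \<Rightarrow> 'e::euclidean_space gvec \<Rightarrow> 'e gvec) \<Rightarrow> ('b \<Rightarrow> 'f::euclidean_space gvec \<Rightarrow> 'f gvec)
      \<Rightarrow> 'a \<times> 'b \<Rightarrow> ('e \<times> 'f) gvec \<Rightarrow> ('e \<times> 'f) gvec" where
  "endo_prod A1 A2 = (\<lambda>(p, q) v. gjoin (A1 p (gfst v)) (A2 q (gsnd v)))"

definition product_J ::
    "('a \<Rightarrow> 'e::euclidean_space gvec \<Rightarrow> 'e gvec) \<Rightarrow> ('a \<Rightarrow> 'e gvec) \<Rightarrow> ('a \<Rightarrow> 'e gvec)
      \<Rightarrow> ('b \<Rightarrow> 'f::euclidean_space gvec \<Rightarrow> 'f gvec) \<Rightarrow> ('b \<Rightarrow> 'f gvec) \<Rightarrow> ('b \<Rightarrow> 'f gvec)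
      \<Rightarrow> 'a \<times> 'b \<Rightarrow> ('e \<times> 'f) gvec \<Rightarrow> ('e \<times> 'f) gvec" where
  "product_J \<Phi>1 Ep1 Em1 \<Phi>2 Ep2 Em2 = (\<lambda>(p, q) v.
     let v1 = gfst v; v2 = gsnd v in
     gjoin
       (\<Phi>1 p v1 - (2 * pairing (Ep2 q) v2) *\<^sub>R Ep1 p - (2 * pairing (Em2 q) v2) *\<^sub>R Em1 p)
       (\<Phi>2 q v2 + (2 * pairing (Ep1 p) v1) *\<^sub>R Ep2 q + (2 * pairing (Em1 p) v1) *\<^sub>R Em2 q))"

end

theory Submission
  imports Defs
begin

text \<open>
  Let \<open>E\<^sup>i\<close> denote the \<open>\<i>\<close>-eigenbundle of \<open>\<Phi>\<^sub>i\<close>.  The \<open>\<i>\<close>-eigenbundle of \<open>J\<^sub>1\<close> is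
  \<open>E\<^sup>1 \<oplus> E\<^sup>2\<close> together with the lines spanned by \<open>F\<^sub>1 = E\<^sub>+\<^sub>,\<^sub>1 - \<i> E\<^sub>-\<^sub>,\<^sub>2\<close> and
  \<open>F\<^sub>2 = E\<^sub>-\<^sub>,\<^sub>1 - \<i> E\<^sub>+\<^sub>,\<^sub>2\<close>.  Sections pulled back from different factors have vanishing
  bracket, so on lifts this bundle is involutive iff, on each factor, \<open>E\<^sup>i\<close> is involutive,
  \<open>[[E\<^sub>\<plusminus>, E\<^sup>i]] \<subseteq> E\<^sup>i\<close>, and \<open>[[E\<^sub>+, E\<^sub>-]] = 0\<close>; the last condition comes from the real
  element \<open>[[F\<^sub>1, F\<^sub>2]]\<close> of an eigenbundle without real points.  By the invariance identity
  of the Courant bracket these three conditions say exactly that the contact structure is normal.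

  All the bundles involved are isotropic, so involutivity is tensorial.  This reduces arbitrary sections
  to lifts without local frames or bump functions: through a given point one takes the slices of a
  section along the two factors, projects them to \<open>E\<^sup>i\<close> with \<open>- \<Phi>\<^sub>i\<^sup>2\<close>, and freezes the coefficients
  of \<open>F\<^sub>1\<close> and \<open>F\<^sub>2\<close>.

  Since \<open>G E\<^sub>\<plusminus> = E\<^sub>\<mp>\<close> and \<open>G\<close> commutes with \<open>\<Phi>\<close>, the structure \<open>J\<^sub>2 = G J\<^sub>1\<close> has the same
  form as \<open>J\<^sub>1\<close>, with \<open>G\<^sub>i \<Phi>\<^sub>i\<close> for \<open>\<Phi>\<^sub>i\<close> and the two sections on the second factor exchanged.
\<close>

section \<open>Calculus of smooth maps\<close>

text \<open>\<open>involutive\<close> quantifies over global sections, while lifts span the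
  eigenbundle of the product only with function coefficients. The gap is closed one point at a time.
  The bracket at p depends only on values and first derivatives in a single chart. If w vanishes at
  p, then pairing \<open>[[w, z]]\<close> with c gives
  \<open>- <Dw(X_z), c> + <Dw(X_c), z> / 2\<close>, with X the tangent part. Derivatives at p of a
  section of L that vanishes there lie in L again, so the second term dies by isotropy and
  \<open>[[w, z]] = - Dw(X_z)\<close> is in L. No Leibniz rule for function multiples is needed. To
  know that such derivatives stay in L, every bundle must be cut out by linear equations with smooth
  coefficients; hence the equational description of \<open>contact_L\<close>. The projection
  \<open>- \<Phi>^2\<close> is available because \<open>\<Phi>^3 = - \<Phi>\<close>. CoKaehler
  demands only strongness of \<open>G \<Phi>\<close>. This is no weaker than normality:
  \<open>[[G E+, G E-]] = [[E-, E+]]\<close> already vanishes by normality of \<open>\<Phi>\<close>.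
  So both complex structures of the product lead to the same condition, normality, once for
  \<open>\<Phi>\<close> and once for \<open>G \<Phi>\<close>.\<close>

lemma Ck_on_cong:
  assumes "open S"
  shows "Ck_on k S f \<Longrightarrow> (\<And>x. x \<in> S \<Longrightarrow> f x = g x) \<Longrightarrow> Ck_on k S g"
proof (induction k arbitrary: f g)
  case 0
  then show ?case by (simp cong: continuous_on_cong)
next
  case (Suc k)
  have D: "(g has_derivative frechet_derivative f (at x)) (at x)" if "x \<in> S" for x
  proof -
    have "(f has_derivative frechet_derivative f (at x)) (at x)"
      using Suc.prems(1) that by (simp add: frechet_derivative_works)
    then show ?thesis
      using has_derivative_transform_within_open[OF _ assms that] Suc.prems(2) by blast
  qed
  have "Ck_on k S (\<lambda>x. frechet_derivative g (at x) v)" for v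
  proof (rule Suc.IH)
    show "Ck_on k S (\<lambda>x. frechet_derivative f (at x) v)"
      using Suc.prems(1) by simp
    show "frechet_derivative f (at x) v = frechet_derivative g (at x) v" if "x \<in> S" for x
      by (metis frechet_derivative_at D that)
  qed
  then show ?case
    using D by (auto simp: differentiable_def)
qed

text \<open>Induction on \<open>k\<close> needs the derivative in closed form, while
  \<open>Ck_on\<close> speaks of \<open>frechet_derivative\<close>. Accepting any derivative
  \<open>D\<close>, this rule is the induction step of the closure properties below.\<close>

lemma Ck_on_SucI:
  assumes "open S" "\<And>x. x \<in> S \<Longrightarrow> (f has_derivative D x) (at x)"
    and "\<And>v. Ck_on k S (\<lambda>x. D x v)"
  shows "Ck_on (Suc k) S f"
proof -
  have "Ck_on k S (\<lambda>x. frechet_derivative f (at x) v)" for v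
  proof (rule Ck_on_cong[OF assms(1) assms(3)])
    show "D x v = frechet_derivative f (at x) v" if "x \<in> S" for x
      by (metis frechet_derivative_at assms(2) that)
  qed
  then show ?thesis
    using assms(2) by (auto simp: differentiable_def)
qed

lemma Ck_on_has_derivative:
  assumes "Ck_on (Suc k) S f" "x \<in> S"
  shows "(f has_derivative frechet_derivative f (at x)) (at x)"
  using assms by (simp add: frechet_derivative_works)

lemma Ck_on_mono: "Ck_on (Suc k) S f \<Longrightarrow> Ck_on k S f"
proof (induction k arbitrary: f)
  case 0
  then show ?case
    by (auto intro!: continuous_at_imp_continuous_on differentiable_imp_continuous_within)
next
  case (Suc k)
  then show ?case by (metis Ck_on.simps(2))
qed

lemma Ck_on_const: "open S \<Longrightarrow> Ck_on k S (\<lambda>x. c)"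
proof (induction k arbitrary: c)
  case (Suc k)
  show ?case
    by (rule Ck_on_SucI[where D = "\<lambda>_ _. 0"]) (use Suc in simp_all)
qed auto

lemma Ck_on_bounded_linear:
  assumes "open S" "bounded_linear L"
  shows "Ck_on k S f \<Longrightarrow> Ck_on k S (\<lambda>x. L (f x))"
proof (induction k arbitrary: f)
  case 0
  then show ?case
    by (simp add: bounded_linear.continuous_on[OF assms(2)])
next
  case (Suc k)
  show ?case
  proof (rule Ck_on_SucI[OF assms(1)])
    fix x assume "x \<in> S"
    then show "((\<lambda>x. L (f x)) has_derivative (\<lambda>v. L (frechet_derivative f (at x) v))) (at x)"
      by (intro bounded_linear.has_derivative[OF assms(2)] Ck_on_has_derivative[OF Suc.prems])
  next
    show "Ck_on k S (\<lambda>x. L (frechet_derivative f (at x) v))" for v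
      using Suc.prems by (intro Suc.IH) simp
  qed
qed

lemma Ck_on_add:
  assumes "open S"
  shows "Ck_on k S f \<Longrightarrow> Ck_on k S g \<Longrightarrow> Ck_on k S (\<lambda>x. f x + g x)"
proof (induction k arbitrary: f g)
  case 0
  then show ?case by (auto intro: continuous_intros)
next
  case (Suc k)
  show ?case
  proof (rule Ck_on_SucI[OF assms])
    fix x assume "x \<in> S"
    then show "((\<lambda>x. f x + g x) has_derivative
        (\<lambda>v. frechet_derivative f (at x) v + frechet_derivative g (at x) v)) (at x)"
      by (intro has_derivative_add Ck_on_has_derivative[OF Suc.prems(1)]
          Ck_on_has_derivative[OF Suc.prems(2)])
  next
    show "Ck_on k S (\<lambda>x. frechet_derivative f (at x) v + frechet_derivative g (at x) v)" for v
      using Suc.prems by (intro Suc.IH) auto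
  qed
qed

lemma Ck_on_bounded_bilinear:
  assumes "open S" "bounded_bilinear B"
  shows "Ck_on k S f \<Longrightarrow> Ck_on k S g \<Longrightarrow> Ck_on k S (\<lambda>x. B (f x) (g x))"
proof (induction k arbitrary: f g)
  case 0
  then show ?case
    by (simp add: bounded_bilinear.continuous_on[OF assms(2)])
next
  case (Suc k)
  show ?case
  proof (rule Ck_on_SucI[OF assms(1)])
    fix x assume "x \<in> S"
    then show "((\<lambda>x. B (f x) (g x)) has_derivative
        (\<lambda>v. B (f x) (frechet_derivative g (at x) v) + B (frechet_derivative f (at x) v) (g x))) (at x)"
      by (intro bounded_bilinear.FDERIV[OF assms(2)] Ck_on_has_derivative[OF Suc.prems(1)]
          Ck_on_has_derivative[OF Suc.prems(2)])
  next
    \<comment> \<open>Each summand of the product rule keeps one undifferentiated factor, which is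
      needed only at level \<open>k\<close>.\<close>
    show "Ck_on k S (\<lambda>x. B (f x) (frechet_derivative g (at x) v)
        + B (frechet_derivative f (at x) v) (g x))" for v
      using Suc.prems
      by (intro Ck_on_add[OF assms(1)] Suc.IH Ck_on_mono[OF Suc.prems(1)]
          Ck_on_mono[OF Suc.prems(2)]) auto
  qed
qed

text \<open>Affine inner maps are enough for the projections of a product and the inclusions of
  slices. Since the derivative \<open>A\<close> is constant, the induction hypothesis applies
  directly to the derivatives of \<open>f\<close>.\<close>

lemma Ck_on_compose_affine:
  assumes "open S" "\<And>x. (g has_derivative A) (at x)" "g ` S \<subseteq> T"
  shows "Ck_on k T f \<Longrightarrow> Ck_on k S (\<lambda>x. f (g x))"
proof (induction k arbitrary: f)
  case 0
  have "continuous_on S g"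
    using assms(2) by (meson continuous_at_imp_continuous_on has_derivative_continuous)
  with 0 show ?case
    using assms(3) continuous_on_compose2 by fastforce
next
  case (Suc k)
  show ?case
  proof (rule Ck_on_SucI[OF assms(1)])
    fix x assume "x \<in> S"
    then have "g x \<in> T" using assms(3) by auto
    then show "((\<lambda>x. f (g x)) has_derivative (\<lambda>v. frechet_derivative f (at (g x)) (A v))) (at x)"
      by (intro has_derivative_compose[OF assms(2)] Ck_on_has_derivative[OF Suc.prems])
  next
    show "Ck_on k S (\<lambda>x. frechet_derivative f (at (g x)) (A v))" for v
      using Suc.prems by (intro Suc.IH) simp
  qed
qed

lemma smooth_map_on_cong:
  "open S \<Longrightarrow> smooth_map_on S f \<Longrightarrow> (\<And>x. x \<in> S \<Longrightarrow> f x = g x) \<Longrightarrow> smooth_map_on S g"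
  unfolding smooth_map_on_def using Ck_on_cong by blast

lemma smooth_map_on_const: "open S \<Longrightarrow> smooth_map_on S (\<lambda>x. c)"
  unfolding smooth_map_on_def by (blast intro: Ck_on_const)

lemma smooth_map_on_bounded_linear:
  "open S \<Longrightarrow> bounded_linear L \<Longrightarrow> smooth_map_on S f \<Longrightarrow> smooth_map_on S (\<lambda>x. L (f x))"
  unfolding smooth_map_on_def by (blast intro: Ck_on_bounded_linear)

lemma smooth_map_on_add:
  "open S \<Longrightarrow> smooth_map_on S f \<Longrightarrow> smooth_map_on S g \<Longrightarrow> smooth_map_on S (\<lambda>x. f x + g x)"
  unfolding smooth_map_on_def by (blast intro: Ck_on_add)

lemma smooth_map_on_bounded_bilinear:
  "open S \<Longrightarrow> bounded_bilinear B \<Longrightarrow> smooth_map_on S f \<Longrightarrow> smooth_map_on S g \<Longrightarrow>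
    smooth_map_on S (\<lambda>x. B (f x) (g x))"
  unfolding smooth_map_on_def by (blast intro: Ck_on_bounded_bilinear)

lemma smooth_map_on_scaleR:
  "open S \<Longrightarrow> smooth_map_on S f \<Longrightarrow> smooth_map_on S g \<Longrightarrow> smooth_map_on S (\<lambda>x. f x *\<^sub>R g x)"
  by (rule smooth_map_on_bounded_bilinear[OF _ bounded_bilinear_scaleR])

lemma smooth_map_on_sum:
  "open S \<Longrightarrow> (\<And>i. i \<in> I \<Longrightarrow> smooth_map_on S (f i)) \<Longrightarrow> smooth_map_on S (\<lambda>x. \<Sum>i\<in>I. f i x)"
  by (induction I rule: infinite_finite_induct) (auto intro: smooth_map_on_const smooth_map_on_add)

lemma smooth_map_on_compose_affine:
  "open S \<Longrightarrow> (\<And>x. (g has_derivative A) (at x)) \<Longrightarrow> g ` S \<subseteq> T \<Longrightarrow> smooth_map_on T f \<Longrightarrow>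
    smooth_map_on S (\<lambda>x. f (g x))"
  unfolding smooth_map_on_def by (blast intro: Ck_on_compose_affine)

lemma smooth_map_on_fst:
  assumes "open S" "open T" "smooth_map_on S f"
  shows "smooth_map_on (S \<times> T) (\<lambda>z. f (fst z))"
  by (rule smooth_map_on_compose_affine[OF _ _ _ assms(3)])
    (auto intro: open_Times assms derivative_intros)

lemma smooth_map_on_snd:
  assumes "open S" "open T" "smooth_map_on T f"
  shows "smooth_map_on (S \<times> T) (\<lambda>z. f (snd z))"
  by (rule smooth_map_on_compose_affine[OF _ _ _ assms(3)])
    (auto intro: open_Times assms derivative_intros)

lemma smooth_map_on_has_derivative:
  assumes "smooth_map_on S f" "x \<in> S"
  shows "(f has_derivative frechet_derivative f (at x)) (at x)"
  using assms Ck_on_has_derivative unfolding smooth_map_on_def by blast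

section \<open>The neutral pairing\<close>

lemma bounded_bilinear_pairing: "bounded_bilinear (pairing :: 'a::euclidean_space gvec \<Rightarrow> _)"
proof
  show "\<exists>K. \<forall>a b :: 'a gvec. norm (pairing a b) \<le> norm a * norm b * K"
  proof (intro exI[of _ 1] allI)
    fix a b :: "'a gvec"
    have "\<bar>blinfun_apply (snd u) (fst v)\<bar> \<le> norm u * norm v" for u v :: "'a gvec"
    proof -
      have "norm (snd u) \<le> norm u" "norm (fst v) \<le> norm v"
        using norm_snd_le[of "snd u" "fst u"] norm_fst_le[of "fst v" "snd v"] by auto
      then have "norm (snd u) * norm (fst v) \<le> norm u * norm v"
        by (intro mult_mono) auto
      then show ?thesis
        using norm_blinfun[of "snd u" "fst v"] by simp
    qed
    from this[of a b] this[of b a] show "norm (pairing a b) \<le> norm a * norm b * 1"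
      by (simp add: pairing_def mult.commute)
  qed
qed (auto simp: pairing_def blinfun.bilinear_simps field_simps)

lemmas pairing_add_left = bounded_bilinear.add_left[OF bounded_bilinear_pairing]
  and pairing_add_right = bounded_bilinear.add_right[OF bounded_bilinear_pairing]
  and pairing_diff_left = bounded_bilinear.diff_left[OF bounded_bilinear_pairing]
  and pairing_diff_right = bounded_bilinear.diff_right[OF bounded_bilinear_pairing]
  and pairing_minus_left = bounded_bilinear.minus_left[OF bounded_bilinear_pairing]
  and pairing_minus_right = bounded_bilinear.minus_right[OF bounded_bilinear_pairing]
  and pairing_zero_left = bounded_bilinear.zero_left[OF bounded_bilinear_pairing]
  and pairing_zero_right = bounded_bilinear.zero_right[OF bounded_bilinear_pairing]
  and pairing_scaleR_left = bounded_bilinear.scaleR_left[OF bounded_bilinear_pairing]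
  and pairing_scaleR_right = bounded_bilinear.scaleR_right[OF bounded_bilinear_pairing]

lemmas pairing_simps = pairing_add_left pairing_add_right pairing_diff_left pairing_diff_right
  pairing_minus_left pairing_minus_right pairing_zero_left pairing_zero_right
  pairing_scaleR_left pairing_scaleR_right

lemma pairing_commute: "pairing u v = pairing v u"
  by (simp add: pairing_def)

text \<open>Nondegeneracy, tested on pure covectors and pure tangent vectors. Bracket identities are
  proved by pairing both sides with an arbitrary \<open>c\<close>.\<close>

lemma pairing_eqI:
  assumes "\<And>c. pairing u c = pairing v c"
  shows "u = v"
proof (rule prod_eqI)
  show "fst u = fst v"
    by (rule euclidean_eqI) (use assms[of "(0, blinfun_inner_left _)"] in \<open>simp add: pairing_def\<close>)
  show "snd u = snd v"
    by (rule blinfun_eqI) (use assms[of "(_, 0)"] in \<open>simp add: pairing_def\<close>)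
qed

section \<open>Endomorphisms in coordinates\<close>

lemma gvec_expand:
  "v = (\<Sum>b\<in>Basis. (fst v \<bullet> b) *\<^sub>R (b, 0))
     + (\<Sum>b\<in>Basis. blinfun_apply (snd v) b *\<^sub>R (0, blinfun_inner_left b))"
  for v :: "'e::euclidean_space gvec"
proof (rule prod_eqI)
  show "snd v = snd ((\<Sum>b\<in>Basis. (fst v \<bullet> b) *\<^sub>R (b, 0))
     + (\<Sum>b\<in>Basis. blinfun_apply (snd v) b *\<^sub>R (0, blinfun_inner_left b)))"
  proof (rule blinfun_eqI)
    fix x :: 'e
    have "blinfun_apply (snd v) x = blinfun_apply (snd v) (\<Sum>b\<in>Basis. (x \<bullet> b) *\<^sub>R b)"
      by (simp add: euclidean_representation)
    also have "\<dots> = (\<Sum>b\<in>Basis. blinfun_apply (snd v) b * (x \<bullet> b))"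
      by (simp add: blinfun.sum_right blinfun.scaleR_right mult.commute)
    finally show "blinfun_apply (snd v) x = blinfun_apply (snd ((\<Sum>b\<in>Basis. (fst v \<bullet> b) *\<^sub>R (b, 0))
     + (\<Sum>b\<in>Basis. blinfun_apply (snd v) b *\<^sub>R (0, blinfun_inner_left b)))) x"
      by (simp add: snd_sum blinfun.sum_left blinfun.scaleR_left)
  qed
qed (simp add: fst_sum euclidean_representation)

lemma linear_gvec_expand:
  fixes A :: "'e::euclidean_space gvec \<Rightarrow> 'b::real_vector"
  assumes "linear A"
  shows "A v = (\<Sum>b\<in>Basis. (fst v \<bullet> b) *\<^sub>R A (b, 0))
     + (\<Sum>b\<in>Basis. blinfun_apply (snd v) b *\<^sub>R A (0, blinfun_inner_left b))"
  by (subst gvec_expand)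
    (simp add: linear_add[OF assms] linear_sum[OF assms] linear_scale[OF assms]
      del: scaleR_Pair)

lemma bounded_linear_coord:
  "bounded_linear (\<lambda>v. fst v \<bullet> b)" "bounded_linear (\<lambda>v. blinfun_apply (snd v) b)"
  by (rule bounded_linear_compose[OF bounded_linear_inner_left bounded_linear_fst],
      rule bounded_linear_compose[OF blinfun.bounded_linear_left bounded_linear_snd])

text \<open>\<open>bundle_endo\<close> controls an endomorphism on fixed coordinate vectors only.
  Expanding \<open>s x\<close> in the fibre basis of basis vectors and dual covectors leaves a
  finite sum of products of smooth functions.\<close>

lemma smooth_map_on_apply:
  fixes B :: "'d::euclidean_space \<Rightarrow> 'e::euclidean_space gvec \<Rightarrow> 'b::real_normed_vector"
  assumes "open S" and B: "\<And>v. smooth_map_on S (\<lambda>x. B x v)" "\<And>x. x \<in> S \<Longrightarrow> linear (B x)"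
    and s: "smooth_map_on S s"
  shows "smooth_map_on S (\<lambda>x. B x (s x))"
proof -
  have "smooth_map_on S (\<lambda>x. (\<Sum>b\<in>Basis. (fst (s x) \<bullet> b) *\<^sub>R B x (b, 0))
     + (\<Sum>b\<in>Basis. blinfun_apply (snd (s x)) b *\<^sub>R B x (0, blinfun_inner_left b)))"
    by (intro smooth_map_on_add smooth_map_on_sum smooth_map_on_scaleR B assms(1)
        smooth_map_on_bounded_linear[OF assms(1) bounded_linear_coord(1) s]
        smooth_map_on_bounded_linear[OF assms(1) bounded_linear_coord(2) s])
  then show ?thesis
    by (rule smooth_map_on_cong[OF assms(1)]) (simp add: linear_gvec_expand[OF B(2), symmetric])
qed

text \<open>The other term of the product rule, the derivative of \<open>B\<close> applied to
  \<open>s x\<close>, vanishes because \<open>s x = 0\<close>.\<close>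

lemma has_derivative_apply_zero:
  fixes B :: "'d::euclidean_space \<Rightarrow> 'e::euclidean_space gvec \<Rightarrow> 'b::real_normed_vector"
  assumes "open S" "x \<in> S" and B: "\<And>v. smooth_map_on S (\<lambda>x. B x v)" "\<And>x. x \<in> S \<Longrightarrow> linear (B x)"
    and s: "(s has_derivative s') (at x)" and "s x = 0"
  shows "((\<lambda>x. B x (s x)) has_derivative (\<lambda>v. B x (s' v))) (at x)"
proof -
  have *: "((\<lambda>x. \<phi> (s x) *\<^sub>R B x e) has_derivative (\<lambda>v. \<phi> (s' v) *\<^sub>R B x e)) (at x)"
    if "bounded_linear \<phi>" for \<phi> e
    using has_derivative_scaleR[OF bounded_linear.has_derivative[OF that s]
        smooth_map_on_has_derivative[OF B(1) \<open>x \<in> S\<close>]]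
    by (simp add: \<open>s x = 0\<close> linear_0[OF bounded_linear.linear[OF that]])
  have "((\<lambda>x. (\<Sum>b\<in>Basis. (fst (s x) \<bullet> b) *\<^sub>R B x (b, 0))
       + (\<Sum>b\<in>Basis. blinfun_apply (snd (s x)) b *\<^sub>R B x (0, blinfun_inner_left b)))
     has_derivative (\<lambda>v. (\<Sum>b\<in>Basis. (fst (s' v) \<bullet> b) *\<^sub>R B x (b, 0))
       + (\<Sum>b\<in>Basis. blinfun_apply (snd (s' v)) b *\<^sub>R B x (0, blinfun_inner_left b)))) (at x)"
    by (intro has_derivative_add has_derivative_sum *[OF bounded_linear_coord(1)]
        *[OF bounded_linear_coord(2)])
  then have "((\<lambda>x. (\<Sum>b\<in>Basis. (fst (s x) \<bullet> b) *\<^sub>R B x (b, 0))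
       + (\<Sum>b\<in>Basis. blinfun_apply (snd (s x)) b *\<^sub>R B x (0, blinfun_inner_left b)))
     has_derivative (\<lambda>v. B x (s' v))) (at x)"
    by (simp add: linear_gvec_expand[OF B(2)[OF \<open>x \<in> S\<close>], symmetric])
  then show ?thesis
    by (rule has_derivative_transform_within_open[OF _ assms(1,2)])
      (simp add: linear_gvec_expand[OF B(2), symmetric])
qed

section \<open>Changes of coordinates\<close>

context
  fixes M :: "('a::{second_countable_topology, t2_space}, 'e::euclidean_space) manifold"
  assumes M: "smooth_manifold M"
begin

lemma
  assumes "c \<in> atlas M"
  shows open_cdom: "open (cdom c)"
    and open_cmap_image: "open (cmap c ` cdom c)"
    and cinv_cmap: "q \<in> cdom c \<Longrightarrow> cinv c (cmap c q) = q"
    and cmap_cinv: "x \<in> cmap c ` cdom c \<Longrightarrow> cmap c (cinv c x) = x"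
    and cinv_in_cdom: "x \<in> cmap c ` cdom c \<Longrightarrow> cinv c x \<in> cdom c"
    and continuous_on_cinv: "continuous_on (cmap c ` cdom c) (cinv c)"
proof -
  have "is_chart c" using M assms unfolding smooth_manifold_def by blast
  then show "open (cdom c)" "open (cmap c ` cdom c)"
    "q \<in> cdom c \<Longrightarrow> cinv c (cmap c q) = q"
    "x \<in> cmap c ` cdom c \<Longrightarrow> cmap c (cinv c x) = x"
    "x \<in> cmap c ` cdom c \<Longrightarrow> cinv c x \<in> cdom c"
    "continuous_on (cmap c ` cdom c) (cinv c)"
    unfolding is_chart_def homeomorphism_def by auto
qed

lemma chart_at_atlas: "chart_at M p \<in> atlas M"
  and chart_at_dom: "p \<in> cdom (chart_at M p)"
  using M unfolding smooth_manifold_def by auto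

lemma open_cmap_overlap:
  assumes "c \<in> atlas M" "d \<in> atlas M"
  shows "open (cmap c ` (cdom c \<inter> cdom d))"
proof -
  have "cmap c ` (cdom c \<inter> cdom d) = cmap c ` cdom c \<inter> cinv c -` cdom d"
    by (auto simp: cinv_cmap[OF assms(1)])
  then show ?thesis
    using continuous_open_preimage[OF continuous_on_cinv[OF assms(1)] open_cmap_image[OF assms(1)]
        open_cdom[OF assms(2)]] by simp
qed

lemma tchange_has_derivative:
  assumes "c \<in> atlas M" "d \<in> atlas M" "p \<in> cdom c" "p \<in> cdom d"
  shows "(cmap d \<circ> cinv c has_derivative blinfun_apply (tchange c d p)) (at (cmap c p))"
proof -
  have "smooth_map_on (cmap c ` (cdom c \<inter> cdom d)) (cmap d \<circ> cinv c)"
    using M assms unfolding smooth_manifold_def by blast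
  then have *: "(cmap d \<circ> cinv c has_derivative
      frechet_derivative (cmap d \<circ> cinv c) (at (cmap c p))) (at (cmap c p))"
    by (rule smooth_map_on_has_derivative) (use assms in auto)
  then show ?thesis
    unfolding tchange_def
    by (subst bounded_linear_Blinfun_apply) (auto dest: has_derivative_bounded_linear)
qed

lemma tchange_self:
  assumes "c \<in> atlas M" "p \<in> cdom c"
  shows "blinfun_apply (tchange c c p) v = v"
proof -
  have "((\<lambda>x. x) has_derivative (\<lambda>v. v)) (at (cmap c p))"
    by (rule has_derivative_ident)
  then have "(cmap c \<circ> cinv c has_derivative (\<lambda>v. v)) (at (cmap c p))"
    by (rule has_derivative_transform_within_open[OF _ open_cmap_image[OF assms(1)]])
      (use assms cmap_cinv in auto)
  from has_derivative_unique[OF this tchange_has_derivative[OF assms(1,1,2,2)]]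
  show ?thesis by metis
qed

lemma tchange_inverse:
  assumes "c \<in> atlas M" "d \<in> atlas M" "p \<in> cdom c" "p \<in> cdom d"
  shows "blinfun_apply (tchange d c p) (blinfun_apply (tchange c d p) v) = v"
proof -
  have "((cmap c \<circ> cinv d) \<circ> (cmap d \<circ> cinv c) has_derivative
      blinfun_apply (tchange d c p) \<circ> blinfun_apply (tchange c d p)) (at (cmap c p))"
    using tchange_has_derivative[OF assms(1,2,3,4)] tchange_has_derivative[OF assms(2,1,4,3)]
    by (intro diff_chain_at) (auto simp: cinv_cmap assms)
  then have "((\<lambda>x. x) has_derivative
      blinfun_apply (tchange d c p) \<circ> blinfun_apply (tchange c d p)) (at (cmap c p))"
    by (rule has_derivative_transform_within_open[OF _ open_cmap_overlap[OF assms(1,2)]])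
      (use assms in \<open>auto simp: cinv_cmap\<close>)
  from has_derivative_unique[OF this has_derivative_ident] show ?thesis
    by (metis comp_apply)
qed

lemma gchange_self:
  assumes "c \<in> atlas M" "p \<in> cdom c"
  shows "gchange c c p v = v"
  by (auto simp: gchange_def tchange_self[OF assms] intro!: prod_eqI blinfun_eqI)

lemma gchange_inverse:
  assumes "c \<in> atlas M" "d \<in> atlas M" "p \<in> cdom c" "p \<in> cdom d"
  shows "gchange d c p (gchange c d p v) = v"
  by (auto simp: gchange_def tchange_inverse[OF assms] intro!: prod_eqI blinfun_eqI)

lemma pairing_gchange:
  assumes "c \<in> atlas M" "d \<in> atlas M" "p \<in> cdom c" "p \<in> cdom d"
  shows "pairing (gchange c d p u) (gchange c d p v) = pairing u v"
  by (simp add: gchange_def pairing_def tchange_inverse[OF assms])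

end

lemma linear_gchange: "linear (gchange c d p)"
  by (rule linearI) (auto simp: gchange_def blinfun.bilinear_simps intro!: prod_eqI blinfun_eqI)

section \<open>Sections and their first jets\<close>

lemma smooth_section_rep:
  "smooth_section M s \<Longrightarrow> c \<in> atlas M \<Longrightarrow> smooth_map_on (cmap c ` cdom c) (local_rep M c s)"
  by (simp add: smooth_section_def)

lemma local_rep_add: "local_rep M c (\<lambda>q. s q + t q) = (\<lambda>x. local_rep M c s x + local_rep M c t x)"
  by (simp add: fun_eq_iff local_rep_def Let_def linear_add[OF linear_gchange])

lemma local_rep_scaleR: "local_rep M c (\<lambda>q. k *\<^sub>R s q) = (\<lambda>x. k *\<^sub>R local_rep M c s x)"
  by (simp add: fun_eq_iff local_rep_def Let_def linear_scale[OF linear_gchange])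

lemma local_rep_zero: "local_rep M c (\<lambda>q. 0) = (\<lambda>x. 0)"
  by (simp add: fun_eq_iff local_rep_def Let_def linear_0[OF linear_gchange])

text \<open>First-order part of a section in the chart in which the fibre over \<open>p\<close> is
  written. Together with the value \<open>s p\<close> it determines brackets at \<open>p\<close>. It
  is chart dependent in general and intrinsic where \<open>s p = 0\<close>.\<close>

definition jet :: "('a, 'e::euclidean_space) manifold \<Rightarrow> ('a \<Rightarrow> 'e gvec) \<Rightarrow> 'a \<Rightarrow> 'e \<Rightarrow> 'e gvec" where
  "jet M s p = frechet_derivative (local_rep M (chart_at M p) s) (at (cmap (chart_at M p) p))"

definition endo_rep ::
    "('a, 'e::euclidean_space) manifold \<Rightarrow> ('a, 'e) chart \<Rightarrow> ('a \<Rightarrow> 'e gvec \<Rightarrow> 'e gvec) \<Rightarrow> 'e \<Rightarrow> 'e gvec \<Rightarrow> 'e gvec" where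
  "endo_rep M c A x v = (let q = cinv c x in
     gchange (chart_at M q) c q (A q (gchange c (chart_at M q) q v)))"

lemma bundle_endo_iff:
  "bundle_endo M A \<longleftrightarrow> (\<forall>p. linear (A p)) \<and>
     (\<forall>c\<in>atlas M. \<forall>v. smooth_map_on (cmap c ` cdom c) (\<lambda>x. endo_rep M c A x v))"
  by (simp add: bundle_endo_def endo_rep_def)

lemma smooth_endo_rep:
  "bundle_endo M A \<Longrightarrow> c \<in> atlas M \<Longrightarrow> smooth_map_on (cmap c ` cdom c) (\<lambda>x. endo_rep M c A x v)"
  unfolding bundle_endo_iff by blast

lemma linear_endo_rep: "bundle_endo M A \<Longrightarrow> linear (endo_rep M c A x)"
  unfolding bundle_endo_iff endo_rep_def Let_def
  by (rule linearI) (auto simp: linear_add[OF linear_gchange] linear_scale[OF linear_gchange]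
      linear_add linear_scale)

lemma jet_eqI:
  "(local_rep M (chart_at M p) s has_derivative D) (at (cmap (chart_at M p) p)) \<Longrightarrow> jet M s p = D"
  unfolding jet_def using frechet_derivative_at by metis

context
  fixes M :: "('a::{second_countable_topology, t2_space}, 'e::euclidean_space) manifold"
  assumes M: "smooth_manifold M"
begin

lemmas open_image = open_cmap_image[OF M]

lemma local_rep_at: "local_rep M (chart_at M p) s (cmap (chart_at M p) p) = s p"
  by (simp add: local_rep_def cinv_cmap[OF M] chart_at_atlas[OF M] chart_at_dom[OF M]
      gchange_self[OF M])

lemma jet_has_derivative:
  "smooth_section M s \<Longrightarrow>
    (local_rep M (chart_at M p) s has_derivative jet M s p) (at (cmap (chart_at M p) p))"
  unfolding jet_def
  by (rule smooth_map_on_has_derivative[OF smooth_section_rep])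
    (auto simp: chart_at_atlas[OF M] chart_at_dom[OF M])

lemma linear_jet: "smooth_section M s \<Longrightarrow> linear (jet M s p)"
  using has_derivative_linear[OF jet_has_derivative] .

lemma smooth_section_add:
  "smooth_section M s \<Longrightarrow> smooth_section M t \<Longrightarrow> smooth_section M (\<lambda>q. s q + t q)"
  by (simp add: smooth_section_def local_rep_add smooth_map_on_add open_image)

lemma smooth_section_scaleR:
  "smooth_section M s \<Longrightarrow> smooth_section M (\<lambda>q. k *\<^sub>R s q)"
  by (simp add: smooth_section_def local_rep_scaleR smooth_map_on_bounded_linear open_image
      bounded_linear_scaleR_right)

lemma smooth_section_uminus: "smooth_section M s \<Longrightarrow> smooth_section M (\<lambda>q. - s q)"
  using smooth_section_scaleR[of s "-1"] by simp

lemma smooth_section_diff: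
  "smooth_section M s \<Longrightarrow> smooth_section M t \<Longrightarrow> smooth_section M (\<lambda>q. s q - t q)"
  using smooth_section_add[OF _ smooth_section_uminus, of s t] by simp

lemma smooth_section_zero: "smooth_section M (\<lambda>q. 0)"
  by (simp add: smooth_section_def local_rep_zero smooth_map_on_const open_image)

lemma jet_add:
  "smooth_section M s \<Longrightarrow> smooth_section M t \<Longrightarrow>
    jet M (\<lambda>q. s q + t q) p v = jet M s p v + jet M t p v"
  by (subst jet_eqI[where D = "\<lambda>v. jet M s p v + jet M t p v"])
    (auto simp: local_rep_add intro!: has_derivative_add jet_has_derivative)

lemma jet_scaleR:
  "smooth_section M s \<Longrightarrow> jet M (\<lambda>q. k *\<^sub>R s q) p v = k *\<^sub>R jet M s p v"
  by (subst jet_eqI[where D = "\<lambda>v. k *\<^sub>R jet M s p v"])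
    (auto simp: local_rep_scaleR intro!: has_derivative_scaleR_right jet_has_derivative)

lemma jet_uminus: "smooth_section M s \<Longrightarrow> jet M (\<lambda>q. - s q) p v = - jet M s p v"
  using jet_scaleR[of s "-1"] by simp

lemma endo_rep_local_rep:
  assumes "c \<in> atlas M" "x \<in> cmap c ` cdom c"
  shows "local_rep M c (\<lambda>q. A q (s q)) x = endo_rep M c A x (local_rep M c s x)"
  by (simp add: local_rep_def endo_rep_def Let_def chart_at_dom[OF M] cinv_in_cdom[OF M] assms
      gchange_inverse[OF M] chart_at_atlas[OF M])

lemma endo_rep_compose:
  assumes "c \<in> atlas M" "x \<in> cmap c ` cdom c"
  shows "endo_rep M c (\<lambda>q v. A q (B q v)) x v = endo_rep M c A x (endo_rep M c B x v)"
  by (simp add: local_rep_def endo_rep_def Let_def chart_at_dom[OF M] cinv_in_cdom[OF M] assms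
      gchange_inverse[OF M] chart_at_atlas[OF M])

lemma smooth_section_endo:
  assumes "bundle_endo M A" "smooth_section M s"
  shows "smooth_section M (\<lambda>q. A q (s q))"
  unfolding smooth_section_def
proof
  fix c assume c: "c \<in> atlas M"
  have "smooth_map_on (cmap c ` cdom c) (\<lambda>x. endo_rep M c A x (local_rep M c s x))"
    using assms c
    by (intro smooth_map_on_apply[where B = "endo_rep M c A" and s = "local_rep M c s"]
        smooth_section_rep open_image linear_endo_rep smooth_endo_rep)
  then show "smooth_map_on (cmap c ` cdom c) (local_rep M c (\<lambda>q. A q (s q)))"
    by (rule smooth_map_on_cong[OF open_image[OF c]]) (simp add: endo_rep_local_rep c)
qed

lemma bundle_endo_compose:
  assumes "bundle_endo M A" "bundle_endo M B"
  shows "bundle_endo M (\<lambda>q v. A q (B q v))"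
  unfolding bundle_endo_iff
proof (intro conjI allI ballI)
  show "linear (\<lambda>v. A p (B p v))" for p
    using assms linear_compose[of "B p" "A p"] by (simp add: bundle_endo_iff comp_def)
  fix c v assume c: "c \<in> atlas M"
  have "smooth_map_on (cmap c ` cdom c) (\<lambda>x. endo_rep M c A x (endo_rep M c B x v))"
    using assms c
    by (intro smooth_map_on_apply[where B = "endo_rep M c A" and s = "\<lambda>x. endo_rep M c B x v"]
        open_image linear_endo_rep smooth_endo_rep)
  then show "smooth_map_on (cmap c ` cdom c) (\<lambda>x. endo_rep M c (\<lambda>q v. A q (B q v)) x v)"
    by (rule smooth_map_on_cong[OF open_image[OF c]]) (simp add: endo_rep_compose c)
qed

text \<open>This is how a linear equation satisfied by a section passes to its derivative at a zero:
  the derivative of \<open>A\<close> only meets the value \<open>0\<close>.\<close>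

lemma jet_endo_zero:
  assumes "bundle_endo M A" "smooth_section M s" "s p = 0"
  shows "jet M (\<lambda>q. A q (s q)) p v = A p (jet M s p v)"
proof -
  let ?c = "chart_at M p"
  have c: "?c \<in> atlas M" and p: "p \<in> cdom ?c"
    by (auto simp: chart_at_atlas[OF M] chart_at_dom[OF M])
  have "((\<lambda>x. endo_rep M ?c A x (local_rep M ?c s x)) has_derivative
      (\<lambda>v. endo_rep M ?c A (cmap ?c p) (jet M s p v))) (at (cmap ?c p))"
    using assms c p
    by (intro has_derivative_apply_zero[where B = "endo_rep M ?c A" and s = "local_rep M ?c s",
          OF open_image[OF c]] jet_has_derivative linear_endo_rep smooth_endo_rep)
      (auto simp: local_rep_at)
  then have "(local_rep M ?c (\<lambda>q. A q (s q)) has_derivative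
      (\<lambda>v. endo_rep M ?c A (cmap ?c p) (jet M s p v))) (at (cmap ?c p))"
    by (rule has_derivative_transform_within_open[OF _ open_image[OF c]])
      (use c p in \<open>auto simp: endo_rep_local_rep\<close>)
  from jet_eqI[OF this] show ?thesis
    by (simp add: endo_rep_def cinv_cmap[OF M c p] gchange_self[OF M c p])
qed

lemma pairing_local_rep:
  assumes "c \<in> atlas M" "x \<in> cmap c ` cdom c"
  shows "pairing (local_rep M c s x) (local_rep M c t x) = pairing (s (cinv c x)) (t (cinv c x))"
  by (simp add: local_rep_def Let_def pairing_gchange[OF M] chart_at_dom[OF M]
      cinv_in_cdom[OF M] assms chart_at_atlas[OF M])

text \<open>Coordinate changes preserve the pairing, so the pairing of the local representatives is
  the same constant \<open>k\<close>. Its derivative, expanded by the product rule, is zero.\<close>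

lemma jet_pairing_const:
  assumes "smooth_section M s" "smooth_section M t" "\<And>q. pairing (s q) (t q) = k"
  shows "pairing (s p) (jet M t p v) + pairing (jet M s p v) (t p) = 0"
proof -
  let ?c = "chart_at M p"
  have c: "?c \<in> atlas M" and p: "p \<in> cdom ?c"
    by (auto simp: chart_at_atlas[OF M] chart_at_dom[OF M])
  have "((\<lambda>x. pairing (local_rep M ?c s x) (local_rep M ?c t x)) has_derivative
     (\<lambda>v. pairing (s p) (jet M t p v) + pairing (jet M s p v) (t p))) (at (cmap ?c p))"
    using bounded_bilinear.FDERIV[OF bounded_bilinear_pairing jet_has_derivative[OF assms(1)]
        jet_has_derivative[OF assms(2)]] by (simp add: local_rep_at)
  moreover have "((\<lambda>x. pairing (local_rep M ?c s x) (local_rep M ?c t x)) has_derivative (\<lambda>v. 0))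
     (at (cmap ?c p))"
    by (rule has_derivative_transform_within_open[OF has_derivative_const[of k] open_image[OF c]])
      (use c p in \<open>simp_all add: pairing_local_rep assms(3)\<close>)
  ultimately show ?thesis
    by (rule fun_cong[OF has_derivative_unique])
qed

section \<open>The Courant bracket in terms of jets\<close>

text \<open>In coordinates, half of the terms of the Lie derivatives that differentiate the vector
  fields cancel against the exterior derivative. What remains combines into pairings with jets in
  the direction of the tangent part of \<open>c\<close>. In this form the properties of the bracket
  become linear algebra on values and jets.\<close>

lemma pairing_courant:
  assumes "linear (H p (fst (a p)) (fst (b p)))" "smooth_section M a" "smooth_section M b"
  shows "pairing (courant M H a b p) c =
    pairing (jet M b p (fst (a p)) - jet M a p (fst (b p))) c
    + (pairing (jet M a p (fst c)) (b p) - pairing (a p) (jet M b p (fst c))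
       + H p (fst (a p)) (fst (b p)) (fst c)) / 2"
proof -
  let ?c = "chart_at M p"
  let ?x = "cmap ?c p"
  let ?A = "jet M a p" and ?B = "jet M b p"
  have d: "((\<lambda>y. fst (local_rep M ?c s y)) has_derivative (\<lambda>v. fst (jet M s p v))) (at ?x)"
    "((\<lambda>y. snd (local_rep M ?c s y)) has_derivative (\<lambda>v. snd (jet M s p v))) (at ?x)"
    if "smooth_section M s" for s
    using jet_has_derivative[OF that] by (auto intro!: derivative_intros)
  note f = frechet_derivative_at[OF d(1)[OF assms(2)], symmetric]
    frechet_derivative_at[OF d(1)[OF assms(3)], symmetric]
    frechet_derivative_at[OF d(2)[OF assms(2)], symmetric]
    frechet_derivative_at[OF d(2)[OF assms(3)], symmetric]
  have "((\<lambda>y. blinfun_apply (snd (local_rep M ?c b y)) (fst (local_rep M ?c a y))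
      - blinfun_apply (snd (local_rep M ?c a y)) (fst (local_rep M ?c b y))) has_derivative
    (\<lambda>v. (blinfun_apply (snd (b p)) (fst (?A v)) + blinfun_apply (snd (?B v)) (fst (a p)))
      - (blinfun_apply (snd (a p)) (fst (?B v)) + blinfun_apply (snd (?A v)) (fst (b p))))) (at ?x)"
    using has_derivative_diff[OF
        bounded_bilinear.FDERIV[OF bounded_bilinear_blinfun_apply d(2)[OF assms(3)] d(1)[OF assms(2)]]
        bounded_bilinear.FDERIV[OF bounded_bilinear_blinfun_apply d(2)[OF assms(2)] d(1)[OF assms(3)]]]
    by (simp add: local_rep_at)
  note e = frechet_derivative_at[OF this, symmetric] has_derivative_bounded_linear[OF this]
  have bl: "bounded_linear (\<lambda>v. fst (?A v))" "bounded_linear (\<lambda>v. fst (?B v))"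
    using d(1) assms has_derivative_bounded_linear by blast+
  show ?thesis
    using assms(1)
    unfolding courant_def Let_def pairing_def lie_bracket_def lie_deriv_def ext_d_def f e(1) local_rep_at
    by (simp add: bounded_linear_Blinfun_apply bl e(2) blinfun.bilinear_simps local_rep_at
        linear_conv_bounded_linear field_simps)
qed

end

section \<open>Algebra of bundle endomorphisms\<close>

context
  fixes M :: "('a::{second_countable_topology, t2_space}, 'e::euclidean_space) manifold"
  assumes M: "smooth_manifold M"
begin

lemma bundle_endo_add:
  assumes "bundle_endo M A" "bundle_endo M B"
  shows "bundle_endo M (\<lambda>p v. A p v + B p v)"
  unfolding bundle_endo_iff
proof (intro conjI allI ballI)
  show "linear (\<lambda>v. A p v + B p v)" for p
    using assms by (simp add: bundle_endo_iff linear_compose_add)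
  have *: "endo_rep M c (\<lambda>p v. A p v + B p v) x v = endo_rep M c A x v + endo_rep M c B x v" for c x v
    by (simp add: endo_rep_def Let_def linear_add[OF linear_gchange])
  show "smooth_map_on (cmap c ` cdom c) (\<lambda>x. endo_rep M c (\<lambda>p v. A p v + B p v) x v)"
    if "c \<in> atlas M" for c v
    unfolding * using that assms by (intro smooth_map_on_add smooth_endo_rep open_image[OF M])
qed

lemma bundle_endo_uminus:
  assumes "bundle_endo M A"
  shows "bundle_endo M (\<lambda>p v. - A p v)"
  unfolding bundle_endo_iff
proof (intro conjI allI ballI)
  show "linear (\<lambda>v. - A p v)" for p
    using assms by (simp add: bundle_endo_iff linear_compose_neg)
  have *: "endo_rep M c (\<lambda>p v. - A p v) x v = - endo_rep M c A x v" for c x v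
    by (simp add: endo_rep_def Let_def linear_neg[OF linear_gchange])
  show "smooth_map_on (cmap c ` cdom c) (\<lambda>x. endo_rep M c (\<lambda>p v. - A p v) x v)"
    if "c \<in> atlas M" for c v
    unfolding * using that assms
    by (intro smooth_map_on_bounded_linear[where L = uminus] smooth_endo_rep open_image[OF M]
        bounded_linear_minus bounded_linear_ident)
qed

lemma bundle_endo_diff:
  "bundle_endo M A \<Longrightarrow> bundle_endo M B \<Longrightarrow> bundle_endo M (\<lambda>p v. A p v - B p v)"
  using bundle_endo_add[OF _ bundle_endo_uminus, of A B] by simp

lemma linear_tens: "linear (tens E F)"
  by (rule linearI) (simp_all add: tens_def pairing_simps algebra_simps)

lemma bundle_endo_tens:
  assumes "smooth_section M E" "smooth_section M F"
  shows "bundle_endo M (\<lambda>p. tens (E p) (F p))"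
  unfolding bundle_endo_iff
proof (intro conjI allI ballI)
  fix c v assume c: "c \<in> atlas M"
  have *: "endo_rep M c (\<lambda>p. tens (E p) (F p)) x v
      = (2 * pairing (local_rep M c F x) v) *\<^sub>R local_rep M c E x" if x: "x \<in> cmap c ` cdom c" for x
  proof -
    let ?q = "cinv c x"
    \<comment> \<open>The vector \<open>v\<close> is written in chart \<open>c\<close>, the value of
      \<open>F\<close> in the chart chosen at \<open>?q\<close>; invariance of the pairing brings
      both into \<open>c\<close>.\<close>
    have "pairing (F ?q) (gchange c (chart_at M ?q) ?q v)
        = pairing (local_rep M c F x) v"
      using pairing_gchange[OF M c chart_at_atlas[OF M], of ?q ?q
          "gchange (chart_at M ?q) c ?q (F ?q)" v]
        gchange_inverse[OF M chart_at_atlas[OF M] c, of ?q ?q "F ?q"]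
        cinv_in_cdom[OF M c x] chart_at_dom[OF M]
      by (simp add: local_rep_def Let_def)
    then show ?thesis
      by (simp add: endo_rep_def Let_def tens_def linear_scale[OF linear_gchange] local_rep_def)
  qed
  have "smooth_map_on (cmap c ` cdom c) (\<lambda>x. pairing (local_rep M c F x) v)"
    using bounded_bilinear.bounded_linear_left[OF bounded_bilinear_pairing] assms c
    by (intro smooth_map_on_bounded_linear[where L = "\<lambda>w. pairing w v"] open_image[OF M]
        smooth_section_rep)
  then have "smooth_map_on (cmap c ` cdom c) (\<lambda>x. 2 * pairing (local_rep M c F x) v)"
    by (intro smooth_map_on_bounded_linear[where L = "\<lambda>r. 2 * r"] open_image[OF M] c
        bounded_linear_mult_right)
  then have "smooth_map_on (cmap c ` cdom c)
      (\<lambda>x. (2 * pairing (local_rep M c F x) v) *\<^sub>R local_rep M c E x)"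
    using assms c by (intro smooth_map_on_scaleR open_image[OF M] smooth_section_rep)
  then show "smooth_map_on (cmap c ` cdom c) (\<lambda>x. endo_rep M c (\<lambda>p. tens (E p) (F p)) x v)"
    by (rule smooth_map_on_cong[OF open_image[OF M c]]) (simp add: *)
qed (rule linear_tens)

end

section \<open>Splitting of the fibres over a product\<close>

lemma blinfun_apply_inclusions:
  "blinfun_apply (Blinfun (\<lambda>x::'e::euclidean_space. (x, 0::'f::euclidean_space))) u = (u, 0)"
  "blinfun_apply (Blinfun (\<lambda>y::'f. (0::'e, y))) v = (0, v)"
  by (auto intro!: bounded_linear_Blinfun_apply[THEN fun_cong] bounded_linear_Pair
      bounded_linear_zero bounded_linear_ident)

lemma gfst_gjoin [simp]: "gfst (gjoin u v) = u"
  by (auto simp: gfst_def gjoin_def blinfun_apply_inclusions blinfun.bilinear_simps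
      intro!: prod_eqI blinfun_eqI)

lemma gsnd_gjoin [simp]: "gsnd (gjoin u v) = v"
  by (auto simp: gsnd_def gjoin_def blinfun_apply_inclusions blinfun.bilinear_simps
      intro!: prod_eqI blinfun_eqI)

lemma gjoin_gfst_gsnd [simp]: "gjoin (gfst w) (gsnd w) = w"
proof -
  have "blinfun_apply (snd w) (a, 0) + blinfun_apply (snd w) (0, b) = blinfun_apply (snd w) (a, b)" for a b
    by (simp flip: blinfun.add_right)
  then show ?thesis
    by (auto simp: gfst_def gsnd_def gjoin_def blinfun_apply_inclusions blinfun.bilinear_simps
        intro!: prod_eqI blinfun_eqI)
qed

lemma gjoin_eq_iff [simp]: "gjoin u v = gjoin u' v' \<longleftrightarrow> u = u' \<and> v = v'"
  by (metis gfst_gjoin gsnd_gjoin)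

lemma fst_gjoin [simp]: "fst (gjoin u v) = (fst u, fst v)"
  by (simp add: gjoin_def)

lemma gjoin_add: "gjoin u v + gjoin u' v' = gjoin (u + u') (v + v')"
  by (auto simp: gjoin_def blinfun.bilinear_simps intro!: prod_eqI blinfun_eqI)

lemma gjoin_scaleR: "k *\<^sub>R gjoin u v = gjoin (k *\<^sub>R u) (k *\<^sub>R v)"
  by (auto simp: gjoin_def blinfun.bilinear_simps algebra_simps intro!: prod_eqI blinfun_eqI)

lemma gjoin_uminus: "- gjoin u v = gjoin (- u) (- v)"
  using gjoin_scaleR[of "-1" u v] by simp

lemma gjoin_diff: "gjoin u v - gjoin u' v' = gjoin (u - u') (v - v')"
  using gjoin_add[of u v "- u'" "- v'"] by (simp add: gjoin_uminus[symmetric])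

lemma gjoin_zero [simp]: "gjoin 0 0 = 0"
  using gjoin_scaleR[of 0 0 0] by simp

lemma gjoin_eq_zero_iff [simp]: "gjoin u v = 0 \<longleftrightarrow> u = 0 \<and> v = 0"
  using gjoin_eq_iff[of u v 0 0] by simp

lemma linear_gfst: "linear gfst"
  by (rule linearI) (auto simp: gfst_def blinfun.bilinear_simps intro!: prod_eqI blinfun_eqI)

lemma linear_gsnd: "linear gsnd"
  by (rule linearI) (auto simp: gsnd_def blinfun.bilinear_simps intro!: prod_eqI blinfun_eqI)

lemma linear_gjoin_left: "linear (\<lambda>u. gjoin u 0)"
  by (rule linearI) (simp_all add: gjoin_add gjoin_scaleR)

lemma linear_gjoin_right: "linear (\<lambda>v. gjoin 0 v)"
  by (rule linearI) (simp_all add: gjoin_add gjoin_scaleR)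

lemma pairing_gjoin: "pairing (gjoin u v) (gjoin u' v') = pairing u u' + pairing v v'"
  by (simp add: gjoin_def pairing_def blinfun.bilinear_simps field_simps)

lemma linear_gvec_bounded_linear:
  fixes A :: "'e::euclidean_space gvec \<Rightarrow> 'b::real_normed_vector"
  assumes "linear A"
  shows "bounded_linear A"
proof -
  have "bounded_linear (\<lambda>v. (\<Sum>b\<in>Basis. (fst v \<bullet> b) *\<^sub>R A (b, 0))
     + (\<Sum>b\<in>Basis. blinfun_apply (snd v) b *\<^sub>R A (0, blinfun_inner_left b)))"
    by (intro bounded_linear_add bounded_linear_sum
        bounded_linear_compose[OF bounded_linear_scaleR_left] bounded_linear_coord)
  then show ?thesis
    by (simp add: linear_gvec_expand[OF assms, symmetric])
qed

lemmas bounded_linear_gfst = linear_gvec_bounded_linear[OF linear_gfst]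
  and bounded_linear_gsnd = linear_gvec_bounded_linear[OF linear_gsnd]
  and bounded_linear_gjoin_left = linear_gvec_bounded_linear[OF linear_gjoin_left]
  and bounded_linear_gjoin_right = linear_gvec_bounded_linear[OF linear_gjoin_right]

section \<open>The product manifold\<close>

lemma smooth_map_on_Pair:
  assumes "open S" "smooth_map_on S f" "smooth_map_on S g"
  shows "smooth_map_on S (\<lambda>x. (f x, g x))"
proof -
  have "smooth_map_on S (\<lambda>x. (f x, 0) + (0, g x))"
    using assms
    by (intro smooth_map_on_add smooth_map_on_bounded_linear[where L = "\<lambda>u. (u, 0)"]
        smooth_map_on_bounded_linear[where L = "\<lambda>u. (0, u)"] bounded_linear_Pair
        bounded_linear_zero bounded_linear_ident)
  then show ?thesis by simp
qed

lemma cdom_chart_prod [simp]: "cdom (chart_prod c d) = cdom c \<times> cdom d"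
  and cmap_chart_prod [simp]: "cmap (chart_prod c d) = map_prod (cmap c) (cmap d)"
  by (simp_all add: chart_prod_def)

lemma atlas_prod: "atlas (manifold_prod M N) = {chart_prod c d | c d. c \<in> atlas M \<and> d \<in> atlas N}"
  and chart_at_prod [simp]: "chart_at (manifold_prod M N) (p, q) = chart_prod (chart_at M p) (chart_at N q)"
  by (simp_all add: manifold_prod_def)

lemma chart_prod_in_atlas: "c \<in> atlas M \<Longrightarrow> d \<in> atlas N \<Longrightarrow> chart_prod c d \<in> atlas (manifold_prod M N)"
  by (auto simp: atlas_prod)

lemma map_prod_image: "map_prod f g ` (A \<times> B) = (f ` A) \<times> (g ` B)"
  by force

context
  fixes M :: "('a::{second_countable_topology, t2_space}, 'e::euclidean_space) manifold"
    and N :: "('b::{second_countable_topology, t2_space}, 'f::euclidean_space) manifold"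
  assumes M: "smooth_manifold M" and N: "smooth_manifold N"
begin

lemma cinv_chart_prod:
  assumes "c \<in> atlas M" "d \<in> atlas N" "x \<in> cmap c ` cdom c" "y \<in> cmap d ` cdom d"
  shows "cinv (chart_prod c d) (x, y) = (cinv c x, cinv d y)"
  unfolding cinv_def[of "chart_prod c d"]
proof (rule the_inv_into_f_eq)
  have "inj_on (cmap c) (cdom c)" "inj_on (cmap d) (cdom d)"
    using cinv_cmap[OF M assms(1)] cinv_cmap[OF N assms(2)] by (auto intro: inj_on_inverseI)
  then show "inj_on (cmap (chart_prod c d)) (cdom (chart_prod c d))"
    by (simp add: map_prod_inj_on)
qed (use assms in \<open>auto simp: cmap_cinv[OF M] cmap_cinv[OF N] cinv_cmap[OF M] cinv_cmap[OF N]\<close>)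

lemma is_chart_prod:
  assumes "c \<in> atlas M" "d \<in> atlas N"
  shows "is_chart (chart_prod c d)"
proof -
  have c: "is_chart c" and d: "is_chart d"
    using M N assms unfolding smooth_manifold_def by auto
  have *: "continuous_on (S \<times> T) (\<lambda>z. (f (fst z), g (snd z)))"
    if "continuous_on S f" "continuous_on T g"
    for S :: "'x::topological_space set" and T :: "'y::topological_space set"
      and f :: "'x \<Rightarrow> 'u::topological_space" and g :: "'y \<Rightarrow> 'v::topological_space"
    by (rule continuous_on_Pair[OF
          continuous_on_compose2[OF that(1) continuous_on_fst[OF continuous_on_id]]
          continuous_on_compose2[OF that(2) continuous_on_snd[OF continuous_on_id]]]) auto
  have "continuous_on ((cmap c ` cdom c) \<times> (cmap d ` cdom d)) (\<lambda>z. (cinv c (fst z), cinv d (snd z)))"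
    using c d unfolding is_chart_def homeomorphism_def by (intro *) auto
  then have 1: "continuous_on ((cmap c ` cdom c) \<times> (cmap d ` cdom d)) (cinv (chart_prod c d))"
    by (rule continuous_on_cong[THEN iffD1, rotated 2]) (auto simp: cinv_chart_prod assms)
  have 2: "continuous_on (cdom c \<times> cdom d) (map_prod (cmap c) (cmap d))"
    using c d *[of "cdom c" "cmap c" "cdom d" "cmap d"]
    unfolding is_chart_def homeomorphism_def map_prod_def case_prod_beta by simp
  have 3: "cinv (chart_prod c d) (cmap c p, cmap d q) = (p, q)" if "p \<in> cdom c" "q \<in> cdom d" for p q
    using that by (simp add: cinv_chart_prod assms cinv_cmap[OF M] cinv_cmap[OF N])
  have 4: "cinv (chart_prod c d) ` (cmap c ` cdom c \<times> cmap d ` cdom d) = cdom c \<times> cdom d"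
    using 3 by (force simp: image_iff)
  show ?thesis
    unfolding is_chart_def homeomorphism_def
    using 1 2 3 4 open_cdom[OF M assms(1)] open_cdom[OF N assms(2)] open_image[OF M assms(1)]
      open_image[OF N assms(2)]
    by (auto simp: map_prod_image open_Times)
qed

lemma smooth_manifold_prod: "smooth_manifold (manifold_prod M N)"
  unfolding smooth_manifold_def
proof (intro conjI ballI allI)
  fix k l assume "k \<in> atlas (manifold_prod M N)" "l \<in> atlas (manifold_prod M N)"
  then obtain c d c' d' where k: "k = chart_prod c d" "c \<in> atlas M" "d \<in> atlas N"
    and l: "l = chart_prod c' d'" "c' \<in> atlas M" "d' \<in> atlas N"
    by (auto simp: atlas_prod)
  let ?S = "cmap c ` (cdom c \<inter> cdom c')" and ?T = "cmap d ` (cdom d \<inter> cdom d')"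
  have op: "open ?S" "open ?T"
    using open_cmap_overlap[OF M] open_cmap_overlap[OF N] k l by auto
  have "smooth_map_on ?S (cmap c' \<circ> cinv c)" "smooth_map_on ?T (cmap d' \<circ> cinv d)"
    using M N k l unfolding smooth_manifold_def by auto
  then have "smooth_map_on (?S \<times> ?T) (\<lambda>z. ((cmap c' \<circ> cinv c) (fst z), (cmap d' \<circ> cinv d) (snd z)))"
    using op by (intro smooth_map_on_Pair smooth_map_on_fst smooth_map_on_snd open_Times)
  then have "smooth_map_on (?S \<times> ?T) (cmap l \<circ> cinv k)"
    by (rule smooth_map_on_cong[OF open_Times[OF op]])
      (auto simp: k l cinv_chart_prod cinv_cmap[OF M] cinv_cmap[OF N])
  then show "smooth_map_on (cmap k ` (cdom k \<inter> cdom l)) (cmap l \<circ> cinv k)"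
    by (simp add: k l map_prod_image Times_Int_Times)
next
  show "chart_at (manifold_prod M N) z \<in> atlas (manifold_prod M N)" for z
    by (cases z) (auto simp: chart_prod_in_atlas chart_at_atlas[OF M] chart_at_atlas[OF N])
  show "z \<in> cdom (chart_at (manifold_prod M N) z)" for z
    by (cases z) (auto simp: chart_at_dom[OF M] chart_at_dom[OF N])
qed (auto simp: atlas_prod is_chart_prod)

lemma tchange_prod:
  assumes "c \<in> atlas M" "c' \<in> atlas M" "p \<in> cdom c" "p \<in> cdom c'"
    and "d \<in> atlas N" "d' \<in> atlas N" "q \<in> cdom d" "q \<in> cdom d'"
  shows "blinfun_apply (tchange (chart_prod c d) (chart_prod c' d') (p, q)) w
    = (blinfun_apply (tchange c c' p) (fst w), blinfun_apply (tchange d d' q) (snd w))"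
proof -
  let ?x = "(cmap c p, cmap d q)"
  have "((\<lambda>z. ((cmap c' \<circ> cinv c) (fst z), (cmap d' \<circ> cinv d) (snd z))) has_derivative
     (\<lambda>w. (blinfun_apply (tchange c c' p) (fst w), blinfun_apply (tchange d d' q) (snd w)))) (at ?x)"
    using has_derivative_compose[OF has_derivative_fst[OF has_derivative_ident], of "cmap c' \<circ> cinv c" _ ?x]
      has_derivative_compose[OF has_derivative_snd[OF has_derivative_ident], of "cmap d' \<circ> cinv d" _ ?x]
      tchange_has_derivative[OF M assms(1-4)] tchange_has_derivative[OF N assms(5-8)]
    by (intro has_derivative_Pair) auto
  then have "(cmap (chart_prod c' d') \<circ> cinv (chart_prod c d) has_derivative
     (\<lambda>w. (blinfun_apply (tchange c c' p) (fst w), blinfun_apply (tchange d d' q) (snd w)))) (at ?x)"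
    by (rule has_derivative_transform_within_open[OF _ open_Times[OF open_image[OF M assms(1)]
            open_image[OF N assms(5)]]])
      (use assms in \<open>auto simp: cinv_chart_prod cinv_cmap[OF M] cinv_cmap[OF N]\<close>)
  moreover have "(cmap (chart_prod c' d') \<circ> cinv (chart_prod c d) has_derivative
     blinfun_apply (tchange (chart_prod c d) (chart_prod c' d') (p, q))) (at ?x)"
    using tchange_has_derivative[OF smooth_manifold_prod, of "chart_prod c d" "chart_prod c' d'" "(p, q)"]
      assms by (simp add: chart_prod_in_atlas)
  ultimately show ?thesis
    using fun_cong[OF has_derivative_unique] by blast
qed

lemma gchange_prod:
  assumes "c \<in> atlas M" "c' \<in> atlas M" "p \<in> cdom c" "p \<in> cdom c'"
    and "d \<in> atlas N" "d' \<in> atlas N" "q \<in> cdom d" "q \<in> cdom d'"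
  shows "gchange (chart_prod c d) (chart_prod c' d') (p, q) (gjoin u v)
    = gjoin (gchange c c' p u) (gchange d d' q v)"
proof (rule prod_eqI)
  show "snd (gchange (chart_prod c d) (chart_prod c' d') (p, q) (gjoin u v))
    = snd (gjoin (gchange c c' p u) (gchange d d' q v))"
    using assms
    by (intro blinfun_eqI) (simp add: gchange_def gjoin_def tchange_prod blinfun.bilinear_simps)
qed (simp add: gchange_def tchange_prod[OF assms])

text \<open>Coordinate changes of a product act blockwise. At the given point each component only
  sees the value of \<open>W\<close> there, so it may be read as the representative of a slice with
  the other coordinate frozen.\<close>

lemma local_rep_prod:
  assumes "c \<in> atlas M" "d \<in> atlas N" "x \<in> cmap c ` cdom c" "y \<in> cmap d ` cdom d"
  shows "local_rep (manifold_prod M N) (chart_prod c d) W (x, y)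
    = gjoin (local_rep M c (\<lambda>p. gfst (W (p, cinv d y))) x) (local_rep N d (\<lambda>q. gsnd (W (cinv c x, q))) y)"
proof -
  let ?p = "cinv c x" and ?q = "cinv d y"
  have "gchange (chart_prod (chart_at M ?p) (chart_at N ?q)) (chart_prod c d) (?p, ?q)
      (gjoin (gfst (W (?p, ?q))) (gsnd (W (?p, ?q)))) =
    gjoin (gchange (chart_at M ?p) c ?p (gfst (W (?p, ?q)))) (gchange (chart_at N ?q) d ?q (gsnd (W (?p, ?q))))"
    using assms
    by (intro gchange_prod)
      (auto simp: chart_at_atlas[OF M] chart_at_atlas[OF N] chart_at_dom[OF M] chart_at_dom[OF N]
        cinv_cmap[OF M] cinv_cmap[OF N])
  then show ?thesis
    by (simp add: local_rep_def Let_def cinv_chart_prod assms)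
qed

text \<open>In product charts a slice is the composition with an affine inclusion, followed by the
  projection to one block of the fibre.\<close>

lemma smooth_section_slice:
  assumes "smooth_section (manifold_prod M N) W"
  shows "smooth_section M (\<lambda>p. gfst (W (p, q)))" "smooth_section N (\<lambda>q. gsnd (W (p, q)))"
proof -
  show "smooth_section M (\<lambda>p. gfst (W (p, q)))"
    unfolding smooth_section_def
  proof
    fix c assume c: "c \<in> atlas M"
    let ?d = "chart_at N q"
    have d: "?d \<in> atlas N" "q \<in> cdom ?d" by (auto simp: chart_at_atlas[OF N] chart_at_dom[OF N])
    have "smooth_map_on (cmap c ` cdom c)
        (\<lambda>x. gfst (local_rep (manifold_prod M N) (chart_prod c ?d) W (x, cmap ?d q)))"
    proof (intro smooth_map_on_bounded_linear[OF open_image[OF M c] bounded_linear_gfst])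
      show "smooth_map_on (cmap c ` cdom c)
          (\<lambda>x. local_rep (manifold_prod M N) (chart_prod c ?d) W (x, cmap ?d q))"
        using smooth_section_rep[OF assms chart_prod_in_atlas[OF c d(1)]]
        by (rule smooth_map_on_compose_affine[where A = "\<lambda>v. (v, 0)", OF open_image[OF M c], rotated 2])
          (use d in \<open>auto simp: map_prod_image intro!: has_derivative_Pair derivative_intros\<close>)
    qed
    then show "smooth_map_on (cmap c ` cdom c) (local_rep M c (\<lambda>p. gfst (W (p, q))))"
      by (rule smooth_map_on_cong[OF open_image[OF M c]])
        (use d in \<open>simp add: local_rep_prod c cinv_cmap[OF N]\<close>)
  qed
  show "smooth_section N (\<lambda>q. gsnd (W (p, q)))"
    unfolding smooth_section_def
  proof
    fix d assume d: "d \<in> atlas N"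
    let ?c = "chart_at M p"
    have c: "?c \<in> atlas M" "p \<in> cdom ?c" by (auto simp: chart_at_atlas[OF M] chart_at_dom[OF M])
    have "smooth_map_on (cmap d ` cdom d)
        (\<lambda>y. gsnd (local_rep (manifold_prod M N) (chart_prod ?c d) W (cmap ?c p, y)))"
    proof (intro smooth_map_on_bounded_linear[OF open_image[OF N d] bounded_linear_gsnd])
      show "smooth_map_on (cmap d ` cdom d)
          (\<lambda>y. local_rep (manifold_prod M N) (chart_prod ?c d) W (cmap ?c p, y))"
        using smooth_section_rep[OF assms chart_prod_in_atlas[OF c(1) d]]
        by (rule smooth_map_on_compose_affine[where A = "\<lambda>v. (0, v)", OF open_image[OF N d], rotated 2])
          (use c in \<open>auto simp: map_prod_image intro!: has_derivative_Pair derivative_intros\<close>)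
    qed
    then show "smooth_map_on (cmap d ` cdom d) (local_rep N d (\<lambda>q. gsnd (W (p, q))))"
      by (rule smooth_map_on_cong[OF open_image[OF N d]])
        (use c in \<open>simp add: local_rep_prod d cinv_cmap[OF M]\<close>)
  qed
qed

end

section \<open>Bilinearity and invariance of the Courant bracket\<close>

context
  fixes M :: "('a::{second_countable_topology, t2_space}, 'e::euclidean_space) manifold"
    and H :: "'a \<Rightarrow> 'e \<Rightarrow> 'e \<Rightarrow> 'e \<Rightarrow> real"
  assumes M: "smooth_manifold M" and H: "three_form M H"
begin

lemma three_form_linear:
  "linear (\<lambda>z. H p z u v)" "linear (\<lambda>z. H p u z v)" "linear (\<lambda>z. H p u v z)" "linear (H p u v)"
  using H by (auto simp: three_form_def)

lemma three_form_swap12: "H p u v w = - H p v u w"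
proof -
  have "H p (u + v) (u + v) w = H p u u w + H p u v w + (H p v u w + H p v v w)"
    by (simp add: linear_add[OF three_form_linear(1)] linear_add[OF three_form_linear(2)])
  then show ?thesis using H by (simp add: three_form_def)
qed

lemma three_form_swap23: "H p u v w = - H p u w v"
proof -
  have "H p u (v + w) (v + w) = H p u v v + H p u w v + (H p u v w + H p u w w)"
    by (simp add: linear_add[OF three_form_linear(3)] linear_add[OF three_form_linear(2)])
  then show ?thesis using H by (simp add: three_form_def)
qed

lemma pairing_courant_form:
  assumes "smooth_section M a" "smooth_section M b"
  shows "pairing (courant M H a b p) c =
    pairing (jet M b p (fst (a p)) - jet M a p (fst (b p))) c
    + (pairing (jet M a p (fst c)) (b p) - pairing (a p) (jet M b p (fst c))
       + H p (fst (a p)) (fst (b p)) (fst c)) / 2"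
  by (rule pairing_courant[where H = H, OF M three_form_linear(4) assms])

lemma courant_antisym:
  assumes "smooth_section M a" "smooth_section M b"
  shows "courant M H b a p = - courant M H a b p"
proof (rule pairing_eqI)
  show "pairing (courant M H b a p) c = pairing (- courant M H a b p) c" for c
    unfolding pairing_minus_left pairing_courant_form[OF assms] pairing_courant_form[OF assms(2,1)]
    using three_form_swap12[of p "fst (a p)" "fst (b p)" "fst c"]
    by (simp add: pairing_simps pairing_commute[of "a p"] pairing_commute[of "b p"] field_simps)
qed

lemma courant_add_left:
  assumes "smooth_section M a" "smooth_section M a'" "smooth_section M b"
  shows "courant M H (\<lambda>q. a q + a' q) b p = courant M H a b p + courant M H a' b p"
proof (rule pairing_eqI)
  show "pairing (courant M H (\<lambda>q. a q + a' q) b p) c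
      = pairing (courant M H a b p + courant M H a' b p) c" for c
    using assms
    by (simp add: pairing_courant_form smooth_section_add[OF M] pairing_simps jet_add[OF M]
        linear_add[OF three_form_linear(1)] linear_add[OF linear_jet[OF M]] field_simps)
qed

lemma courant_scaleR_left:
  assumes "smooth_section M a" "smooth_section M b"
  shows "courant M H (\<lambda>q. k *\<^sub>R a q) b p = k *\<^sub>R courant M H a b p"
proof (rule pairing_eqI)
  show "pairing (courant M H (\<lambda>q. k *\<^sub>R a q) b p) c = pairing (k *\<^sub>R courant M H a b p) c" for c
    using assms
    by (simp add: pairing_courant_form smooth_section_scaleR[OF M] pairing_simps jet_scaleR[OF M]
        linear_scale[OF three_form_linear(1)] linear_scale[OF linear_jet[OF M]] field_simps)
qed

lemma courant_uminus_left:
  assumes "smooth_section M a" "smooth_section M b"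
  shows "courant M H (\<lambda>q. - a q) b p = - courant M H a b p"
  using courant_scaleR_left[OF assms, of "-1"] by simp

lemma courant_diff_left:
  assumes "smooth_section M a" "smooth_section M a'" "smooth_section M b"
  shows "courant M H (\<lambda>q. a q - a' q) b p = courant M H a b p - courant M H a' b p"
  using courant_add_left[OF assms(1) smooth_section_uminus[OF M assms(2)] assms(3)]
    courant_uminus_left[OF assms(2,3)] by simp

lemma courant_zero_left: "smooth_section M b \<Longrightarrow> courant M H (\<lambda>q. 0) b p = 0"
  using courant_scaleR_left[OF smooth_section_zero[OF M], of b 0] by simp

lemma courant_zero_right: "smooth_section M a \<Longrightarrow> courant M H a (\<lambda>q. 0) p = 0"
  by (simp add: courant_antisym[OF smooth_section_zero[OF M]] courant_zero_left)

lemma courant_self: "smooth_section M a \<Longrightarrow> courant M H a a p = 0"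
  using courant_antisym[of a a p] by (metis add.right_inverse scaleR_2 scaleR_eq_0_iff zero_neq_numeral)

text \<open>For sections with constant pairings the exact terms in the invariance identity drop out.\<close>

lemma courant_invariant:
  assumes sm: "smooth_section M a" "smooth_section M b" "smooth_section M c"
    and const: "\<And>q. pairing (a q) (b q) = k" "\<And>q. pairing (b q) (c q) = l" "\<And>q. pairing (a q) (c q) = m"
  shows "pairing (courant M H a b p) (c p) + pairing (b p) (courant M H a c p) = 0"
proof -
  note j = jet_pairing_const[OF M sm(1,2) const(1), of p] jet_pairing_const[OF M sm(2,3) const(2), of p]
    jet_pairing_const[OF M sm(1,3) const(3), of p]
  note s = pairing_commute[of "a p"] pairing_commute[of "b p"] pairing_commute[of "c p"]
  show ?thesis
    \<comment> \<open>Each constant pairing is differentiated along the tangent part of the third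
      section; the two three-form terms cancel by antisymmetry.\<close>
    using j(2)[of "fst (a p)"] j(1)[of "fst (c p)"] j(3)[of "fst (b p)"]
      three_form_swap23[of p "fst (a p)" "fst (b p)" "fst (c p)"]
    unfolding pairing_commute[of "b p" "courant M H a c p"] pairing_courant_form[OF sm(1,2)]
      pairing_courant_form[OF sm(1,3)]
    by (simp add: pairing_simps s add_divide_distrib diff_divide_distrib)
qed

end

section \<open>Complex sections\<close>

text \<open>The complex bilinear (not Hermitian) extension of \<open>pairing\<close>; isotropy is
  meant with respect to it.\<close>

definition cpair :: "'e::euclidean_space cgvec \<Rightarrow> 'e cgvec \<Rightarrow> complex" where
  "cpair u v = Complex (pairing (fst u) (fst v) - pairing (snd u) (snd v))
     (pairing (fst u) (snd v) + pairing (snd u) (fst v))"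

definition csubspace :: "'e::euclidean_space cgvec set \<Rightarrow> bool" where
  "csubspace L \<longleftrightarrow> 0 \<in> L \<and> (\<forall>u\<in>L. \<forall>v\<in>L. u + v \<in> L) \<and> (\<forall>k. \<forall>u\<in>L. cscale k u \<in> L)"

definition csmooth :: "('a, 'e::euclidean_space) manifold \<Rightarrow> ('a \<Rightarrow> 'e cgvec) \<Rightarrow> bool" where
  "csmooth M w \<longleftrightarrow> smooth_section M (\<lambda>p. fst (w p)) \<and> smooth_section M (\<lambda>p. snd (w p))"

definition cjet :: "('a, 'e::euclidean_space) manifold \<Rightarrow> ('a \<Rightarrow> 'e cgvec) \<Rightarrow> 'a \<Rightarrow> 'e \<Rightarrow> 'e cgvec" where
  "cjet M w p v = (jet M (\<lambda>q. fst (w q)) p v, jet M (\<lambda>q. snd (w q)) p v)"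

text \<open>Unlike \<open>prod_eq_iff\<close>, this does not also split the two generalized vectors.\<close>

lemma cgvec_eq_iff: "u = v \<longleftrightarrow> fst u = fst v \<and> snd u = snd v"
  for u v :: "'e::euclidean_space cgvec"
  by (rule prod_eq_iff)

lemma csection_of_iff: "csection_of M L w \<longleftrightarrow> csmooth M w \<and> (\<forall>p. w p \<in> L p)"
  by (auto simp: csection_of_def csmooth_def)

lemma cscale_add: "cscale k (u + v) = cscale k u + cscale k v"
  by (simp add: cscale_def algebra_simps)

lemma cscale_minus_one: "cscale (-1) u = - u"
  by (simp add: cscale_def prod_eq_iff)

lemma cscale_cscale: "cscale k (cscale l u) = cscale (k * l) u"
  by (simp add: cscale_def algebra_simps prod_eq_iff)

lemma cscale_zero [simp]: "cscale k 0 = 0"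
  by (simp add: cscale_def prod_eq_iff)

lemma cscale_zero_left [simp]: "cscale 0 u = 0"
  by (simp add: cscale_def cgvec_eq_iff)

lemma cscale_one [simp]: "cscale 1 u = u"
  by (simp add: cscale_def)

lemma cscale_minus: "cscale k (- u) = - cscale k u"
  by (simp add: cscale_def prod_eq_iff)

lemma cpair_commute: "cpair u v = cpair v u"
  by (simp add: cpair_def pairing_commute)

lemma cpair_add_left: "cpair (u + u') v = cpair u v + cpair u' v"
  by (simp add: cpair_def pairing_simps complex_eq_iff)

lemma cpair_cscale_left: "cpair (cscale k u) v = k * cpair u v"
  by (simp add: cpair_def cscale_def pairing_simps complex_eq_iff algebra_simps)

lemma cpair_add_right: "cpair u (v + v') = cpair u v + cpair u v'"
  by (simp add: cpair_commute[of u] cpair_add_left)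

lemma cpair_cscale_right: "cpair u (cscale k v) = k * cpair u v"
  by (simp add: cpair_commute[of u] cpair_cscale_left)

lemma
  assumes "csubspace L"
  shows csubspace_zero: "0 \<in> L"
    and csubspace_add: "u \<in> L \<Longrightarrow> v \<in> L \<Longrightarrow> u + v \<in> L"
    and csubspace_cscale: "u \<in> L \<Longrightarrow> cscale k u \<in> L"
    and csubspace_minus: "u \<in> L \<Longrightarrow> - u \<in> L"
    and csubspace_diff: "u \<in> L \<Longrightarrow> v \<in> L \<Longrightarrow> u - v \<in> L"
proof -
  show 0: "0 \<in> L" and a: "u \<in> L \<Longrightarrow> v \<in> L \<Longrightarrow> u + v \<in> L" and "u \<in> L \<Longrightarrow> cscale k u \<in> L" for u v k
    using assms by (auto simp: csubspace_def)
  show m: "u \<in> L \<Longrightarrow> - u \<in> L" for u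
    using assms cscale_minus_one[of u] unfolding csubspace_def by metis
  show "u \<in> L \<Longrightarrow> v \<in> L \<Longrightarrow> u - v \<in> L"
    using a[OF _ m, of u v] by simp
qed

context
  fixes M :: "('a::{second_countable_topology, t2_space}, 'e::euclidean_space) manifold"
  assumes M: "smooth_manifold M"
begin

lemma csmooth_add: "csmooth M w \<Longrightarrow> csmooth M z \<Longrightarrow> csmooth M (\<lambda>q. w q + z q)"
  by (simp add: csmooth_def smooth_section_add[OF M])

lemma csmooth_cscale: "csmooth M w \<Longrightarrow> csmooth M (\<lambda>q. cscale k (w q))"
  by (simp add: csmooth_def cscale_def smooth_section_add[OF M] smooth_section_diff[OF M]
      smooth_section_scaleR[OF M])

lemma csmooth_diff: "csmooth M w \<Longrightarrow> csmooth M z \<Longrightarrow> csmooth M (\<lambda>q. w q - z q)"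
  using csmooth_add[OF _ csmooth_cscale[of z "-1"], of w] by (simp add: cscale_minus_one)

lemma csmooth_real: "smooth_section M E \<Longrightarrow> csmooth M (\<lambda>q. (E q, 0))"
  by (simp add: csmooth_def smooth_section_zero[OF M])

lemma csmooth_cext: "bundle_endo M A \<Longrightarrow> csmooth M w \<Longrightarrow> csmooth M (\<lambda>q. cext (A q) (w q))"
  using smooth_section_endo[OF M, of A "\<lambda>q. fst (w q)"] smooth_section_endo[OF M, of A "\<lambda>q. snd (w q)"]
  by (simp add: csmooth_def cext_def)

end

context
  fixes M :: "('a::{second_countable_topology, t2_space}, 'e::euclidean_space) manifold"
    and H :: "'a \<Rightarrow> 'e \<Rightarrow> 'e \<Rightarrow> 'e \<Rightarrow> real"
  assumes M: "smooth_manifold M" and H: "three_form M H"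
begin

lemma ccourant_antisym:
  assumes "csmooth M w" "csmooth M z"
  shows "ccourant M H z w p = - ccourant M H w z p"
  using assms courant_antisym[OF M H, of "\<lambda>q. fst (w q)" "\<lambda>q. fst (z q)" p]
    courant_antisym[OF M H, of "\<lambda>q. snd (w q)" "\<lambda>q. snd (z q)" p]
    courant_antisym[OF M H, of "\<lambda>q. fst (w q)" "\<lambda>q. snd (z q)" p]
    courant_antisym[OF M H, of "\<lambda>q. snd (w q)" "\<lambda>q. fst (z q)" p]
  by (simp add: ccourant_def csmooth_def Let_def)

lemma ccourant_add_left:
  assumes "csmooth M w" "csmooth M w'" "csmooth M z"
  shows "ccourant M H (\<lambda>q. w q + w' q) z p = ccourant M H w z p + ccourant M H w' z p"
  using assms by (simp add: ccourant_def csmooth_def Let_def courant_add_left[OF M H])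

lemma ccourant_cscale_left:
  assumes "csmooth M w" "csmooth M z"
  shows "ccourant M H (\<lambda>q. cscale k (w q)) z p = cscale k (ccourant M H w z p)"
  using assms
  by (simp add: ccourant_def csmooth_def Let_def cscale_def courant_add_left[OF M H]
      courant_diff_left[OF M H] courant_scaleR_left[OF M H] smooth_section_scaleR[OF M] algebra_simps)

lemma ccourant_add_right:
  assumes "csmooth M w" "csmooth M z" "csmooth M z'"
  shows "ccourant M H w (\<lambda>q. z q + z' q) p = ccourant M H w z p + ccourant M H w z' p"
  using assms
  by (simp add: ccourant_antisym[of _ w] csmooth_add[OF M] ccourant_add_left)

lemma ccourant_cscale_right:
  assumes "csmooth M w" "csmooth M z"
  shows "ccourant M H w (\<lambda>q. cscale k (z q)) p = cscale k (ccourant M H w z p)"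
  using assms
  by (simp add: ccourant_antisym[of _ w] csmooth_cscale[OF M] ccourant_cscale_left cscale_minus)

lemma ccourant_real_left:
  assumes "smooth_section M E" "csmooth M w"
  shows "ccourant M H (\<lambda>q. (E q, 0)) w p
    = (courant M H E (\<lambda>q. fst (w q)) p, courant M H E (\<lambda>q. snd (w q)) p)"
  using assms by (simp add: ccourant_def Let_def csmooth_def courant_zero_left[OF M H])

text \<open>With \<open>w p = 0\<close> only terms with the derivative of \<open>w\<close> survive.
  Those paired with \<open>z p\<close> vanish because the derivatives lie in \<open>L\<close> and
  \<open>L\<close> annihilates \<open>z p\<close>. What is left is minus the derivative of
  \<open>w\<close> along the complex tangent vector \<open>?z1 + \<i> ?z2\<close>, again an element
  of \<open>L\<close>.\<close>

lemma ccourant_zero_at: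
  assumes w: "csmooth M w" "w p = 0" and z: "csmooth M z"
    and L: "csubspace L" "\<And>v. cjet M w p v \<in> L" "\<And>u. u \<in> L \<Longrightarrow> cpair u (z p) = 0"
  shows "ccourant M H w z p \<in> L"
proof -
  let ?j = "cjet M w p"
  let ?z1 = "fst (fst (z p))" and ?z2 = "fst (snd (z p))"
  have "cpair (?j v) (z p) = 0" for v
    using L by blast
  then have iso: "pairing (fst (?j v)) (fst (z p)) = pairing (snd (?j v)) (snd (z p))"
    "pairing (fst (?j v)) (snd (z p)) = - pairing (snd (?j v)) (fst (z p))" for v
    by (simp_all add: cpair_def complex_eq_iff eq_neg_iff_add_eq_0)
  have sm: "smooth_section M (\<lambda>q. fst (w q))" "smooth_section M (\<lambda>q. snd (w q))"
    "smooth_section M (\<lambda>q. fst (z q))" "smooth_section M (\<lambda>q. snd (z q))"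
    using w z by (auto simp: csmooth_def)
  note 0 = linear_0[OF linear_jet[OF M sm(3)]] linear_0[OF linear_jet[OF M sm(4)]]
    linear_0[OF three_form_linear(1)[OF M H]]
  have "ccourant M H w z p = - (?j ?z1) - cscale \<i> (?j ?z2)"
  proof (rule prod_eqI; rule pairing_eqI)
    show "pairing (fst (ccourant M H w z p)) c = pairing (fst (- (?j ?z1) - cscale \<i> (?j ?z2))) c" for c
      using iso[of "fst c"]
      by (simp add: ccourant_def Let_def pairing_courant_form[OF M H] sm pairing_simps w(2) cjet_def
          cscale_def 0)
    show "pairing (snd (ccourant M H w z p)) c = pairing (snd (- (?j ?z1) - cscale \<i> (?j ?z2))) c" for c
      using iso[of "fst c"]
      by (simp add: ccourant_def Let_def pairing_courant_form[OF M H] sm pairing_simps w(2) cjet_def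
          cscale_def 0)
  qed
  then show ?thesis
    using csubspace_diff[OF L(1) csubspace_minus[OF L(1) L(2)[of ?z1]]
        csubspace_cscale[OF L(1) L(2)[of ?z2], of \<i>]] by simp
qed

end

section \<open>Isotropic bundles\<close>

text \<open>
  The last clause follows from smoothness of the bundle \<open>L\<close>; with isotropy it makes membership of
  \<open>ccourant M H w z p\<close> in \<open>L p\<close> depend only on the values of \<open>w\<close> and \<open>z\<close> at \<open>p\<close>.
\<close>

definition isotropic_bundle ::
    "('a, 'e::euclidean_space) manifold \<Rightarrow> ('a \<Rightarrow> 'e cgvec set) \<Rightarrow> bool" where
  "isotropic_bundle M L \<longleftrightarrow>
     (\<forall>p. csubspace (L p)) \<and> (\<forall>p. \<forall>u\<in>L p. \<forall>v\<in>L p. cpair u v = 0) \<and>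
     (\<forall>w p v. csection_of M L w \<longrightarrow> w p = 0 \<longrightarrow> cjet M w p v \<in> L p)"

context
  fixes M :: "('a::{second_countable_topology, t2_space}, 'e::euclidean_space) manifold"
    and H :: "'a \<Rightarrow> 'e \<Rightarrow> 'e \<Rightarrow> 'e \<Rightarrow> real"
  assumes M: "smooth_manifold M" and H: "three_form M H"
begin

lemma csection_of_diff:
  assumes "isotropic_bundle M L" "csection_of M L w" "csection_of M L z"
  shows "csection_of M L (\<lambda>q. w q - z q)"
  using assms by (auto simp: csection_of_iff isotropic_bundle_def csmooth_diff[OF M] intro: csubspace_diff)

lemma ccourant_section_zero_at:
  assumes "isotropic_bundle M L" "csection_of M L w" "csection_of M L z" "w p = 0"
  shows "ccourant M H w z p \<in> L p"
  using assms
  by (intro ccourant_zero_at[OF M H]) (auto simp: csection_of_iff isotropic_bundle_def)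

text \<open>Telescoping: \<open>[[w, z]] = [[w - w', z]] + [[w', z - z']] + [[w', z']]\<close>,
  where the first two brackets have an argument that vanishes at \<open>p\<close>. Hence
  involutivity at \<open>p\<close> may be checked on any convenient sections with the prescribed
  values.\<close>

lemma ccourant_cong_at:
  assumes L: "isotropic_bundle M L"
    and w: "csection_of M L w" "csection_of M L w'" "w p = w' p"
    and z: "csection_of M L z" "csection_of M L z'" "z p = z' p"
    and "ccourant M H w' z' p \<in> L p"
  shows "ccourant M H w z p \<in> L p"
proof -
  have sub: "csubspace (L p)" using L by (simp add: isotropic_bundle_def)
  note wd = csection_of_diff[OF L w(1,2)] and zd = csection_of_diff[OF L z(1,2)]
  have cs: "csmooth M w" "csmooth M w'" "csmooth M z" "csmooth M z'"
    "csmooth M (\<lambda>q. w q - w' q)" "csmooth M (\<lambda>q. z q - z' q)"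
    using w z wd zd by (auto simp: csection_of_iff)
  have 1: "ccourant M H (\<lambda>q. w q - w' q) z p \<in> L p"
    using ccourant_section_zero_at[OF L wd z(1)] w by simp
  have "ccourant M H (\<lambda>q. z q - z' q) w' p \<in> L p"
    using ccourant_section_zero_at[OF L zd w(2)] z by simp
  then have 2: "ccourant M H w' (\<lambda>q. z q - z' q) p \<in> L p"
    using ccourant_antisym[OF M H cs(6,2), of p] csubspace_minus[OF sub] by simp
  have "ccourant M H w z p = ccourant M H (\<lambda>q. w q - w' q) z p + ccourant M H w' z p"
    using ccourant_add_left[OF M H cs(5,2,3)] by simp
  also have "ccourant M H w' z p = ccourant M H w' (\<lambda>q. z q - z' q) p + ccourant M H w' z' p"
    using ccourant_add_right[OF M H cs(2,6,4)] by simp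
  finally show ?thesis
    using 1 2 assms(8) csubspace_add[OF sub] by simp
qed

end

lemma mem_i_eigen_iff: "u \<in> i_eigen A p \<longleftrightarrow> A p (fst u) = - snd u \<and> A p (snd u) = fst u"
  by (simp add: i_eigen_def cext_def cscale_def prod_eq_iff)

lemma csubspace_i_eigen:
  assumes "linear (A p)"
  shows "csubspace (i_eigen A p)"
  by (auto simp: csubspace_def mem_i_eigen_iff linear_0[OF assms] linear_add[OF assms]
      linear_diff[OF assms] linear_scale[OF assms] cscale_def)

lemma is_adjoint_skew: "is_adjoint A (\<lambda>v. - A v) \<Longrightarrow> pairing (A u) v = - pairing u (A v)"
  unfolding is_adjoint_def pairing_minus_right by blast

text \<open>Moving \<open>A\<close> across the pairing gives
  \<open>\<i> * cpair u v = - \<i> * cpair u v\<close>.\<close>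

lemma cpair_i_eigen:
  assumes "is_adjoint (A p) (\<lambda>v. - A p v)" "u \<in> i_eigen A p" "v \<in> i_eigen A p"
  shows "cpair u v = 0"
proof -
  have u: "A p (fst u) = - snd u" "A p (snd u) = fst u" and v: "A p (fst v) = - snd v" "A p (snd v) = fst v"
    using assms by (auto simp: mem_i_eigen_iff)
  show ?thesis
    using is_adjoint_skew[OF assms(1), of "fst u" "snd v"] is_adjoint_skew[OF assms(1), of "snd u" "snd v"]
    by (simp add: u v cpair_def complex_eq_iff pairing_simps)
qed

text \<open>The eigenvalue equation is linear with smooth coefficients, so it can be differentiated
  at a zero of the section.\<close>

lemma isotropic_bundle_i_eigen:
  assumes M: "smooth_manifold M" and "bundle_endo M A" "\<And>p. is_adjoint (A p) (\<lambda>v. - A p v)"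
  shows "isotropic_bundle M (i_eigen A)"
  unfolding isotropic_bundle_def
proof (intro conjI allI ballI impI)
  fix w p v assume w: "csection_of M (i_eigen A) w" "w p = 0"
  then have sm: "smooth_section M (\<lambda>q. fst (w q))" "smooth_section M (\<lambda>q. snd (w q))"
    and "A q (fst (w q)) = - snd (w q)" "A q (snd (w q)) = fst (w q)" for q
    by (auto simp: csection_of_def mem_i_eigen_iff)
  then show "cjet M w p v \<in> i_eigen A p"
    using jet_endo_zero[OF M assms(2) sm(1), of p v] jet_endo_zero[OF M assms(2) sm(2), of p v]
    by (simp add: mem_i_eigen_iff cjet_def w(2) jet_uminus[OF M])
qed (use assms in \<open>auto intro: csubspace_i_eigen cpair_i_eigen simp: bundle_endo_iff\<close>)

section \<open>Generalized almost contact structures\<close>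

lemma gen_almost_contact_swap:
  "gen_almost_contact M \<Phi> Ep Em \<Longrightarrow> gen_almost_contact M \<Phi> Em Ep"
  by (simp add: gen_almost_contact_def pairing_commute ac_simps)

lemma
  assumes "gen_almost_contact M \<Phi> Ep Em"
  shows almost_contact_endo: "bundle_endo M \<Phi>"
    and almost_contact_linear: "linear (\<Phi> p)"
    and almost_contact_section: "smooth_section M Ep"
    and almost_contact_adjoint: "is_adjoint (\<Phi> p) (\<lambda>v. - \<Phi> p v)"
    and almost_contact_skew: "pairing (\<Phi> p u) v = - pairing u (\<Phi> p v)"
    and almost_contact_square: "\<Phi> p (\<Phi> p v) =
      - v + (2 * pairing (Em p) v) *\<^sub>R Ep p + (2 * pairing (Ep p) v) *\<^sub>R Em p"
    and almost_contact_pairing: "pairing (Ep p) (Ep p) = 0" "pairing (Ep p) (Em p) = 1 / 2"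
proof -
  show "bundle_endo M \<Phi>" "smooth_section M Ep" and *: "is_adjoint (\<Phi> p) (\<lambda>v. - \<Phi> p v)"
    and "pairing (Ep p) (Ep p) = 0"
    using assms unfolding gen_almost_contact_def by blast+
  then show "linear (\<Phi> p)" by (simp add: bundle_endo_iff)
  show "pairing (\<Phi> p u) v = - pairing u (\<Phi> p v)" by (rule is_adjoint_skew[OF *])
  show "\<Phi> p (\<Phi> p v) = - v + (2 * pairing (Em p) v) *\<^sub>R Ep p + (2 * pairing (Ep p) v) *\<^sub>R Em p"
    using assms unfolding gen_almost_contact_def tens_def by blast
  have "2 * pairing (Ep p) (Em p) = 1"
    using assms unfolding gen_almost_contact_def by blast
  then show "pairing (Ep p) (Em p) = 1 / 2" by simp
qed

text \<open>The formula for the square gives \<open>\<Phi> (\<Phi> E+) = 0\<close>. Skewness gives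
  \<open><E+, \<Phi> E+> = 0\<close>, and then the square formula at \<open>\<Phi> E+\<close> shows
  that this vector is a multiple \<open>k E+\<close>. Applying \<open>\<Phi>\<close> once more
  yields \<open>k \<Phi> E+ = 0\<close>, so \<open>\<Phi> E+ = 0\<close> whether or not
  \<open>k\<close> is zero. The second claim is the adjoint statement.\<close>

lemma almost_contact_kernel:
  assumes "gen_almost_contact M \<Phi> Ep Em"
  shows "\<Phi> p (Ep p) = 0" "pairing (Ep p) (\<Phi> p v) = 0"
proof -
  note lin = almost_contact_linear[OF assms, of p] and sq = almost_contact_square[OF assms, of p]
    and pr = almost_contact_pairing[OF assms, of p]
  let ?y = "\<Phi> p (Ep p)"
  have 1: "\<Phi> p ?y = 0"
    using sq[of "Ep p"] pr by (simp add: pairing_commute[of "Em p"])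
  have "pairing (Ep p) ?y = 0"
    using almost_contact_skew[OF assms, of p "Ep p" "Ep p"] by (simp add: pairing_commute)
  then have 2: "?y = (2 * pairing (Em p) ?y) *\<^sub>R Ep p"
    using sq[of ?y] 1 linear_0[OF lin] by (simp add: add.commute)
  have "0 = (2 * pairing (Em p) ?y) *\<^sub>R ?y"
    using 1 2 linear_scale[OF lin, of "2 * pairing (Em p) ?y" "Ep p"] by metis
  then show 0: "?y = 0" using 2 by auto
  show "pairing (Ep p) (\<Phi> p v) = 0"
    using almost_contact_skew[OF assms, of p "Ep p" v] 0 by (simp add: pairing_simps)
qed

text \<open>Consequently \<open>- \<Phi>^2\<close> is a projection with kernel spanned by
  \<open>E+\<close> and \<open>E-\<close>, defined by a smooth bundle map on the whole
  manifold.\<close>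

lemma almost_contact_cube:
  assumes "gen_almost_contact M \<Phi> Ep Em"
  shows "\<Phi> p (\<Phi> p (\<Phi> p v)) = - \<Phi> p v"
  using almost_contact_square[OF assms, of p "\<Phi> p v"] almost_contact_kernel(2)[OF assms]
    almost_contact_kernel(2)[OF gen_almost_contact_swap[OF assms]] by simp

lemma mem_contact_L_iff:
  "u \<in> contact_L \<Phi> E p \<longleftrightarrow> (\<exists>k e. e \<in> i_eigen \<Phi> p \<and> u = cscale k (E p, 0) + e)"
  unfolding contact_L_def bundle_sum_def cline_def by blast

lemma pairing_E_i_eigen:
  assumes "gen_almost_contact M \<Phi> Ep Em" "e \<in> i_eigen \<Phi> p"
  shows "pairing (Ep p) (fst e) = 0" "pairing (Ep p) (snd e) = 0"
proof -
  have e: "fst e = \<Phi> p (snd e)" "snd e = - \<Phi> p (fst e)"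
    using assms(2) by (auto simp: mem_i_eigen_iff)
  show "pairing (Ep p) (fst e) = 0"
    by (subst e(1)) (rule almost_contact_kernel(2)[OF assms(1)])
  show "pairing (Ep p) (snd e) = 0"
    by (subst e(2)) (simp add: pairing_minus_right almost_contact_kernel(2)[OF assms(1)])
qed

context
  fixes M :: "('a::{second_countable_topology, t2_space}, 'e::euclidean_space) manifold"
    and \<Phi> :: "'a \<Rightarrow> 'e gvec \<Rightarrow> 'e gvec" and Ep Em :: "'a \<Rightarrow> 'e gvec"
  assumes ac: "gen_almost_contact M \<Phi> Ep Em"
begin

lemma almost_contact_i_eigen_iff:
  "e \<in> i_eigen \<Phi> p \<longleftrightarrow> \<Phi> p (fst e) = - snd e \<and> e = - cext (\<Phi> p) (cext (\<Phi> p) e)"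
proof
  assume "e \<in> i_eigen \<Phi> p"
  then have "\<Phi> p (fst e) = - snd e" "\<Phi> p (snd e) = fst e" by (auto simp: mem_i_eigen_iff)
  then show "\<Phi> p (fst e) = - snd e \<and> e = - cext (\<Phi> p) (cext (\<Phi> p) e)"
    using linear_neg[OF almost_contact_linear[OF ac], of p "snd e"]
    by (simp add: cext_def cgvec_eq_iff)
next
  assume *: "\<Phi> p (fst e) = - snd e \<and> e = - cext (\<Phi> p) (cext (\<Phi> p) e)"
  then have "fst e = - \<Phi> p (\<Phi> p (fst e))"
    by (metis cext_def fst_conv fst_uminus)
  then have "\<Phi> p (snd e) = fst e"
    using * linear_neg[OF almost_contact_linear[OF ac], of p "snd e"] by simp
  then show "e \<in> i_eigen \<Phi> p" using * by (simp add: mem_i_eigen_iff)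
qed

text \<open>The hypotheses are the real and imaginary parts of
  \<open>\<Phi> (\<Phi> u) = \<i> \<Phi> u\<close>: the vector \<open>\<Phi> u\<close>, and with it
  \<open>- \<Phi>^2 u\<close>, is an eigenvector. In this form they follow for vectors that differ
  from eigenvectors by multiples of \<open>E+\<close> and \<open>E-\<close>.\<close>

lemma minus_square_i_eigen:
  assumes "\<Phi> p (fst u) = \<Phi> p (\<Phi> p (snd u))" "\<Phi> p (snd u) = - \<Phi> p (\<Phi> p (fst u))"
  shows "- cext (\<Phi> p) (cext (\<Phi> p) u) \<in> i_eigen \<Phi> p"
  using assms linear_neg[OF almost_contact_linear[OF ac]]
  by (simp add: mem_i_eigen_iff cext_def almost_contact_cube[OF ac])

lemma cext_square_cline: "cext (\<Phi> p) (cext (\<Phi> p) (cscale k (Ep p, 0))) = 0"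
  by (simp add: cext_def cscale_def linear_scale[OF almost_contact_linear[OF ac]]
      almost_contact_kernel[OF ac] linear_0[OF almost_contact_linear[OF ac]] cgvec_eq_iff)

lemma cext_add: "cext (\<Phi> p) (u + v) = cext (\<Phi> p) u + cext (\<Phi> p) v"
  by (simp add: cext_def linear_add[OF almost_contact_linear[OF ac]])

text \<open>Since \<open>\<Phi>\<close> kills \<open>E+\<close>, the projection
  \<open>- \<Phi>^2\<close> recovers the eigenvector component. The decomposition of a smooth
  section is therefore smooth without choosing a frame.\<close>

lemma contact_L_decompose:
  assumes "u \<in> contact_L \<Phi> Ep p"
  obtains k where "u = cscale k (Ep p, 0) + - cext (\<Phi> p) (cext (\<Phi> p) u)"
    "- cext (\<Phi> p) (cext (\<Phi> p) u) \<in> i_eigen \<Phi> p"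
proof -
  obtain k e where e: "e \<in> i_eigen \<Phi> p" and u: "u = cscale k (Ep p, 0) + e"
    using assms unfolding mem_contact_L_iff by blast
  have "- cext (\<Phi> p) (cext (\<Phi> p) u) = e"
    using e by (simp add: u cext_add cext_square_cline almost_contact_i_eigen_iff)
  then show ?thesis using that e u by blast
qed

text \<open>Replaces the existential description by linear equations with smooth coefficients, which
  survive differentiation at a zero. They say that \<open>u\<close> is orthogonal to
  \<open>E+\<close> and that \<open>\<Phi> u\<close> is an eigenvector.\<close>

lemma contact_L_iff:
  "u \<in> contact_L \<Phi> Ep p \<longleftrightarrow> pairing (Ep p) (fst u) = 0 \<and> pairing (Ep p) (snd u) = 0 \<and>
     \<Phi> p (fst u) = \<Phi> p (\<Phi> p (snd u)) \<and> \<Phi> p (snd u) = - \<Phi> p (\<Phi> p (fst u))"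
proof
  note lin = almost_contact_linear[OF ac, of p]
  assume "u \<in> contact_L \<Phi> Ep p"
  then obtain k e where e: "e \<in> i_eigen \<Phi> p" and u: "u = cscale k (Ep p, 0) + e"
    unfolding mem_contact_L_iff by blast
  have e': "\<Phi> p (fst e) = - snd e" "\<Phi> p (snd e) = fst e"
    using e by (auto simp: mem_i_eigen_iff)
  have u': "fst u = Re k *\<^sub>R Ep p + fst e" "snd u = Im k *\<^sub>R Ep p + snd e"
    by (simp_all add: u cscale_def)
  have \<Phi>u: "\<Phi> p (fst u) = - snd e" "\<Phi> p (snd u) = fst e"
    unfolding u' by (simp_all add: linear_add[OF lin] linear_scale[OF lin] almost_contact_kernel[OF ac] e')
  have "pairing (Ep p) (fst u) = 0" "pairing (Ep p) (snd u) = 0"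
    unfolding u' by (simp_all add: pairing_simps almost_contact_pairing[OF ac] pairing_E_i_eigen[OF ac e])
  then show "pairing (Ep p) (fst u) = 0 \<and> pairing (Ep p) (snd u) = 0 \<and>
     \<Phi> p (fst u) = \<Phi> p (\<Phi> p (snd u)) \<and> \<Phi> p (snd u) = - \<Phi> p (\<Phi> p (fst u))"
    by (simp add: \<Phi>u e' linear_neg[OF lin])
next
  assume *: "pairing (Ep p) (fst u) = 0 \<and> pairing (Ep p) (snd u) = 0 \<and>
     \<Phi> p (fst u) = \<Phi> p (\<Phi> p (snd u)) \<and> \<Phi> p (snd u) = - \<Phi> p (\<Phi> p (fst u))"
  let ?e = "- cext (\<Phi> p) (cext (\<Phi> p) u)"
  have e: "?e \<in> i_eigen \<Phi> p"
    using * by (intro minus_square_i_eigen) blast+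
  \<comment> \<open>The coefficient of \<open>E+\<close> is read off from the formula for
    \<open>\<Phi>^2\<close>; the factor 2 comes from the normalization
    \<open>2 <E+, E-> = 1\<close>.\<close>
  have "u = cscale (Complex (2 * pairing (Em p) (fst u)) (2 * pairing (Em p) (snd u))) (Ep p, 0) + ?e"
    using conjunct1[OF *] conjunct1[OF conjunct2[OF *]]
    by (simp add: cgvec_eq_iff cext_def cscale_def almost_contact_square[OF ac])
  then show "u \<in> contact_L \<Phi> Ep p"
    using e unfolding mem_contact_L_iff by blast
qed

text \<open>The component of \<open>u\<close> along \<open>E+\<close> is \<open>2 <E-, u>\<close>,
  so \<open>E-\<close> detects whether it is present.\<close>

lemma contact_L_Em_zero:
  assumes "u \<in> contact_L \<Phi> Ep p" "pairing (Em p) (fst u) = 0" "pairing (Em p) (snd u) = 0"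
  shows "u \<in> i_eigen \<Phi> p"
proof -
  have "pairing (Ep p) (fst u) = 0" "pairing (Ep p) (snd u) = 0"
    using assms(1) unfolding contact_L_iff by blast+
  then have "- cext (\<Phi> p) (cext (\<Phi> p) u) = u"
    using assms(2,3) by (simp add: cgvec_eq_iff cext_def almost_contact_square[OF ac])
  then show ?thesis
    using assms(1) contact_L_decompose by metis
qed

lemma i_eigen_contact_L: "e \<in> i_eigen \<Phi> p \<Longrightarrow> e \<in> contact_L \<Phi> Ep p"
  unfolding mem_contact_L_iff by (rule exI[of _ 0], rule exI[of _ e]) simp

lemma E_contact_L: "(Ep p, 0) \<in> contact_L \<Phi> Ep p"
  unfolding mem_contact_L_iff
  by (rule exI[of _ 1], rule exI[of _ 0])
    (simp add: csubspace_zero[OF csubspace_i_eigen[OF almost_contact_linear[OF ac]]])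

lemma csubspace_contact_L: "csubspace (contact_L \<Phi> Ep p)"
  unfolding csubspace_def
proof (intro conjI ballI allI)
  have sub: "csubspace (i_eigen \<Phi> p)"
    by (rule csubspace_i_eigen[OF almost_contact_linear[OF ac]])
  show "0 \<in> contact_L \<Phi> Ep p"
    by (rule i_eigen_contact_L[OF csubspace_zero[OF sub]])
  fix u assume "u \<in> contact_L \<Phi> Ep p"
  then obtain k e where u: "e \<in> i_eigen \<Phi> p" "u = cscale k (Ep p, 0) + e"
    unfolding mem_contact_L_iff by blast
  show "cscale m u \<in> contact_L \<Phi> Ep p" for m
    unfolding mem_contact_L_iff u cscale_add cscale_cscale
    using csubspace_cscale[OF sub u(1)] by blast
  fix v assume "v \<in> contact_L \<Phi> Ep p"
  then obtain l f where v: "f \<in> i_eigen \<Phi> p" "v = cscale l (Ep p, 0) + f"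
    unfolding mem_contact_L_iff by blast
  have "u + v = cscale (k + l) (Ep p, 0) + (e + f)"
    by (simp add: u v cscale_def cgvec_eq_iff scaleR_add_left)
  then show "u + v \<in> contact_L \<Phi> Ep p"
    unfolding mem_contact_L_iff using csubspace_add[OF sub u(1) v(1)] by blast
qed

section \<open>Isotropy of the contact bundles, and their involutivity in terms of the
  eigenbundle\<close>

context
  assumes M: "smooth_manifold M"
begin

lemma isotropic_bundle_contact_L: "isotropic_bundle M (contact_L \<Phi> Ep)"
  unfolding isotropic_bundle_def
proof (intro conjI allI ballI impI)
  fix p u v assume "u \<in> contact_L \<Phi> Ep p" "v \<in> contact_L \<Phi> Ep p"
  then obtain k e l f where u: "e \<in> i_eigen \<Phi> p" "u = cscale k (Ep p, 0) + e"
    and v: "f \<in> i_eigen \<Phi> p" "v = cscale l (Ep p, 0) + f"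
    unfolding mem_contact_L_iff by blast
  have "cpair (Ep p, 0) e = 0" "cpair (Ep p, 0) f = 0" "cpair (Ep p, 0) (Ep p, 0) = 0"
    using pairing_E_i_eigen[OF ac u(1)] pairing_E_i_eigen[OF ac v(1)] almost_contact_pairing[OF ac]
    by (simp_all add: cpair_def pairing_simps complex_eq_iff)
  moreover have "cpair e f = 0"
    using cpair_i_eigen[OF almost_contact_adjoint[OF ac] u(1) v(1)] .
  ultimately show "cpair u v = 0"
    by (simp add: u v cpair_add_left cpair_add_right cpair_cscale_left cpair_cscale_right
        cpair_commute[of e])
next
  fix w p v assume w: "csection_of M (contact_L \<Phi> Ep) w" "w p = 0"
  let ?a = "\<lambda>q. fst (w q)" and ?b = "\<lambda>q. snd (w q)"
  have sm: "smooth_section M ?a" "smooth_section M ?b"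
    and eq: "pairing (Ep q) (fst (w q)) = 0" "pairing (Ep q) (snd (w q)) = 0"
    "\<Phi> q (fst (w q)) = \<Phi> q (\<Phi> q (snd (w q)))" "\<Phi> q (snd (w q)) = - \<Phi> q (\<Phi> q (fst (w q)))" for q
    using w unfolding csection_of_def contact_L_iff by blast+
  note endo = almost_contact_endo[OF ac] and sE = almost_contact_section[OF ac]
  have sq: "jet M (\<lambda>q. \<Phi> q (\<Phi> q (s q))) p v = \<Phi> p (\<Phi> p (jet M s p v))"
    "smooth_section M (\<lambda>q. \<Phi> q (\<Phi> q (s q)))" if "smooth_section M s" "s p = 0" for s
  proof -
    show "jet M (\<lambda>q. \<Phi> q (\<Phi> q (s q))) p v = \<Phi> p (\<Phi> p (jet M s p v))"
      using jet_endo_zero[OF M bundle_endo_compose[OF M endo endo] that] .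
    show "smooth_section M (\<lambda>q. \<Phi> q (\<Phi> q (s q)))"
      using smooth_section_endo[OF M bundle_endo_compose[OF M endo endo] that(1)] .
  qed
  have "pairing (Ep p) (jet M ?a p v) = 0" "pairing (Ep p) (jet M ?b p v) = 0"
    using jet_pairing_const[OF M sE sm(1) eq(1), of p v]
      jet_pairing_const[OF M sE sm(2) eq(2), of p v] w(2)
    by (simp_all add: pairing_simps)
  moreover have "\<Phi> p (jet M ?a p v) = \<Phi> p (\<Phi> p (jet M ?b p v))"
    using jet_endo_zero[OF M endo sm(1), of p v] sq(1)[OF sm(2)] w(2) by (simp add: eq(3))
  moreover have "\<Phi> p (jet M ?b p v) = - \<Phi> p (\<Phi> p (jet M ?a p v))"
    using jet_endo_zero[OF M endo sm(2), of p v] sq[OF sm(1)] w(2) by (simp add: eq(4) jet_uminus[OF M])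
  ultimately show "cjet M w p v \<in> contact_L \<Phi> Ep p"
    by (simp add: contact_L_iff cjet_def)
qed (rule csubspace_contact_L)

lemma csmooth_minus_cext_square:
  assumes "csmooth M w"
  shows "csmooth M (\<lambda>q. - cext (\<Phi> q) (cext (\<Phi> q) (w q)))"
proof -
  have "csmooth M (\<lambda>q. cext (\<Phi> q) (cext (\<Phi> q) (w q)))"
    by (intro csmooth_cext[OF M almost_contact_endo[OF ac]] assms)
  then show ?thesis
    using csmooth_cscale[OF M, of _ "-1"] by (simp add: cscale_minus_one)
qed

context
  fixes H :: "'a \<Rightarrow> 'e \<Rightarrow> 'e \<Rightarrow> 'e \<Rightarrow> real"
  assumes H: "three_form M H"
begin

text \<open>After splitting both sections at one point, only \<open>[[E, E]] = 0\<close>, brackets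
  of \<open>E\<close> with eigensections, and brackets of eigensections remain.\<close>

lemma involutive_contact_L:
  assumes "involutive M H (i_eigen \<Phi>)"
    and "\<And>w p. csection_of M (i_eigen \<Phi>) w \<Longrightarrow> ccourant M H (\<lambda>q. (Ep q, 0)) w p \<in> i_eigen \<Phi> p"
  shows "involutive M H (contact_L \<Phi> Ep)"
  unfolding involutive_def
proof (intro allI impI)
  fix w z p assume w: "csection_of M (contact_L \<Phi> Ep) w" and z: "csection_of M (contact_L \<Phi> Ep) z"
  define E where "E = (\<lambda>q. (Ep q, 0 :: 'e gvec))"
  define P where "P = (\<lambda>w q. - cext (\<Phi> q) (cext (\<Phi> q) (w q)))"
  have sub: "csubspace (contact_L \<Phi> Ep p)"
    by (rule csubspace_contact_L)
  have sE: "csmooth M E"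
    using almost_contact_section[OF ac] csmooth_real[OF M] by (simp add: E_def)
  have P: "csection_of M (i_eigen \<Phi>) (P w)" if "csection_of M (contact_L \<Phi> Ep) w" for w
    using that csmooth_minus_cext_square[of w] contact_L_decompose
    unfolding csection_of_iff P_def by blast
  obtain k where k: "w p = cscale k (E p) + P w p"
    using contact_L_decompose[of "w p" p] w unfolding csection_of_iff E_def P_def by blast
  obtain l where l: "z p = cscale l (E p) + P z p"
    using contact_L_decompose[of "z p" p] z unfolding csection_of_iff E_def P_def by blast
  \<comment> \<open>The coefficient is frozen to a constant \<open>m\<close>. For
    \<open>m = k\<close> and \<open>m = l\<close> these sections agree with \<open>w\<close> and
    \<open>z\<close> at \<open>p\<close>, and no derivative of a coefficient enters their
    bracket.\<close>
  have sec: "csection_of M (contact_L \<Phi> Ep) (\<lambda>q. cscale m (E q) + P v q)"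
    if "csection_of M (contact_L \<Phi> Ep) v" for m v
  proof -
    have "csmooth M (P v)" "P v q \<in> i_eigen \<Phi> q" for q
      using P[OF that] by (auto simp: csection_of_iff)
    then show ?thesis
      using csmooth_add[OF M csmooth_cscale[OF M sE]]
      unfolding csection_of_iff mem_contact_L_iff E_def by blast
  qed
  have sP: "csmooth M (P w)" "csmooth M (P z)"
    using P w z by (auto simp: csection_of_iff)
  note c = csmooth_cscale[OF M] csmooth_add[OF M] sE sP
  have "ccourant M H E E p = 0"
    using ccourant_real_left[OF M H almost_contact_section[OF ac] sE, of p]
    by (simp add: E_def courant_self[OF M H almost_contact_section[OF ac]]
        courant_zero_right[OF M H almost_contact_section[OF ac]] cgvec_eq_iff)
  moreover have "ccourant M H E (P z) p \<in> contact_L \<Phi> Ep p" "ccourant M H E (P w) p \<in> contact_L \<Phi> Ep p"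
    using assms(2)[OF P[OF w]] assms(2)[OF P[OF z]] by (auto simp: E_def intro: i_eigen_contact_L)
  moreover have "ccourant M H (P w) (P z) p \<in> contact_L \<Phi> Ep p"
    using assms(1) P[OF w] P[OF z] by (auto simp: involutive_def intro: i_eigen_contact_L)
  ultimately have "ccourant M H (\<lambda>q. cscale k (E q) + P w q) (\<lambda>q. cscale l (E q) + P z q) p
      \<in> contact_L \<Phi> Ep p"
    using ccourant_antisym[OF M H sE sP(1), of p] csubspace_minus[OF sub] csubspace_zero[OF sub]
    by (simp add: c ccourant_add_left[OF M H] ccourant_add_right[OF M H]
        ccourant_cscale_left[OF M H] ccourant_cscale_right[OF M H]
        csubspace_add[OF sub] csubspace_cscale[OF sub])
  then show "ccourant M H w z p \<in> contact_L \<Phi> Ep p"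
    by (intro ccourant_cong_at[OF M H isotropic_bundle_contact_L w sec[OF w] k z sec[OF z] l])
qed

text \<open>Involutivity puts \<open>[[E+, e]]\<close> into the bundle spanned by \<open>E+\<close>
  and the eigenvectors. Its \<open>E+\<close> component is measured by \<open>E-\<close>, and
  invariance gives \<open><[[E+, e]], E-> = - <e, [[E+, E-]]> = 0\<close>.\<close>

lemma ccourant_E_i_eigen:
  assumes inv: "involutive M H (contact_L \<Phi> Ep)" and nrm: "\<And>p. courant M H Ep Em p = 0"
    and w: "csection_of M (i_eigen \<Phi>) w"
  shows "ccourant M H (\<lambda>q. (Ep q, 0)) w p \<in> i_eigen \<Phi> p"
proof (rule contact_L_Em_zero)
  note sp = almost_contact_section[OF ac] and sm = almost_contact_section[OF gen_almost_contact_swap[OF ac]]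
  have sw: "smooth_section M (\<lambda>q. fst (w q))" "smooth_section M (\<lambda>q. snd (w q))" "csmooth M w"
    and we: "w q \<in> i_eigen \<Phi> q" for q
    using w by (auto simp: csection_of_iff csmooth_def)
  have "csection_of M (contact_L \<Phi> Ep) (\<lambda>q. (Ep q, 0))" "csection_of M (contact_L \<Phi> Ep) w"
    using sw we csmooth_real[OF M sp] by (auto simp: csection_of_iff intro: E_contact_L i_eigen_contact_L)
  then show "ccourant M H (\<lambda>q. (Ep q, 0)) w p \<in> contact_L \<Phi> Ep p"
    using inv by (auto simp: involutive_def)
  have "pairing (courant M H Ep a p) (Em p) = 0"
    if "smooth_section M a" "\<And>q. pairing (Ep q) (a q) = 0" "\<And>q. pairing (Em q) (a q) = 0" for a
    \<comment> \<open>The constants are the remaining two pairings: \<open>a\<close> with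
      \<open>E-\<close> gives 0, and \<open>E+\<close> with \<open>E-\<close> gives
      \<open>1 / 2\<close>.\<close>
    using courant_invariant[OF M H sp that(1) sm that(2), of 0 "1 / 2" p] that(3)
    by (simp add: nrm pairing_simps almost_contact_pairing[OF ac] pairing_commute[of "a _"])
  moreover have "pairing (Em q) (fst (w q)) = 0" "pairing (Em q) (snd (w q)) = 0" for q
    using pairing_E_i_eigen[OF gen_almost_contact_swap[OF ac] we] by auto
  ultimately show "pairing (Em p) (fst (ccourant M H (\<lambda>q. (Ep q, 0)) w p)) = 0"
    "pairing (Em p) (snd (ccourant M H (\<lambda>q. (Ep q, 0)) w p)) = 0"
    using sw pairing_E_i_eigen[OF ac we]
    by (simp_all add: ccourant_real_left[OF M H sp] pairing_commute[of "Em p"])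
qed

end

end

end

text \<open>
  Strongness together with \<open>[[E\<^sub>+, E\<^sub>-]] = 0\<close>, in terms of the eigenbundle \<open>E\<^sup>(\<^sup>1\<^sup>,\<^sup>0\<^sup>)\<close> alone.
\<close>

definition contact_integrable ::
    "('a, 'e::euclidean_space) manifold \<Rightarrow> ('a \<Rightarrow> 'e \<Rightarrow> 'e \<Rightarrow> 'e \<Rightarrow> real)
      \<Rightarrow> ('a \<Rightarrow> 'e gvec \<Rightarrow> 'e gvec) \<Rightarrow> ('a \<Rightarrow> 'e gvec) \<Rightarrow> ('a \<Rightarrow> 'e gvec) \<Rightarrow> bool" where
  "contact_integrable M H \<Phi> Ep Em \<longleftrightarrow> involutive M H (i_eigen \<Phi>) \<and>
     (\<forall>w p. csection_of M (i_eigen \<Phi>) w \<longrightarrow>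
        ccourant M H (\<lambda>q. (Ep q, 0)) w p \<in> i_eigen \<Phi> p \<and>
        ccourant M H (\<lambda>q. (Em q, 0)) w p \<in> i_eigen \<Phi> p) \<and>
     (\<forall>p. courant M H Ep Em p = 0)"

text \<open>From left to right, the eigenbundle is the intersection of the two contact bundles,
  hence involutive. From right to left, each contact bundle is rebuilt from the eigenbundle and its
  own line.\<close>

lemma normal_gen_contact_iff:
  assumes M: "smooth_manifold M" and H: "three_form M H" and ac: "gen_almost_contact M \<Phi> Ep Em"
  shows "normal_gen_contact M H \<Phi> Ep Em \<longleftrightarrow> contact_integrable M H \<Phi> Ep Em"
proof
  note ac' = gen_almost_contact_swap[OF ac]
  note sp = almost_contact_section[OF ac] and sm = almost_contact_section[OF ac']
  assume "normal_gen_contact M H \<Phi> Ep Em"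
  then have p: "involutive M H (contact_L \<Phi> Ep)" and m: "involutive M H (contact_L \<Phi> Em)"
    and n: "courant M H Ep Em p = 0" "courant M H Em Ep p = 0" for p
    by (auto simp: normal_gen_contact_def strong_gen_contact_def courant_antisym[OF M H sp sm])
  have "involutive M H (i_eigen \<Phi>)"
    unfolding involutive_def
  proof (intro allI impI)
    fix w z q assume "csection_of M (i_eigen \<Phi>) w" "csection_of M (i_eigen \<Phi>) z"
    then have "ccourant M H w z q \<in> contact_L \<Phi> Ep q" "ccourant M H w z q \<in> contact_L \<Phi> Em q"
      using p m i_eigen_contact_L[OF ac] i_eigen_contact_L[OF ac']
      unfolding involutive_def csection_of_def by metis+
    \<comment> \<open>Membership in the bundle of \<open>E-\<close> includes orthogonality to
      \<open>E-\<close>, which removes the \<open>E+\<close> component.\<close>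
    then show "ccourant M H w z q \<in> i_eigen \<Phi> q"
      using contact_L_Em_zero[OF ac] contact_L_iff[OF ac'] by blast
  qed
  then show "contact_integrable M H \<Phi> Ep Em"
    using ccourant_E_i_eigen[OF ac M H p n(1)] ccourant_E_i_eigen[OF ac' M H m n(2)] n
    by (auto simp: contact_integrable_def)
next
  assume "contact_integrable M H \<Phi> Ep Em"
  then show "normal_gen_contact M H \<Phi> Ep Em"
    using involutive_contact_L[OF ac M H] involutive_contact_L[OF gen_almost_contact_swap[OF ac] M H] ac
    by (auto simp: contact_integrable_def normal_gen_contact_def strong_gen_contact_def)
qed

section \<open>Lifting sections to the product\<close>

definition lift1 :: "('a \<Rightarrow> 'e::euclidean_space gvec) \<Rightarrow> 'a \<times> 'b \<Rightarrow> ('e \<times> 'f::euclidean_space) gvec" where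
  "lift1 s z = gjoin (s (fst z)) 0"

definition lift2 :: "('b \<Rightarrow> 'f::euclidean_space gvec) \<Rightarrow> 'a \<times> 'b \<Rightarrow> ('e::euclidean_space \<times> 'f) gvec" where
  "lift2 s z = gjoin 0 (s (snd z))"

lemma gvec_prod_cases:
  obtains u v where "w = gjoin u v"
  by (metis gjoin_gfst_gsnd)

context
  fixes M :: "('a::{second_countable_topology, t2_space}, 'e::euclidean_space) manifold"
    and N :: "('b::{second_countable_topology, t2_space}, 'f::euclidean_space) manifold"
  assumes M: "smooth_manifold M" and N: "smooth_manifold N"
begin

lemma local_rep_lift:
  assumes "c \<in> atlas M" "d \<in> atlas N" "z \<in> (cmap c ` cdom c) \<times> (cmap d ` cdom d)"
  shows "local_rep (manifold_prod M N) (chart_prod c d) (lift1 s) z = gjoin (local_rep M c s (fst z)) 0"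
    and "local_rep (manifold_prod M N) (chart_prod c d) (lift2 t) z = gjoin 0 (local_rep N d t (snd z))"
  using assms local_rep_prod[OF M N assms(1,2), of "fst z" "snd z"]
  by (auto simp: lift1_def lift2_def local_rep_zero)

lemma smooth_section_lift1:
  assumes "smooth_section M s"
  shows "smooth_section (manifold_prod M N) (lift1 s)"
  unfolding smooth_section_def
proof
  fix k assume "k \<in> atlas (manifold_prod M N)"
  then obtain c d where k: "k = chart_prod c d" "c \<in> atlas M" "d \<in> atlas N"
    by (auto simp: atlas_prod)
  note op = open_image[OF M k(2)] open_image[OF N k(3)]
  have "smooth_map_on ((cmap c ` cdom c) \<times> (cmap d ` cdom d)) (\<lambda>z. gjoin (local_rep M c s (fst z)) 0)"
    by (rule smooth_map_on_bounded_linear[OF open_Times[OF op] bounded_linear_gjoin_left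
          smooth_map_on_fst[OF op smooth_section_rep[OF assms k(2)]]])
  then have "smooth_map_on ((cmap c ` cdom c) \<times> (cmap d ` cdom d)) (local_rep (manifold_prod M N) k (lift1 s))"
    by (rule smooth_map_on_cong[OF open_Times[OF op]]) (simp add: local_rep_lift k)
  then show "smooth_map_on (cmap k ` cdom k) (local_rep (manifold_prod M N) k (lift1 s))"
    by (simp add: k map_prod_image)
qed

lemma smooth_section_lift2:
  assumes "smooth_section N s"
  shows "smooth_section (manifold_prod M N) (lift2 s)"
  unfolding smooth_section_def
proof
  fix k assume "k \<in> atlas (manifold_prod M N)"
  then obtain c d where k: "k = chart_prod c d" "c \<in> atlas M" "d \<in> atlas N"
    by (auto simp: atlas_prod)
  note op = open_image[OF M k(2)] open_image[OF N k(3)]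
  have "smooth_map_on ((cmap c ` cdom c) \<times> (cmap d ` cdom d)) (\<lambda>z. gjoin 0 (local_rep N d s (snd z)))"
    by (rule smooth_map_on_bounded_linear[OF open_Times[OF op] bounded_linear_gjoin_right
          smooth_map_on_snd[OF op smooth_section_rep[OF assms k(3)]]])
  then have "smooth_map_on ((cmap c ` cdom c) \<times> (cmap d ` cdom d)) (local_rep (manifold_prod M N) k (lift2 s))"
    by (rule smooth_map_on_cong[OF open_Times[OF op]]) (simp add: local_rep_lift k)
  then show "smooth_map_on (cmap k ` cdom k) (local_rep (manifold_prod M N) k (lift2 s))"
    by (simp add: k map_prod_image)
qed

lemma jet_lift1:
  assumes "smooth_section M s"
  shows "jet (manifold_prod M N) (lift1 s) z = (\<lambda>v. gjoin (jet M s (fst z) (fst v)) 0)"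
proof (rule jet_eqI)
  let ?c = "chart_at M (fst z)" and ?d = "chart_at N (snd z)"
  note cd = chart_at_atlas[OF M, of "fst z"] chart_at_atlas[OF N, of "snd z"]
  have k: "chart_at (manifold_prod M N) z = chart_prod ?c ?d"
    by (cases z) simp
  have "(local_rep M ?c s has_derivative jet M s (fst z)) (at (fst (map_prod (cmap ?c) (cmap ?d) z)))"
    using jet_has_derivative[OF M assms, of "fst z"] by (cases z) simp
  then have "((\<lambda>x. gjoin (local_rep M ?c s (fst x)) 0) has_derivative (\<lambda>v. gjoin (jet M s (fst z) (fst v)) 0))
      (at (map_prod (cmap ?c) (cmap ?d) z))"
    by (rule bounded_linear.has_derivative[OF bounded_linear_gjoin_left
          has_derivative_compose[OF has_derivative_fst[OF has_derivative_ident]]])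
  then show "(local_rep (manifold_prod M N) (chart_at (manifold_prod M N) z) (lift1 s) has_derivative
      (\<lambda>v. gjoin (jet M s (fst z) (fst v)) 0)) (at (cmap (chart_at (manifold_prod M N) z) z))"
    unfolding k cmap_chart_prod
    by (rule has_derivative_transform_within_open[OF _ open_Times[OF open_image[OF M cd(1)]
            open_image[OF N cd(2)]]])
      (use cd in \<open>cases z, auto simp: local_rep_lift chart_at_dom[OF M] chart_at_dom[OF N]\<close>)
qed

lemma jet_lift2:
  assumes "smooth_section N s"
  shows "jet (manifold_prod M N) (lift2 s) z = (\<lambda>v. gjoin 0 (jet N s (snd z) (snd v)))"
proof (rule jet_eqI)
  let ?c = "chart_at M (fst z)" and ?d = "chart_at N (snd z)"
  note cd = chart_at_atlas[OF M, of "fst z"] chart_at_atlas[OF N, of "snd z"]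
  have k: "chart_at (manifold_prod M N) z = chart_prod ?c ?d"
    by (cases z) simp
  have "(local_rep N ?d s has_derivative jet N s (snd z)) (at (snd (map_prod (cmap ?c) (cmap ?d) z)))"
    using jet_has_derivative[OF N assms, of "snd z"] by (cases z) simp
  then have "((\<lambda>x. gjoin 0 (local_rep N ?d s (snd x))) has_derivative (\<lambda>v. gjoin 0 (jet N s (snd z) (snd v))))
      (at (map_prod (cmap ?c) (cmap ?d) z))"
    by (rule bounded_linear.has_derivative[OF bounded_linear_gjoin_right
          has_derivative_compose[OF has_derivative_snd[OF has_derivative_ident]]])
  then show "(local_rep (manifold_prod M N) (chart_at (manifold_prod M N) z) (lift2 s) has_derivative
      (\<lambda>v. gjoin 0 (jet N s (snd z) (snd v)))) (at (cmap (chart_at (manifold_prod M N) z) z))"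
    unfolding k cmap_chart_prod
    by (rule has_derivative_transform_within_open[OF _ open_Times[OF open_image[OF M cd(1)]
            open_image[OF N cd(2)]]])
      (use cd in \<open>cases z, auto simp: local_rep_lift chart_at_dom[OF M] chart_at_dom[OF N]\<close>)
qed

section \<open>Product endomorphisms, sums of three-forms, and brackets of lifts\<close>

lemma bundle_endo_prod:
  assumes "bundle_endo M A" "bundle_endo N B"
  shows "bundle_endo (manifold_prod M N) (endo_prod A B)"
  unfolding bundle_endo_iff
proof (intro conjI allI ballI)
  have lin: "linear (A p)" "linear (B q)" for p q
    using assms by (auto simp: bundle_endo_iff)
  show "linear (endo_prod A B z)" for z
    by (cases z, rule linearI) (simp_all add: endo_prod_def gjoin_add gjoin_scaleR
        linear_add[OF linear_gfst] linear_add[OF linear_gsnd] linear_scale[OF linear_gfst]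
        linear_scale[OF linear_gsnd] linear_add[OF lin(1)] linear_add[OF lin(2)]
        linear_scale[OF lin(1)] linear_scale[OF lin(2)])
  fix k v assume "k \<in> atlas (manifold_prod M N)"
  then obtain c d where k: "k = chart_prod c d" "c \<in> atlas M" "d \<in> atlas N"
    by (auto simp: atlas_prod)
  note op = open_image[OF M k(2)] open_image[OF N k(3)]
  have "smooth_map_on ((cmap c ` cdom c) \<times> (cmap d ` cdom d))
      (\<lambda>z. gjoin (endo_rep M c A (fst z) (gfst v)) 0 + gjoin 0 (endo_rep N d B (snd z) (gsnd v)))"
    using k assms
    by (intro smooth_map_on_add open_Times op
        smooth_map_on_bounded_linear[OF open_Times[OF op] bounded_linear_gjoin_left smooth_map_on_fst[OF op]]
        smooth_map_on_bounded_linear[OF open_Times[OF op] bounded_linear_gjoin_right smooth_map_on_snd[OF op]]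
        smooth_endo_rep)
  then have "smooth_map_on ((cmap c ` cdom c) \<times> (cmap d ` cdom d))
      (\<lambda>z. endo_rep (manifold_prod M N) k (endo_prod A B) z v)"
  proof (rule smooth_map_on_cong[OF open_Times[OF op]])
    fix z assume z: "z \<in> (cmap c ` cdom c) \<times> (cmap d ` cdom d)"
    obtain x y v1 v2 where xy: "z = (x, y)" and v: "v = gjoin v1 v2"
      by (cases z, rule gvec_prod_cases[of v]) blast
    let ?p = "cinv c x" and ?q = "cinv d y"
    have "?p \<in> cdom c" "?q \<in> cdom d"
      using z k cinv_in_cdom[OF M] cinv_in_cdom[OF N] by (auto simp: xy)
    then show "gjoin (endo_rep M c A (fst z) (gfst v)) 0 + gjoin 0 (endo_rep N d B (snd z) (gsnd v))
        = endo_rep (manifold_prod M N) k (endo_prod A B) z v"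
      using z k
      by (simp add: xy v endo_rep_def endo_prod_def gjoin_add cinv_chart_prod[OF M N] Let_def
          gchange_prod[OF M N] chart_at_atlas[OF M] chart_at_atlas[OF N] chart_at_dom[OF M]
          chart_at_dom[OF N])
  qed
  then show "smooth_map_on (cmap k ` cdom k) (\<lambda>z. endo_rep (manifold_prod M N) k (endo_prod A B) z v)"
    by (simp add: k map_prod_image)
qed

context
  fixes H :: "'a \<Rightarrow> 'e \<Rightarrow> 'e \<Rightarrow> 'e \<Rightarrow> real" and K :: "'b \<Rightarrow> 'f \<Rightarrow> 'f \<Rightarrow> 'f \<Rightarrow> real"
  assumes H: "three_form M H" and K: "three_form N K"
begin

lemma three_form_sum: "three_form (manifold_prod M N) (form_sum H K)"
  unfolding three_form_def
proof (intro conjI allI ballI)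
  note h = three_form_linear(1-3)[OF M H] and k = three_form_linear(1-3)[OF N K]
  show "linear (\<lambda>z. form_sum H K p z u v)" for p u v
    by (cases p, rule linearI) (simp_all add: form_sum_def linear_add[OF h(1)] linear_add[OF k(1)]
        linear_scale[OF h(1)] linear_scale[OF k(1)] algebra_simps)
  show "linear (\<lambda>z. form_sum H K p u z v)" for p u v
    by (cases p, rule linearI) (simp_all add: form_sum_def linear_add[OF h(2)] linear_add[OF k(2)]
        linear_scale[OF h(2)] linear_scale[OF k(2)] algebra_simps)
  show "linear (\<lambda>z. form_sum H K p u v z)" for p u v
    by (cases p, rule linearI) (simp_all add: form_sum_def linear_add[OF h(3)] linear_add[OF k(3)]
        linear_scale[OF h(3)] linear_scale[OF k(3)] algebra_simps)
  show "form_sum H K p u u v = 0" "form_sum H K p u v v = 0" for p u v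
    using H K by (cases p; simp add: form_sum_def three_form_def)+
  fix k u v w assume "k \<in> atlas (manifold_prod M N)"
  then obtain c d where k: "k = chart_prod c d" "c \<in> atlas M" "d \<in> atlas N"
    by (auto simp: atlas_prod)
  note op = open_image[OF M k(2)] open_image[OF N k(3)]
  have "smooth_map_on (cmap c ` cdom c) (form_rep M c H (fst u) (fst v) (fst w))"
    "smooth_map_on (cmap d ` cdom d) (form_rep N d K (snd u) (snd v) (snd w))"
    using H K k unfolding three_form_def by blast+
  then have "smooth_map_on ((cmap c ` cdom c) \<times> (cmap d ` cdom d))
      (\<lambda>z. form_rep M c H (fst u) (fst v) (fst w) (fst z) + form_rep N d K (snd u) (snd v) (snd w) (snd z))"
    by (intro smooth_map_on_add open_Times op smooth_map_on_fst[OF op] smooth_map_on_snd[OF op])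
  then have "smooth_map_on ((cmap c ` cdom c) \<times> (cmap d ` cdom d))
      (form_rep (manifold_prod M N) k (form_sum H K) u v w)"
  proof (rule smooth_map_on_cong[OF open_Times[OF op]])
    fix z assume z: "z \<in> (cmap c ` cdom c) \<times> (cmap d ` cdom d)"
    obtain x y where xy: "z = (x, y)" by (cases z)
    let ?p = "cinv c x" and ?q = "cinv d y"
    have "?p \<in> cdom c" "?q \<in> cdom d"
      using z k cinv_in_cdom[OF M] cinv_in_cdom[OF N] by (auto simp: xy)
    then show "form_rep M c H (fst u) (fst v) (fst w) (fst z)
        + form_rep N d K (snd u) (snd v) (snd w) (snd z)
        = form_rep (manifold_prod M N) k (form_sum H K) u v w z"
      using z k
      by (simp add: xy form_rep_def form_sum_def cinv_chart_prod[OF M N] Let_def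
          tchange_prod[OF M N] chart_at_atlas[OF M] chart_at_atlas[OF N] chart_at_dom[OF M]
          chart_at_dom[OF N])
  qed
  then show "smooth_map_on (cmap k ` cdom k) (form_rep (manifold_prod M N) k (form_sum H K) u v w)"
    by (simp add: k map_prod_image)
qed

lemma form_sum_zero:
  "form_sum H K z (u, 0) (v, 0) w = H (fst z) u v (fst w)"
  "form_sum H K z (0, u') (0, v') w = K (snd z) u' v' (snd w)"
  "form_sum H K z (u, 0) (0, v') w = 0"
  using linear_0[OF three_form_linear(1)[OF M H]] linear_0[OF three_form_linear(2)[OF M H]]
    linear_0[OF three_form_linear(1)[OF N K]] linear_0[OF three_form_linear(2)[OF N K]]
  by (auto simp: form_sum_def split: prod.split)

lemma courant_lift1:
  assumes "smooth_section M a" "smooth_section M b"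
  shows "courant (manifold_prod M N) (form_sum H K) (lift1 a) (lift1 b) z
    = gjoin (courant M H a b (fst z)) 0"
proof (rule pairing_eqI)
  fix c :: "('e \<times> 'f) gvec"
  obtain c1 c2 where c: "c = gjoin c1 c2" by (rule gvec_prod_cases)
  show "pairing (courant (manifold_prod M N) (form_sum H K) (lift1 a) (lift1 b) z) c
      = pairing (gjoin (courant M H a b (fst z)) 0) c"
    unfolding c pairing_courant_form[OF smooth_manifold_prod[OF M N] three_form_sum smooth_section_lift1[OF assms(1)]
        smooth_section_lift1[OF assms(2)]] jet_lift1[OF assms(1)] jet_lift1[OF assms(2)] pairing_gjoin
        pairing_courant_form[OF M H assms]
    by (simp add: lift1_def pairing_gjoin gjoin_diff form_sum_zero pairing_simps)
qed

lemma courant_lift2: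
  assumes "smooth_section N a" "smooth_section N b"
  shows "courant (manifold_prod M N) (form_sum H K) (lift2 a) (lift2 b) z
    = gjoin 0 (courant N K a b (snd z))"
proof (rule pairing_eqI)
  fix c :: "('e \<times> 'f) gvec"
  obtain c1 c2 where c: "c = gjoin c1 c2" by (rule gvec_prod_cases)
  show "pairing (courant (manifold_prod M N) (form_sum H K) (lift2 a) (lift2 b) z) c
      = pairing (gjoin 0 (courant N K a b (snd z))) c"
    unfolding c pairing_courant_form[OF smooth_manifold_prod[OF M N] three_form_sum smooth_section_lift2[OF assms(1)]
        smooth_section_lift2[OF assms(2)]] jet_lift2[OF assms(1)] jet_lift2[OF assms(2)] pairing_gjoin
        pairing_courant_form[OF N K assms]
    by (simp add: lift2_def pairing_gjoin gjoin_diff form_sum_zero pairing_simps)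
qed

text \<open>A lift is constant along the other factor, so its derivative in the direction of the
  other section vanishes. The remaining jet terms pair vectors of different factors, and each
  three-form receives an argument 0.\<close>

lemma courant_lift12:
  assumes "smooth_section M a" "smooth_section N b"
  shows "courant (manifold_prod M N) (form_sum H K) (lift1 a) (lift2 b) z = 0"
proof (rule pairing_eqI)
  fix c :: "('e \<times> 'f) gvec"
  obtain c1 c2 where c: "c = gjoin c1 c2" by (rule gvec_prod_cases)
  show "pairing (courant (manifold_prod M N) (form_sum H K) (lift1 a) (lift2 b) z) c = pairing 0 c"
    unfolding c pairing_courant_form[OF smooth_manifold_prod[OF M N] three_form_sum smooth_section_lift1[OF assms(1)]
        smooth_section_lift2[OF assms(2)]] jet_lift1[OF assms(1)] jet_lift2[OF assms(2)]
    by (simp add: lift1_def lift2_def pairing_gjoin gjoin_diff form_sum_zero pairing_simps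
        linear_0[OF linear_jet[OF M assms(1)]] linear_0[OF linear_jet[OF N assms(2)]])
qed

end

end

definition clift1 :: "('a \<Rightarrow> 'e::euclidean_space cgvec) \<Rightarrow> 'a \<times> 'b \<Rightarrow> ('e \<times> 'f::euclidean_space) cgvec" where
  "clift1 w z = (lift1 (\<lambda>p. fst (w p)) z, lift1 (\<lambda>p. snd (w p)) z)"

definition clift2 :: "('b \<Rightarrow> 'f::euclidean_space cgvec) \<Rightarrow> 'a \<times> 'b \<Rightarrow> ('e::euclidean_space \<times> 'f) cgvec" where
  "clift2 w z = (lift2 (\<lambda>p. fst (w p)) z, lift2 (\<lambda>p. snd (w p)) z)"

definition cjoin :: "'e::euclidean_space cgvec \<Rightarrow> 'f::euclidean_space cgvec \<Rightarrow> ('e \<times> 'f) cgvec" where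
  "cjoin u v = (gjoin (fst u) (fst v), gjoin (snd u) (snd v))"

lemma clift_eq: "clift1 w z = cjoin (w (fst z)) 0" "clift2 v z = cjoin 0 (v (snd z))"
  by (simp_all add: clift1_def clift2_def cjoin_def lift1_def lift2_def)

lemma cjoin_zero [simp]: "cjoin 0 0 = 0"
  by (simp add: cjoin_def cgvec_eq_iff)

lemma cjoin_add: "cjoin u v + cjoin u' v' = cjoin (u + u') (v + v')"
  by (simp add: cjoin_def gjoin_add)

lemma cjoin_cscale: "cscale k (cjoin u v) = cjoin (cscale k u) (cscale k v)"
  by (simp add: cjoin_def cscale_def gjoin_add gjoin_diff gjoin_scaleR)

context
  fixes M :: "('a::{second_countable_topology, t2_space}, 'e::euclidean_space) manifold"
    and N :: "('b::{second_countable_topology, t2_space}, 'f::euclidean_space) manifold"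
    and H :: "'a \<Rightarrow> 'e \<Rightarrow> 'e \<Rightarrow> 'e \<Rightarrow> real" and K :: "'b \<Rightarrow> 'f \<Rightarrow> 'f \<Rightarrow> 'f \<Rightarrow> real"
  assumes M: "smooth_manifold M" and N: "smooth_manifold N"
    and H: "three_form M H" and K: "three_form N K"
begin

lemma csmooth_clift:
  "csmooth M w \<Longrightarrow> csmooth (manifold_prod M N) (clift1 w)"
  "csmooth N z \<Longrightarrow> csmooth (manifold_prod M N) (clift2 z)"
  by (simp_all add: csmooth_def clift1_def clift2_def smooth_section_lift1[OF M N]
      smooth_section_lift2[OF M N])

lemma ccourant_clift1:
  assumes "csmooth M w" "csmooth M z"
  shows "ccourant (manifold_prod M N) (form_sum H K) (clift1 w) (clift1 z) y
    = cjoin (ccourant M H w z (fst y)) 0"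
  using assms
  by (simp add: ccourant_def clift1_def csmooth_def Let_def courant_lift1[OF M N H K] cjoin_def
      gjoin_add gjoin_diff)

lemma ccourant_clift2:
  assumes "csmooth N w" "csmooth N z"
  shows "ccourant (manifold_prod M N) (form_sum H K) (clift2 w) (clift2 z) y
    = cjoin 0 (ccourant N K w z (snd y))"
  using assms
  by (simp add: ccourant_def clift2_def csmooth_def Let_def courant_lift2[OF M N H K] cjoin_def
      gjoin_add gjoin_diff)

lemma ccourant_clift12:
  assumes "csmooth M w" "csmooth N z"
  shows "ccourant (manifold_prod M N) (form_sum H K) (clift1 w) (clift2 z) y = 0"
    "ccourant (manifold_prod M N) (form_sum H K) (clift2 z) (clift1 w) y = 0"
proof -
  show *: "ccourant (manifold_prod M N) (form_sum H K) (clift1 w) (clift2 z) y = 0"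
    using assms
    by (simp add: ccourant_def clift1_def clift2_def csmooth_def Let_def courant_lift12[OF M N H K]
        cgvec_eq_iff)
  show "ccourant (manifold_prod M N) (form_sum H K) (clift2 z) (clift1 w) y = 0"
    using ccourant_antisym[OF smooth_manifold_prod[OF M N] three_form_sum[OF M N H K]
        csmooth_clift(1)[OF assms(1)] csmooth_clift(2)[OF assms(2)], of y] * by simp
qed

end

section \<open>The generalized almost complex structure of a product\<close>

lemma product_J_gjoin:
  "product_J \<Phi>1 Ep1 Em1 \<Phi>2 Ep2 Em2 z (gjoin u v) = gjoin
     (\<Phi>1 (fst z) u - (2 * pairing (Ep2 (snd z)) v) *\<^sub>R Ep1 (fst z)
        - (2 * pairing (Em2 (snd z)) v) *\<^sub>R Em1 (fst z))
     (\<Phi>2 (snd z) v + (2 * pairing (Ep1 (fst z)) u) *\<^sub>R Ep2 (snd z)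
        + (2 * pairing (Em1 (fst z)) u) *\<^sub>R Em2 (snd z))"
  by (simp add: product_J_def split: prod.split)

lemma endo_prod_gjoin: "endo_prod A B z (gjoin u v) = gjoin (A (fst z) u) (B (snd z) v)"
  by (simp add: endo_prod_def split: prod.split)

text \<open>Exhibits the mixing part as tensors of lifted sections, so that smoothness follows from
  the algebra of bundle endomorphisms.\<close>

lemma product_J_eq_tens:
  fixes \<Phi>1 :: "'a \<Rightarrow> 'e::euclidean_space gvec \<Rightarrow> 'e gvec"
    and \<Phi>2 :: "'b \<Rightarrow> 'f::euclidean_space gvec \<Rightarrow> 'f gvec"
  shows "product_J \<Phi>1 Ep1 Em1 \<Phi>2 Ep2 Em2 = (\<lambda>z v. endo_prod \<Phi>1 \<Phi>2 z v
     - tens (lift1 Ep1 z) (lift2 Ep2 z) v - tens (lift1 Em1 z) (lift2 Em2 z) v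
     + tens (lift2 Ep2 z) (lift1 Ep1 z) v + tens (lift2 Em2 z) (lift1 Em1 z) v)"
proof (intro ext)
  fix z and v :: "('e \<times> 'f) gvec"
  obtain v1 v2 where v: "v = gjoin v1 v2" by (rule gvec_prod_cases)
  show "product_J \<Phi>1 Ep1 Em1 \<Phi>2 Ep2 Em2 z v = endo_prod \<Phi>1 \<Phi>2 z v
     - tens (lift1 Ep1 z) (lift2 Ep2 z) v - tens (lift1 Em1 z) (lift2 Em2 z) v
     + tens (lift2 Ep2 z) (lift1 Ep1 z) v + tens (lift2 Em2 z) (lift1 Em1 z) v"
    by (simp add: v product_J_gjoin endo_prod_gjoin tens_def lift1_def lift2_def pairing_gjoin
        pairing_simps gjoin_scaleR gjoin_add gjoin_diff)
qed

context
  fixes M :: "('a::{second_countable_topology, t2_space}, 'e::euclidean_space) manifold"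
    and N :: "('b::{second_countable_topology, t2_space}, 'f::euclidean_space) manifold"
    and H :: "'a \<Rightarrow> 'e \<Rightarrow> 'e \<Rightarrow> 'e \<Rightarrow> real" and K :: "'b \<Rightarrow> 'f \<Rightarrow> 'f \<Rightarrow> 'f \<Rightarrow> real"
    and \<Phi>1 Ep1 Em1 \<Phi>2 Ep2 Em2
  assumes M: "smooth_manifold M" and N: "smooth_manifold N"
    and H: "three_form M H" and K: "three_form N K"
    and ac1: "gen_almost_contact M \<Phi>1 Ep1 Em1" and ac2: "gen_almost_contact N \<Phi>2 Ep2 Em2"
begin

private abbreviation (input) "J \<equiv> product_J \<Phi>1 Ep1 Em1 \<Phi>2 Ep2 Em2"
private abbreviation (input) "P \<equiv> manifold_prod M N"
private abbreviation (input) "HK \<equiv> form_sum H K"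

private lemmas sections = almost_contact_section[OF ac1]
  almost_contact_section[OF gen_almost_contact_swap[OF ac1]]
  almost_contact_section[OF ac2] almost_contact_section[OF gen_almost_contact_swap[OF ac2]]

private lemmas kernels = almost_contact_kernel[OF ac1]
  almost_contact_kernel[OF gen_almost_contact_swap[OF ac1]]
  almost_contact_kernel[OF ac2] almost_contact_kernel[OF gen_almost_contact_swap[OF ac2]]

private lemmas pairings = almost_contact_pairing[OF ac1]
  almost_contact_pairing[OF gen_almost_contact_swap[OF ac1]]
  almost_contact_pairing[OF ac2] almost_contact_pairing[OF gen_almost_contact_swap[OF ac2]]

private lemmas lin1 = almost_contact_linear[OF ac1]
private lemmas lin2 = almost_contact_linear[OF ac2]
private lemmas lins = linear_add[OF lin1] linear_diff[OF lin1] linear_scale[OF lin1] linear_neg[OF lin1]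
  linear_add[OF lin2] linear_diff[OF lin2] linear_scale[OF lin2] linear_neg[OF lin2]

private lemmas prod_mfd = smooth_manifold_prod[OF M N]
private lemmas prod_form = three_form_sum[OF M N H K]

lemma gen_almost_complex_product_J: "gen_almost_complex P J"
  unfolding gen_almost_complex_def
proof (intro conjI allI)
  show "bundle_endo P J"
    unfolding product_J_eq_tens
    by (intro bundle_endo_add[OF prod_mfd] bundle_endo_diff[OF prod_mfd]
        bundle_endo_tens[OF prod_mfd] bundle_endo_prod[OF M N] smooth_section_lift1[OF M N]
        smooth_section_lift2[OF M N] sections almost_contact_endo[OF ac1] almost_contact_endo[OF ac2])
  show "is_adjoint (J z) (\<lambda>v. - J z v)" for z
    unfolding is_adjoint_def
  proof (intro allI)
    fix u v :: "('e \<times> 'f) gvec"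
    obtain u1 u2 v1 v2 where u: "u = gjoin u1 u2" and v: "v = gjoin v1 v2"
      by (metis gvec_prod_cases)
    show "pairing (J z u) v = pairing u (- J z v)"
      by (simp add: u v product_J_gjoin pairing_gjoin pairing_simps gjoin_uminus
          almost_contact_skew[OF ac1] almost_contact_skew[OF ac2] pairing_commute[of u1 "Ep1 _"]
          pairing_commute[of u1 "Em1 _"] pairing_commute[of u2 "Ep2 _"] pairing_commute[of u2 "Em2 _"])
  qed
  \<comment> \<open>The mixing part carries the span of \<open>E+\<close> and \<open>E-\<close> of
    one factor to that of the other. Its square cancels the two tensor terms in the squares of
    \<open>\<Phi>1\<close> and \<open>\<Phi>2\<close>.\<close>
  show "J z (J z v) = - v" for z and v :: "('e \<times> 'f) gvec"
  proof -
    obtain v1 v2 where v: "v = gjoin v1 v2" by (rule gvec_prod_cases)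
    show ?thesis
      by (simp add: v product_J_gjoin lins kernels pairings pairing_simps gjoin_uminus
          almost_contact_square[OF ac1] almost_contact_square[OF ac2])
  qed
qed

lemma isotropic_bundle_product_J: "isotropic_bundle P (i_eigen J)"
  using gen_almost_complex_product_J unfolding gen_almost_complex_def
  by (intro isotropic_bundle_i_eigen[OF prod_mfd]) auto

lemma csubspace_product_J: "csubspace (i_eigen J z)"
  using isotropic_bundle_product_J unfolding isotropic_bundle_def by blast

text \<open>Eigenvectors of \<open>\<Phi>1\<close> and \<open>\<Phi>2\<close> are orthogonal to
  \<open>E+\<close> and \<open>E-\<close>, so the mixing terms of \<open>J\<close> vanish on them.
  The converse is the eigenvalue equation in one component.\<close>

lemma cjoin_mem_product_J:
  "cjoin u 0 \<in> i_eigen J z \<longleftrightarrow> u \<in> i_eigen \<Phi>1 (fst z)"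
  "cjoin 0 v \<in> i_eigen J z \<longleftrightarrow> v \<in> i_eigen \<Phi>2 (snd z)"
proof -
  show "cjoin u 0 \<in> i_eigen J z \<longleftrightarrow> u \<in> i_eigen \<Phi>1 (fst z)"
    using pairing_E_i_eigen[OF ac1, of u "fst z"]
      pairing_E_i_eigen[OF gen_almost_contact_swap[OF ac1], of u "fst z"]
    by (auto simp: mem_i_eigen_iff cjoin_def product_J_gjoin gjoin_uminus pairing_simps
        linear_0[OF lin2])
  show "cjoin 0 v \<in> i_eigen J z \<longleftrightarrow> v \<in> i_eigen \<Phi>2 (snd z)"
    using pairing_E_i_eigen[OF ac2, of v "snd z"]
      pairing_E_i_eigen[OF gen_almost_contact_swap[OF ac2], of v "snd z"]
    by (auto simp: mem_i_eigen_iff cjoin_def product_J_gjoin gjoin_uminus pairing_simps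
        linear_0[OF lin1])
qed

text \<open>The two sections of the eigenbundle that mix the factors: \<open>J E\<^sub>+\<^sub>,\<^sub>1 = E\<^sub>-\<^sub>,\<^sub>2\<close> and \<open>J E\<^sub>-\<^sub>,\<^sub>1 = E\<^sub>+\<^sub>,\<^sub>2\<close>.\<close>

private definition "F1 z = clift1 (\<lambda>p. (Ep1 p, 0)) z + cscale (- \<i>) (clift2 (\<lambda>q. (Em2 q, 0)) z)"
private definition "F2 z = clift1 (\<lambda>p. (Em1 p, 0)) z + cscale (- \<i>) (clift2 (\<lambda>q. (Ep2 q, 0)) z)"

lemma F_cjoin:
  "F1 z = cjoin (Ep1 (fst z), 0) (0, - Em2 (snd z))" "F2 z = cjoin (Em1 (fst z), 0) (0, - Ep2 (snd z))"
  by (simp_all add: F1_def F2_def clift_eq cjoin_cscale cjoin_add) (simp_all add: cscale_def)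

lemma F_mem: "F1 z \<in> i_eigen J z" "F2 z \<in> i_eigen J z"
  by (simp_all add: F_cjoin mem_i_eigen_iff cjoin_def product_J_gjoin kernels pairings pairing_simps
      linear_0[OF lin1] linear_0[OF lin2] lins gjoin_uminus)

private lemmas creal = csmooth_real[OF M sections(1)] csmooth_real[OF M sections(2)]
  csmooth_real[OF N sections(3)] csmooth_real[OF N sections(4)]

private lemmas clifts = csmooth_clift(1)[OF M N H K] csmooth_clift(2)[OF M N H K]

lemma F_csmooth: "csmooth P F1" "csmooth P F2"
  unfolding F1_def F2_def
  by (intro csmooth_add[OF prod_mfd] csmooth_cscale[OF prod_mfd] clifts creal)+

lemma ccourant_F1:
  "csmooth M w \<Longrightarrow> ccourant P HK F1 (clift1 w) z = cjoin (ccourant M H (\<lambda>p. (Ep1 p, 0)) w (fst z)) 0"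
  "csmooth N v \<Longrightarrow> ccourant P HK F1 (clift2 v) z
     = cscale (- \<i>) (cjoin 0 (ccourant N K (\<lambda>p. (Em2 p, 0)) v (snd z)))"
  unfolding F1_def
  by (simp_all add: ccourant_add_left[OF prod_mfd prod_form] ccourant_cscale_left[OF prod_mfd prod_form]
      csmooth_cscale[OF prod_mfd] clifts creal ccourant_clift1[OF M N H K] ccourant_clift2[OF M N H K]
      ccourant_clift12[OF M N H K])

lemma ccourant_F2:
  "csmooth M w \<Longrightarrow> ccourant P HK F2 (clift1 w) z = cjoin (ccourant M H (\<lambda>p. (Em1 p, 0)) w (fst z)) 0"
  "csmooth N v \<Longrightarrow> ccourant P HK F2 (clift2 v) z
     = cscale (- \<i>) (cjoin 0 (ccourant N K (\<lambda>p. (Ep2 p, 0)) v (snd z)))"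
  unfolding F2_def
  by (simp_all add: ccourant_add_left[OF prod_mfd prod_form] ccourant_cscale_left[OF prod_mfd prod_form]
      csmooth_cscale[OF prod_mfd] clifts creal ccourant_clift1[OF M N H K] ccourant_clift2[OF M N H K]
      ccourant_clift12[OF M N H K])

text \<open>Mixed brackets vanish, and the second factor contributes
  \<open>(- \<i>)^2 [[E-, E+]] = [[E+, E-]]\<close>. The result is real, which is what the zero
  imaginary parts record.\<close>

lemma ccourant_F1_F2:
  "ccourant P HK F1 F2 z = cjoin (courant M H Ep1 Em1 (fst z), 0) (courant N K Ep2 Em2 (snd z), 0)"
proof -
  have "ccourant P HK F1 F2 z = ccourant P HK F1 (clift1 (\<lambda>p. (Em1 p, 0))) z
      + cscale (- \<i>) (ccourant P HK F1 (clift2 (\<lambda>p. (Ep2 p, 0))) z)"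
    unfolding F2_def
    by (subst ccourant_add_right[OF prod_mfd prod_form])
      (simp_all add: F_csmooth csmooth_cscale[OF prod_mfd] clifts creal
        ccourant_cscale_right[OF prod_mfd prod_form])
  then show ?thesis
    by (simp add: ccourant_F1 creal cjoin_cscale cjoin_add cscale_cscale cscale_minus_one
        ccourant_real_left[OF M H sections(1)] ccourant_real_left[OF N K sections(4)]
        courant_zero_right[OF M H sections(1)] courant_zero_right[OF N K sections(4)]
        courant_antisym[OF N K sections(3,4)])
qed

section \<open>Involutivity of the product eigenbundle versus integrability of the factors\<close>

lemma contact_integrable_if_involutive_product_J:
  assumes "involutive P HK (i_eigen J)"
  shows "contact_integrable M H \<Phi>1 Ep1 Em1" "contact_integrable N K \<Phi>2 Ep2 Em2"
proof -
  have sec: "csection_of P (i_eigen J) F1" "csection_of P (i_eigen J) F2"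
    "csection_of M (i_eigen \<Phi>1) w \<Longrightarrow> csection_of P (i_eigen J) (clift1 w)"
    "csection_of N (i_eigen \<Phi>2) v \<Longrightarrow> csection_of P (i_eigen J) (clift2 v)" for w v
    by (simp_all add: csection_of_iff F_mem F_csmooth clifts clift_eq cjoin_mem_product_J)
  have inv: "csection_of P (i_eigen J) W \<Longrightarrow> csection_of P (i_eigen J) Z \<Longrightarrow>
      ccourant P HK W Z z \<in> i_eigen J z" for W Z z
    using assms unfolding involutive_def by blast
  have zero: "courant M H Ep1 Em1 p = 0 \<and> courant N K Ep2 Em2 q = 0" for p q
  proof -
    \<comment> \<open>One half of the eigenvalue equation: \<open>J\<close> maps the imaginary part,
      here 0, to the real part.\<close>
    have "J (p, q) 0 = gjoin (courant M H Ep1 Em1 p) (courant N K Ep2 Em2 q)"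
      using inv[OF sec(1,2), of "(p, q)"] by (simp add: ccourant_F1_F2 mem_i_eigen_iff cjoin_def)
    moreover have "J (p, q) 0 = 0"
      using product_J_gjoin[of \<Phi>1 Ep1 Em1 \<Phi>2 Ep2 Em2 "(p, q)" 0 0]
      by (simp add: pairing_simps linear_0[OF lin1] linear_0[OF lin2])
    ultimately show ?thesis by simp
  qed
  show "contact_integrable M H \<Phi>1 Ep1 Em1"
    unfolding contact_integrable_def involutive_def
  proof (intro conjI allI impI)
    fix w z p
    assume w: "csection_of M (i_eigen \<Phi>1) w"
    then have sw: "csmooth M w" by (simp add: csection_of_iff)
    \<comment> \<open>Any point of the second factor serves, hence \<open>undefined\<close>: the
      bracket with a lift from the first factor depends on \<open>p\<close> only.\<close>
    show "ccourant M H (\<lambda>q. (Ep1 q, 0)) w p \<in> i_eigen \<Phi>1 p"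
      using inv[OF sec(1,3), OF w, of "(p, undefined)"]
      by (simp add: ccourant_F1(1)[OF sw] cjoin_mem_product_J)
    show "ccourant M H (\<lambda>q. (Em1 q, 0)) w p \<in> i_eigen \<Phi>1 p"
      using inv[OF sec(2,3), OF w, of "(p, undefined)"]
      by (simp add: ccourant_F2(1)[OF sw] cjoin_mem_product_J)
    assume z: "csection_of M (i_eigen \<Phi>1) z"
    then have "csmooth M z" by (simp add: csection_of_iff)
    then show "ccourant M H w z p \<in> i_eigen \<Phi>1 p"
      using inv[OF sec(3)[OF w] sec(3)[OF z], of "(p, undefined)"]
      by (simp add: ccourant_clift1[OF M N H K sw] cjoin_mem_product_J)
  qed (use zero in auto)
  \<comment> \<open>Removes the factor \<open>- \<i>\<close> with which the sections of the second
    factor enter \<open>F1\<close> and \<open>F2\<close>.\<close>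
  have i: "v \<in> i_eigen \<Phi>2 q" if "cscale (- \<i>) (cjoin 0 v) \<in> i_eigen J (p, q)" for v p q
    using csubspace_cscale[OF csubspace_product_J that, of \<i>]
    by (simp add: cscale_cscale cjoin_mem_product_J)
  show "contact_integrable N K \<Phi>2 Ep2 Em2"
    unfolding contact_integrable_def involutive_def
  proof (intro conjI allI impI)
    fix w z p
    assume w: "csection_of N (i_eigen \<Phi>2) w"
    then have sw: "csmooth N w" by (simp add: csection_of_iff)
    show "ccourant N K (\<lambda>q. (Em2 q, 0)) w p \<in> i_eigen \<Phi>2 p"
      using inv[OF sec(1,4), OF w, of "(undefined, p)"]
      by (intro i[of _ undefined]) (simp add: ccourant_F1(2)[OF sw])
    show "ccourant N K (\<lambda>q. (Ep2 q, 0)) w p \<in> i_eigen \<Phi>2 p"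
      using inv[OF sec(2,4), OF w, of "(undefined, p)"]
      by (intro i[of _ undefined]) (simp add: ccourant_F2(2)[OF sw])
    assume z: "csection_of N (i_eigen \<Phi>2) z"
    then have "csmooth N z" by (simp add: csection_of_iff)
    then show "ccourant N K w z p \<in> i_eigen \<Phi>2 p"
      using inv[OF sec(4)[OF w] sec(4)[OF z], of "(undefined, p)"]
      by (simp add: ccourant_clift2[OF M N H K sw] cjoin_mem_product_J)
  qed (use zero in auto)
qed

text \<open>The projections \<open>- \<Phi>1^2\<close> and \<open>- \<Phi>2^2\<close> split off the
  eigenvectors of the factors. The remainder lies in the span of the four sections
  \<open>E+\<close>, \<open>E-\<close>, where the eigenvalue equation ties the coefficients of the
  second factor to those of the first and leaves two parameters.\<close>

lemma product_J_decompose: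
  assumes "cjoin u v \<in> i_eigen J (p, q)"
  shows "- cext (\<Phi>1 p) (cext (\<Phi>1 p) u) \<in> i_eigen \<Phi>1 p"
    and "- cext (\<Phi>2 q) (cext (\<Phi>2 q) v) \<in> i_eigen \<Phi>2 q"
    and "\<exists>k l. cjoin u v = cjoin (- cext (\<Phi>1 p) (cext (\<Phi>1 p) u)) 0
      + cjoin 0 (- cext (\<Phi>2 q) (cext (\<Phi>2 q) v)) + cscale k (F1 (p, q)) + cscale l (F2 (p, q))"
proof -
  obtain A1 B1 where u: "u = (A1, B1)" by (cases u)
  obtain A2 B2 where v: "v = (A2, B2)" by (cases v)
  have 1: "- B1 = \<Phi>1 p A1 - (2 * pairing (Ep2 q) A2) *\<^sub>R Ep1 p - (2 * pairing (Em2 q) A2) *\<^sub>R Em1 p"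
    and 2: "- B2 = \<Phi>2 q A2 + (2 * pairing (Ep1 p) A1) *\<^sub>R Ep2 q + (2 * pairing (Em1 p) A1) *\<^sub>R Em2 q"
    and 3: "A1 = \<Phi>1 p B1 - (2 * pairing (Ep2 q) B2) *\<^sub>R Ep1 p - (2 * pairing (Em2 q) B2) *\<^sub>R Em1 p"
    and 4: "A2 = \<Phi>2 q B2 + (2 * pairing (Ep1 p) B1) *\<^sub>R Ep2 q + (2 * pairing (Em1 p) B1) *\<^sub>R Em2 q"
    using assms by (simp_all add: mem_i_eigen_iff cjoin_def u v product_J_gjoin gjoin_uminus)
  \<comment> \<open>Applying \<open>\<Phi>1\<close> or \<open>\<Phi>2\<close> to the four equations
    kills their mixing terms.\<close>
  have "\<Phi>1 p (- B1) = \<Phi>1 p (\<Phi>1 p A1)" "\<Phi>1 p A1 = \<Phi>1 p (\<Phi>1 p B1)"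
    "\<Phi>2 q (- B2) = \<Phi>2 q (\<Phi>2 q A2)" "\<Phi>2 q A2 = \<Phi>2 q (\<Phi>2 q B2)"
    by (subst 1 2 3 4, simp add: lins kernels)+
  then show "- cext (\<Phi>1 p) (cext (\<Phi>1 p) u) \<in> i_eigen \<Phi>1 p"
    "- cext (\<Phi>2 q) (cext (\<Phi>2 q) v) \<in> i_eigen \<Phi>2 q"
    by (auto intro!: minus_square_i_eigen[OF ac1] minus_square_i_eigen[OF ac2]
        simp: u v lins minus_equation_iff[of "\<Phi>1 p B1"] minus_equation_iff[of "\<Phi>2 q B2"])
  \<comment> \<open>Pairing equations 1 and 3 with \<open>Ep1\<close> and \<open>Em1\<close>
    compares the coefficients of the two factors. The coefficient of \<open>F1\<close> is then
    \<open>2 <Em1, u>\<close> and that of \<open>F2\<close> is \<open>2 <Ep1, u>\<close>, since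
    \<open>Em1\<close> is dual to \<open>Ep1\<close> and conversely.\<close>
  have "pairing (Em1 p) (- B1) = - pairing (Ep2 q) A2" "pairing (Ep1 p) (- B1) = - pairing (Em2 q) A2"
    "pairing (Em1 p) A1 = - pairing (Ep2 q) B2" "pairing (Ep1 p) A1 = - pairing (Em2 q) B2"
    by (subst 1 3, simp add: pairing_simps kernels pairings)+
  then have "cjoin u v = cjoin (- cext (\<Phi>1 p) (cext (\<Phi>1 p) u)) 0
      + cjoin 0 (- cext (\<Phi>2 q) (cext (\<Phi>2 q) v))
      + cscale (Complex (2 * pairing (Em1 p) A1) (2 * pairing (Em1 p) B1)) (F1 (p, q))
      + cscale (Complex (2 * pairing (Ep1 p) A1) (2 * pairing (Ep1 p) B1)) (F2 (p, q))"
    by (simp add: u v cext_def F_cjoin cjoin_def cscale_def gjoin_add gjoin_diff gjoin_scaleR cgvec_eq_iff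
        pairing_simps almost_contact_square[OF ac1] almost_contact_square[OF ac2])
  then show "\<exists>k l. cjoin u v = cjoin (- cext (\<Phi>1 p) (cext (\<Phi>1 p) u)) 0
      + cjoin 0 (- cext (\<Phi>2 q) (cext (\<Phi>2 q) v)) + cscale k (F1 (p, q)) + cscale l (F2 (p, q))"
    by blast
qed

text \<open>
  At the point \<open>(p, q)\<close> a section is replaced by one that agrees with it there and is a sum of lifts
  of sections of the factors, namely its slices through \<open>(p, q)\<close> with frozen coefficients.
\<close>

lemma product_J_slices:
  assumes W: "csection_of P (i_eigen J) W"
  obtains w v k l where "csection_of M (i_eigen \<Phi>1) w" "csection_of N (i_eigen \<Phi>2) v"
    "W (p, q) = clift1 w (p, q) + clift2 v (p, q) + cscale k (F1 (p, q)) + cscale l (F2 (p, q))"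
proof -
  define U where "U = (\<lambda>z. (gfst (fst (W z)), gfst (snd (W z))))"
  define V where "V = (\<lambda>z. (gsnd (fst (W z)), gsnd (snd (W z))))"
  have WUV: "W z = cjoin (U z) (V z)" for z
    by (simp add: U_def V_def cjoin_def)
  have mem: "cjoin (U (x, y)) (V (x, y)) \<in> i_eigen J (x, y)" for x y
    using W by (simp add: csection_of_iff flip: WUV)
  let ?w = "\<lambda>x. - cext (\<Phi>1 x) (cext (\<Phi>1 x) (U (x, q)))"
  let ?v = "\<lambda>y. - cext (\<Phi>2 y) (cext (\<Phi>2 y) (V (p, y)))"
  have "csmooth M (\<lambda>x. U (x, q))" "csmooth N (\<lambda>y. V (p, y))"
    using W smooth_section_slice[OF M N, of "\<lambda>z. fst (W z)"] smooth_section_slice[OF M N, of "\<lambda>z. snd (W z)"]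
    by (simp_all add: csection_of_def csmooth_def U_def V_def)
  then have "csection_of M (i_eigen \<Phi>1) ?w" "csection_of N (i_eigen \<Phi>2) ?v"
    using csmooth_minus_cext_square[OF ac1 M] csmooth_minus_cext_square[OF ac2 N]
      product_J_decompose(1,2)[OF mem]
    by (auto simp: csection_of_iff)
  moreover obtain k l where "W (p, q) = cjoin (?w p) 0 + cjoin 0 (?v q)
      + cscale k (F1 (p, q)) + cscale l (F2 (p, q))"
    using product_J_decompose(3)[OF mem, of p q] by (auto simp: WUV)
  ultimately show ?thesis
    using that[of ?w ?v k l] by (simp add: clift_eq)
qed

lemma involutive_product_J:
  assumes c1: "contact_integrable M H \<Phi>1 Ep1 Em1" and c2: "contact_integrable N K \<Phi>2 Ep2 Em2"
  shows "involutive P HK (i_eigen J)"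
  unfolding involutive_def
proof (intro allI impI)
  fix W Z y assume W: "csection_of P (i_eigen J) W" and Z: "csection_of P (i_eigen J) Z"
  \<comment> \<open>\<open>R\<close> is symmetric and closed under combinations with constant
    coefficients. The bracket of two sums of four terms thus reduces to unordered pairs of
    generators.\<close>
  define R where "R = (\<lambda>X Y. csmooth P X \<and> csmooth P Y \<and> ccourant P HK X Y y \<in> i_eigen J y)"
  note sub = csubspace_product_J[of y]
  have R_sym: "R Y X" if "R X Y" for X Y
    using that csubspace_minus[OF sub] by (auto simp: R_def ccourant_antisym[OF prod_mfd prod_form, of X Y])
  have R_comb: "R (\<lambda>z. A z + B z + cscale k (F1 z) + cscale l (F2 z)) X"
    if "R A X" "R B X" "R F1 X" "R F2 X" for A B X k l
    using that csubspace_add[OF sub] csubspace_cscale[OF sub]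
    by (simp add: R_def csmooth_add[OF prod_mfd] csmooth_cscale[OF prod_mfd]
        ccourant_add_left[OF prod_mfd prod_form] ccourant_cscale_left[OF prod_mfd prod_form])
  have s: "csmooth M w" if "csection_of M (i_eigen \<Phi>1) w" for w
    using that by (simp add: csection_of_iff)
  have t: "csmooth N v" if "csection_of N (i_eigen \<Phi>2) v" for v
    using that by (simp add: csection_of_iff)
  have R11: "R (clift1 w) (clift1 w')"
    if "csection_of M (i_eigen \<Phi>1) w" "csection_of M (i_eigen \<Phi>1) w'" for w w'
    using that c1
    by (simp add: R_def s clifts ccourant_clift1[OF M N H K] cjoin_mem_product_J contact_integrable_def
        involutive_def)
  have R22: "R (clift2 v) (clift2 v')"
    if "csection_of N (i_eigen \<Phi>2) v" "csection_of N (i_eigen \<Phi>2) v'" for v v'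
    using that c2
    by (simp add: R_def t clifts ccourant_clift2[OF M N H K] cjoin_mem_product_J contact_integrable_def
        involutive_def)
  have R12: "R (clift1 w) (clift2 v)"
    if "csection_of M (i_eigen \<Phi>1) w" "csection_of N (i_eigen \<Phi>2) v" for w v
    using that by (simp add: R_def s t clifts ccourant_clift12[OF M N H K] csubspace_zero[OF sub])
  have RF1: "R F1 (clift1 w)" "R F2 (clift1 w)" if "csection_of M (i_eigen \<Phi>1) w" for w
    using that c1
    by (simp_all add: R_def s clifts F_csmooth ccourant_F1 ccourant_F2 cjoin_mem_product_J
        contact_integrable_def)
  have RF2: "R F1 (clift2 v)" "R F2 (clift2 v)" if "csection_of N (i_eigen \<Phi>2) v" for v
    using that c2
    by (simp_all add: R_def t clifts F_csmooth ccourant_F1 ccourant_F2 cjoin_mem_product_J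
        contact_integrable_def csubspace_cscale[OF sub])
  have self: "ccourant P HK X X y = 0" if "csmooth P X" for X
    using ccourant_antisym[OF prod_mfd prod_form that that, of y]
    by (metis add.right_inverse scaleR_2 scaleR_eq_0_iff zero_neq_numeral)
  have RFF: "R F1 F1" "R F2 F2" "R F1 F2"
    using c1 c2 csubspace_zero[OF sub]
    by (auto simp: R_def F_csmooth self ccourant_F1_F2 contact_integrable_def simp flip: zero_prod_def)
  obtain w v k l where w: "csection_of M (i_eigen \<Phi>1) w" "csection_of N (i_eigen \<Phi>2) v"
    and Wy: "W y = clift1 w y + clift2 v y + cscale k (F1 y) + cscale l (F2 y)"
    using product_J_slices[OF W, of "fst y" "snd y"] by (metis prod.collapse)
  obtain w' v' k' l' where w': "csection_of M (i_eigen \<Phi>1) w'" "csection_of N (i_eigen \<Phi>2) v'"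
    and Zy: "Z y = clift1 w' y + clift2 v' y + cscale k' (F1 y) + cscale l' (F2 y)"
    using product_J_slices[OF Z, of "fst y" "snd y"] by (metis prod.collapse)
  have sec: "csection_of P (i_eigen J) (\<lambda>z. clift1 w z + clift2 v z + cscale k (F1 z) + cscale l (F2 z))"
    if "csection_of M (i_eigen \<Phi>1) w" "csection_of N (i_eigen \<Phi>2) v" for w v k l
    unfolding csection_of_iff
  proof (intro conjI allI)
    show "csmooth P (\<lambda>z. clift1 w z + clift2 v z + cscale k (F1 z) + cscale l (F2 z))"
      by (intro csmooth_add[OF prod_mfd] csmooth_cscale[OF prod_mfd] clifts F_csmooth s t that)
    show "clift1 w z + clift2 v z + cscale k (F1 z) + cscale l (F2 z) \<in> i_eigen J z" for z
      using that
      by (intro csubspace_add[OF csubspace_product_J] csubspace_cscale[OF csubspace_product_J] F_mem)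
        (auto simp: csection_of_iff clift_eq cjoin_mem_product_J)
  qed
  have "R (\<lambda>z. clift1 w z + clift2 v z + cscale k (F1 z) + cscale l (F2 z))
      (\<lambda>z. clift1 w' z + clift2 v' z + cscale k' (F1 z) + cscale l' (F2 z))"
    using w w' R11 R22 R12 RF1 RF2 RFF
    by (intro R_comb R_sym[OF R_comb]) (blast intro: R_sym)+
  then show "ccourant P HK W Z y \<in> i_eigen J y"
    by (intro ccourant_cong_at[OF prod_mfd prod_form isotropic_bundle_product_J W sec[OF w] Wy Z
          sec[OF w'] Zy]) (simp add: R_def)
qed

lemma gen_complex_product_J_iff:
  "gen_complex P HK J \<longleftrightarrow>
     contact_integrable M H \<Phi>1 Ep1 Em1 \<and> contact_integrable N K \<Phi>2 Ep2 Em2"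
  using gen_almost_complex_product_J contact_integrable_if_involutive_product_J involutive_product_J
  unfolding gen_complex_def by blast

end

section \<open>Metrics and generalized coKaehler structures\<close>

text \<open>Needed because the second complex structure exchanges the two sections on one factor;
  the bracket condition only changes sign.\<close>

lemma contact_integrable_swap:
  assumes "smooth_manifold M" "three_form M H" "gen_almost_contact M \<Phi> Ep Em"
  shows "contact_integrable M H \<Phi> Em Ep \<longleftrightarrow> contact_integrable M H \<Phi> Ep Em"
  using courant_antisym[OF assms(1,2) almost_contact_section[OF assms(3)]
      almost_contact_section[OF gen_almost_contact_swap[OF assms(3)]]]
  unfolding contact_integrable_def by auto

lemma
  assumes "gen_metric M G"
  shows gen_metric_endo: "bundle_endo M G"
    and gen_metric_adjoint: "pairing (G p u) v = pairing u (G p v)"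
    and gen_metric_involution: "G p (G p v) = v"
    and gen_metric_pos: "v \<noteq> 0 \<Longrightarrow> pairing (G p v) v > 0"
  using assms unfolding gen_metric_def is_adjoint_def by blast+

text \<open>Since \<open>\<Phi>\<close> kills \<open>E+\<close> and \<open>E-\<close>, the
  compatibility condition evaluated there reads \<open>G E+ = E-\<close> and
  \<open>G E- = E+\<close>. Hence \<open>G \<Phi> v\<close> is orthogonal to both sections and is
  fixed by \<open>- \<Phi>^2\<close>. Inserting the condition into
  \<open>\<Phi> (- \<Phi> G \<Phi> v)\<close> gives \<open>\<Phi> G v\<close>.\<close>

lemma
  assumes "gen_almost_contact_metric M \<Phi> Ep Em G"
  shows contact_metric_almost_contact: "gen_almost_contact M \<Phi> Ep Em"
    and contact_metric_metric: "gen_metric M G"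
    and contact_metric_E: "G p (Ep p) = Em p" "G p (Em p) = Ep p"
    and contact_metric_commute: "\<Phi> p (G p v) = G p (\<Phi> p v)"
proof -
  show ac: "gen_almost_contact M \<Phi> Ep Em" and G: "gen_metric M G"
    using assms by (auto simp: gen_almost_contact_metric_def)
  have c: "- \<Phi> p (G p (\<Phi> p v)) = G p v - (2 * pairing (Ep p) v) *\<^sub>R Ep p - (2 * pairing (Em p) v) *\<^sub>R Em p" for v
    using assms unfolding gen_almost_contact_metric_def tens_def by blast
  note ac' = gen_almost_contact_swap[OF ac]
  have lin: "linear (G p)" using gen_metric_endo[OF G] by (simp add: bundle_endo_iff)
  note zero = linear_0[OF lin] linear_0[OF almost_contact_linear[OF ac, of p]]
  note pr = almost_contact_pairing[OF ac, of p] almost_contact_pairing[OF ac', of p]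
  show Ep: "G p (Ep p) = Em p" and Em: "G p (Em p) = Ep p"
    using c[of "Ep p"] c[of "Em p"]
    by (simp_all add: almost_contact_kernel[OF ac] almost_contact_kernel[OF ac'] zero pr)
  have "pairing (Em p) (G p (\<Phi> p v)) = 0" "pairing (Ep p) (G p (\<Phi> p v)) = 0"
    using gen_metric_adjoint[OF G, of p "Em p" "\<Phi> p v"] gen_metric_adjoint[OF G, of p "Ep p" "\<Phi> p v"]
    by (simp_all add: Ep Em almost_contact_kernel[OF ac] almost_contact_kernel[OF ac'])
  then have "G p (\<Phi> p v) = - \<Phi> p (\<Phi> p (G p (\<Phi> p v)))"
    by (simp add: almost_contact_square[OF ac])
  also have "\<dots> = \<Phi> p (- \<Phi> p (G p (\<Phi> p v)))"
    by (simp add: linear_neg[OF almost_contact_linear[OF ac]])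
  also have "\<dots> = \<Phi> p (G p v)"
    unfolding c
    by (simp add: linear_diff[OF almost_contact_linear[OF ac]] linear_scale[OF almost_contact_linear[OF ac]]
        almost_contact_kernel[OF ac] almost_contact_kernel[OF ac'])
  finally show "\<Phi> p (G p v) = G p (\<Phi> p v)" by simp
qed

text \<open>As \<open>G\<close> is an involution commuting with \<open>\<Phi>\<close>, the square of
  \<open>G \<Phi>\<close> is that of \<open>\<Phi>\<close>. The sections may be kept in their
  original order because the conditions are symmetric in them.\<close>

lemma gen_almost_contact_metric_compose:
  assumes M: "smooth_manifold M" and cm: "gen_almost_contact_metric M \<Phi> Ep Em G"
  shows "gen_almost_contact M (\<lambda>p v. G p (\<Phi> p v)) Ep Em"
proof -
  note ac = contact_metric_almost_contact[OF cm] and G = contact_metric_metric[OF cm]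
  have "bundle_endo M (\<lambda>p v. G p (\<Phi> p v))"
    by (rule bundle_endo_compose[OF M gen_metric_endo[OF G] almost_contact_endo[OF ac]])
  moreover have "is_adjoint (\<lambda>v. G p (\<Phi> p v)) (\<lambda>v. - G p (\<Phi> p v))" for p
    unfolding is_adjoint_def
    by (simp add: gen_metric_adjoint[OF G] almost_contact_skew[OF ac] contact_metric_commute[OF cm]
        pairing_minus_right)
  moreover have "G p (\<Phi> p (G p (\<Phi> p v))) = \<Phi> p (\<Phi> p v)" for p v
    by (simp add: contact_metric_commute[OF cm] gen_metric_involution[OF G])
  ultimately show ?thesis
    using ac unfolding gen_almost_contact_def by simp
qed

text \<open>\<open>G\<close> merely exchanges \<open>E+\<close> and \<open>E-\<close>, and
  strongness is symmetric in them. The vanishing of \<open>[[E+, E-]]\<close> is shared by the two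
  structures, so strongness of \<open>G \<Phi>\<close> amounts to its normality.\<close>

lemma gen_cokahler_iff:
  assumes M: "smooth_manifold M" and H: "three_form M H" and "gen_contact_metric M H \<Phi> Ep Em G"
  shows "gen_cokahler M H \<Phi> Ep Em G \<longleftrightarrow> contact_integrable M H \<Phi> Ep Em \<and>
     contact_integrable M H (\<lambda>p v. G p (\<Phi> p v)) Ep Em"
proof -
  have cm: "gen_almost_contact_metric M \<Phi> Ep Em G"
    using assms(3) by (simp add: gen_contact_metric_def)
  note ac = contact_metric_almost_contact[OF cm]
  note ac' = gen_almost_contact_metric_compose[OF M cm]
  have "strong_gen_contact M H (\<lambda>p v. G p (\<Phi> p v)) (\<lambda>p. G p (Ep p)) (\<lambda>p. G p (Em p))
      \<longleftrightarrow> strong_gen_contact M H (\<lambda>p v. G p (\<Phi> p v)) Ep Em"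
    using ac' gen_almost_contact_swap[OF ac']
    by (auto simp: contact_metric_E[OF cm] strong_gen_contact_def)
  then show ?thesis
    using assms(3) normal_gen_contact_iff[OF M H ac] normal_gen_contact_iff[OF M H ac']
    by (auto simp: gen_cokahler_def normal_gen_contact_def)
qed

lemma gen_metric_prod:
  assumes M: "smooth_manifold M" and N: "smooth_manifold N" and G: "gen_metric M G1" "gen_metric N G2"
  shows "gen_metric (manifold_prod M N) (endo_prod G1 G2)"
  unfolding gen_metric_def is_adjoint_def
proof (intro conjI allI impI)
  show "bundle_endo (manifold_prod M N) (endo_prod G1 G2)"
    by (intro bundle_endo_prod M N gen_metric_endo G)
  fix z and u v :: "('b \<times> 'd) gvec"
  obtain u1 u2 v1 v2 where u: "u = gjoin u1 u2" and v: "v = gjoin v1 v2"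
    by (metis gvec_prod_cases)
  show "pairing (endo_prod G1 G2 z u) v = pairing u (endo_prod G1 G2 z v)"
    by (simp add: u v endo_prod_gjoin pairing_gjoin gen_metric_adjoint[OF G(1)] gen_metric_adjoint[OF G(2)])
  show "endo_prod G1 G2 z (endo_prod G1 G2 z v) = v"
    by (simp add: v endo_prod_gjoin gen_metric_involution[OF G(1)] gen_metric_involution[OF G(2)])
  assume "v \<noteq> 0"
  then have "v1 \<noteq> 0 \<or> v2 \<noteq> 0" by (auto simp: v)
  moreover have "pairing (G1 (fst z) v1) v1 \<ge> 0" "pairing (G2 (snd z) v2) v2 \<ge> 0"
    using gen_metric_pos[OF G(1), of v1 "fst z"] gen_metric_pos[OF G(2), of v2 "snd z"]
    by (cases "v1 = 0"; cases "v2 = 0"; simp add: pairing_zero_right)+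
  ultimately have "pairing (G1 (fst z) v1) v1 + pairing (G2 (snd z) v2) v2 > 0"
    using gen_metric_pos[OF G(1), of v1 "fst z"] gen_metric_pos[OF G(2), of v2 "snd z"]
    by (metis add_pos_nonneg add_nonneg_pos)
  then show "pairing (endo_prod G1 G2 z v) v > 0"
    by (simp add: v endo_prod_gjoin pairing_gjoin)
qed

text \<open>\<open>G\<close> exchanges the output sections of the mixing terms but leaves the
  pairings with the input alone, so \<open>Ep1\<close> becomes matched with \<open>Em2\<close>. On
  the input side self-adjointness makes the same exchange, which gives commutation.\<close>

lemma endo_prod_product_J:
  assumes "gen_almost_contact_metric M \<Phi>1 Ep1 Em1 G1" "gen_almost_contact_metric N \<Phi>2 Ep2 Em2 G2"
  shows "endo_prod G1 G2 z (product_J \<Phi>1 Ep1 Em1 \<Phi>2 Ep2 Em2 z v)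
      = product_J (\<lambda>p v. G1 p (\<Phi>1 p v)) Ep1 Em1 (\<lambda>p v. G2 p (\<Phi>2 p v)) Em2 Ep2 z v"
    and "product_J \<Phi>1 Ep1 Em1 \<Phi>2 Ep2 Em2 z (endo_prod G1 G2 z v)
      = endo_prod G1 G2 z (product_J \<Phi>1 Ep1 Em1 \<Phi>2 Ep2 Em2 z v)"
proof -
  obtain v1 v2 where v: "v = gjoin v1 v2" by (rule gvec_prod_cases)
  note G = contact_metric_metric[OF assms(1)] contact_metric_metric[OF assms(2)]
  have lin: "linear (G1 p)" "linear (G2 q)" for p q
    using gen_metric_endo[OF G(1)] gen_metric_endo[OF G(2)] by (auto simp: bundle_endo_iff)
  note lins = linear_add[OF lin(1)] linear_diff[OF lin(1)] linear_scale[OF lin(1)]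
    linear_add[OF lin(2)] linear_diff[OF lin(2)] linear_scale[OF lin(2)]
  note E = contact_metric_E[OF assms(1)] contact_metric_E[OF assms(2)]
  show "endo_prod G1 G2 z (product_J \<Phi>1 Ep1 Em1 \<Phi>2 Ep2 Em2 z v)
      = product_J (\<lambda>p v. G1 p (\<Phi>1 p v)) Ep1 Em1 (\<lambda>p v. G2 p (\<Phi>2 p v)) Em2 Ep2 z v"
    by (simp add: v product_J_gjoin endo_prod_gjoin lins E)
  have "pairing (Ep1 p) (G1 p u) = pairing (Em1 p) u" "pairing (Em1 p) (G1 p u) = pairing (Ep1 p) u" for p u
    using gen_metric_adjoint[OF G(1), of p "Ep1 p" u] gen_metric_adjoint[OF G(1), of p "Em1 p" u]
    by (simp_all add: E)
  moreover have "pairing (Ep2 q) (G2 q u) = pairing (Em2 q) u" "pairing (Em2 q) (G2 q u) = pairing (Ep2 q) u" for q u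
    using gen_metric_adjoint[OF G(2), of q "Ep2 q" u] gen_metric_adjoint[OF G(2), of q "Em2 q" u]
    by (simp_all add: E)
  ultimately show "product_J \<Phi>1 Ep1 Em1 \<Phi>2 Ep2 Em2 z (endo_prod G1 G2 z v)
      = endo_prod G1 G2 z (product_J \<Phi>1 Ep1 Em1 \<Phi>2 Ep2 Em2 z v)"
    by (simp add: v product_J_gjoin endo_prod_gjoin lins E contact_metric_commute[OF assms(1)]
        contact_metric_commute[OF assms(2)])
qed

theorem theorem1p3:
  fixes M1 :: "('a::{second_countable_topology, t2_space}, 'e::euclidean_space) manifold"
    and M2 :: "('b::{second_countable_topology, t2_space}, 'f::euclidean_space) manifold"
    and H1 :: "'a \<Rightarrow> 'e \<Rightarrow> 'e \<Rightarrow> 'e \<Rightarrow> real"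
    and H2 :: "'b \<Rightarrow> 'f \<Rightarrow> 'f \<Rightarrow> 'f \<Rightarrow> real"
    and \<Phi>1 G1 :: "'a \<Rightarrow> 'e gvec \<Rightarrow> 'e gvec" and Ep1 Em1 :: "'a \<Rightarrow> 'e gvec"
    and \<Phi>2 G2 :: "'b \<Rightarrow> 'f gvec \<Rightarrow> 'f gvec" and Ep2 Em2 :: "'b \<Rightarrow> 'f gvec"
  assumes "smooth_manifold M1" and "odd DIM('e)"
    and "smooth_manifold M2" and "odd DIM('f)"
    and "closed_three_form M1 H1" and "closed_three_form M2 H2"
    and "gen_contact_metric M1 H1 \<Phi>1 Ep1 Em1 G1"
    and "gen_contact_metric M2 H2 \<Phi>2 Ep2 Em2 G2"
  shows
    "let G = endo_prod G1 G2;
         J1 = product_J \<Phi>1 Ep1 Em1 \<Phi>2 Ep2 Em2;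
         J2 = (\<lambda>p v. G p (J1 p v))
     in gen_kahler (manifold_prod M1 M2) (form_sum H1 H2) J1 J2 \<longleftrightarrow>
        gen_cokahler M1 H1 \<Phi>1 Ep1 Em1 G1 \<and> gen_cokahler M2 H2 \<Phi>2 Ep2 Em2 G2"
proof -
  note M = assms(1) and N = assms(3)
  have H: "three_form M1 H1" and K: "three_form M2 H2"
    using assms(5,6) by (auto simp: closed_three_form_def)
  have cm1: "gen_almost_contact_metric M1 \<Phi>1 Ep1 Em1 G1" and cm2: "gen_almost_contact_metric M2 \<Phi>2 Ep2 Em2 G2"
    using assms(7,8) by (auto simp: gen_contact_metric_def)
  note ac1 = contact_metric_almost_contact[OF cm1] and ac2 = contact_metric_almost_contact[OF cm2]
  note ac1' = gen_almost_contact_metric_compose[OF M cm1]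
    and ac2' = gen_almost_contact_metric_compose[OF N cm2]
  let ?G = "endo_prod G1 G2" and ?J = "product_J \<Phi>1 Ep1 Em1 \<Phi>2 Ep2 Em2"
  have J2: "(\<lambda>z v. ?G z (?J z v))
      = product_J (\<lambda>p v. G1 p (\<Phi>1 p v)) Ep1 Em1 (\<lambda>p v. G2 p (\<Phi>2 p v)) Em2 Ep2"
    by (intro ext endo_prod_product_J(1)[OF cm1 cm2])
  have JJ: "?J z (?J z v) = - v" for z v
    using gen_almost_complex_product_J[OF M N H K ac1 ac2] unfolding gen_almost_complex_def by blast
  have lin: "linear (?G z)" for z
    using bundle_endo_prod[OF M N] gen_metric_endo contact_metric_metric[OF cm1] contact_metric_metric[OF cm2]
    by (metis bundle_endo_iff)
  \<comment> \<open>\<open>- J1 J2 = - G J1^2 = G\<close> by commutation, so the metric condition of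
    a Kaehler structure holds from the start and only the two integrability conditions
    remain.\<close>
  have G: "(\<lambda>z v. - ?G z (?J z (?J z v))) = ?G"
    by (intro ext) (simp add: JJ linear_neg[OF lin])
  have "gen_kahler (manifold_prod M1 M2) (form_sum H1 H2) ?J (\<lambda>z v. ?G z (?J z v)) \<longleftrightarrow>
      gen_complex (manifold_prod M1 M2) (form_sum H1 H2) ?J \<and>
      gen_complex (manifold_prod M1 M2) (form_sum H1 H2) (\<lambda>z v. ?G z (?J z v))"
    using gen_metric_prod[OF M N contact_metric_metric[OF cm1] contact_metric_metric[OF cm2]]
    by (simp add: gen_kahler_def G endo_prod_product_J(2)[OF cm1 cm2])
  also have "\<dots> \<longleftrightarrow> gen_cokahler M1 H1 \<Phi>1 Ep1 Em1 G1 \<and> gen_cokahler M2 H2 \<Phi>2 Ep2 Em2 G2"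
    unfolding J2 gen_complex_product_J_iff[OF M N H K ac1 ac2]
      gen_complex_product_J_iff[OF M N H K ac1' gen_almost_contact_swap[OF ac2']]
      gen_cokahler_iff[OF M H assms(7)] gen_cokahler_iff[OF N K assms(8)]
      contact_integrable_swap[OF N K ac2']
    by blast
  finally show ?thesis
    by (simp add: Let_def)
qed

end
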